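(* Let $\Omega\subset\mathbb{R}^3$ be a simply-connected bounded open set with smooth boundary. For each $L>0$ let $Q^{(L)}$ be a global minimizer of $\tilde F_{LG}$ in $\mathcal{A}_Q$. Assume that $L_k\to0^+$ is a sequence such that $Q^{(L_k)}\to Q^{(0)}$ in $W^{1,2}(\Omega;S_0)$, where $Q^{(0)}$ is a limiting harmonic map. Then for any compact $K\subset\Omega$ such that $Q^{(0)}$ has no singularity in $K$, $$\lim_{L_k\to0}\tilde f_B(Q^{(L_k)}(x))=0,\qquad x\in K,$$ and the limit is uniform on $K$.
   Context: Fix constants $a^2,b^2,c^2>0$. $S_0$ is the space of real symmetric traceless $3\times3$ matrices, with norm $|Q|=\sqrt{\mathrm{tr}\,Q^2}$; $Id$ is the identity matrix and $S^2\subset\mathbb{R}^3$ the unit sphere. Let $f_B(Q)=-\frac{a^2}{2}\mathrm{tr}(Q^2)-\frac{b^2}{3}\mathrm{tr}(Q^3)+\frac{c^2}{4}(\mathrm{tr}\,Q^2)^2$ and $\tilde f_B(Q)=f_B(Q)-\min_{S_0}f_B\ge 0$. Let $s_+=\frac{b^2+\sqrt{b^4+24a^2c^2}}{4c^2}$. Fix $n_b\in C^\infty(\partial\Omega;S^2)$ and set $Q_b=s_+(n_b\otimes n_b-\frac13 Id)$. The admissible class is $\mathcal{A}_Q=\{Q\in W^{1,2}(\Omega;S_0): Q=Q_b \text{ on }\partial\Omega\}$. For $L>0$, $\tilde F_{LG}[Q]=\int_\Omega \frac L2|\nabla Q|^2+\tilde f_B(Q)\,dx$, where $|\nabla Q|^2=\sum_{i,j,k}(\partial_kQ_{ij})^2$.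 Global minimizers are smooth, so pointwise values make sense. A limiting harmonic map is a map $Q^{(0)}=s_+(n^{(0)}\otimes n^{(0)}-\frac13 Id)$ where $n^{(0)}$ is a (not necessarily unique) minimizer of $\int_\Omega|\nabla n|^2\,dx$ over $\mathcal{A}_n=\{n\in W^{1,2}(\Omega;S^2): n=n_b\text{ on }\partial\Omega\}$. Its singularities are the points having no neighbourhood on which $n^{(0)}$ (equivalently $Q^{(0)}$) is smooth; there are at most finitely many, and they are isolated. *)

theory Defs
  imports "HOL-Analysis.Analysis"
begin

section \<open>Smooth functions and domains with smooth boundary\<close>

primrec Ck_on :: "nat \<Rightarrow> 'a::euclidean_space set \<Rightarrow> ('a \<Rightarrow> 'b::real_normed_vector) \<Rightarrow> bool" where
  "Ck_on 0 U f \<longleftrightarrow> continuous_on U f"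
| "Ck_on (Suc n) U f \<longleftrightarrow>
     (\<forall>x\<in>U. f differentiable (at x)) \<and>
     (\<forall>v\<in>Basis. Ck_on n U (\<lambda>x. frechet_derivative f (at x) v))"

definition smooth_on :: "'a::euclidean_space set \<Rightarrow> ('a \<Rightarrow> 'b::real_normed_vector) \<Rightarrow> bool" where
  "smooth_on U f \<longleftrightarrow> open U \<and> (\<forall>n. Ck_on n U f)"

text \<open>Smoothness on a set that need not be open, such as a hypersurface: local existence of
  smooth extensions to open sets of the ambient space.\<close>

definition smooth_map_on :: "'a::euclidean_space set \<Rightarrow> ('a \<Rightarrow> 'b::real_normed_vector) \<Rightarrow> bool" where
  "smooth_map_on A f \<longleftrightarrow>
     (\<forall>p\<in>A. \<exists>U g. p \<in> U \<and> smooth_on U g \<and> (\<forall>x\<in>U \<inter> A. g x = f x))"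

text \<open>Near each boundary point the set is, after a linear isometry of the coordinates (which may
  permute or reflect the axes), the region strictly above the graph of a smooth function.\<close>

definition smooth_boundary :: "(real^3) set \<Rightarrow> bool" where
  "smooth_boundary \<Omega> \<longleftrightarrow>
     (\<forall>p\<in>frontier \<Omega>. \<exists>r (T :: real^3 \<Rightarrow> real^3) (\<gamma> :: real \<times> real \<Rightarrow> real).
        r > 0 \<and> orthogonal_transformation T \<and> smooth_on UNIV \<gamma> \<and>
        \<Omega> \<inter> ball p r = {x \<in> ball p r. \<gamma> (T x $ 1, T x $ 2) < T x $ 3})"


section \<open>Sobolev spaces\<close>

text \<open>Elements of Sobolev spaces are represented by functions on the whole space; only their
  values almost everywhere on \<open>\<Omega>\<close> matter.\<close>

definition test_function :: "'a::euclidean_space set \<Rightarrow> ('a \<Rightarrow> 'b::real_normed_vector) \<Rightarrow> bool" where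
  "test_function \<Omega> \<phi> \<longleftrightarrow>
     smooth_on UNIV \<phi> \<and> (\<exists>K. compact K \<and> K \<subseteq> \<Omega> \<and> (\<forall>x. x \<notin> K \<longrightarrow> \<phi> x = 0))"

definition locally_integrable_on :: "'a::euclidean_space set \<Rightarrow> ('a \<Rightarrow> 'b::euclidean_space) \<Rightarrow> bool" where
  "locally_integrable_on \<Omega> u \<longleftrightarrow> (\<forall>K. compact K \<and> K \<subseteq> \<Omega> \<longrightarrow> integrable (lebesgue_on K) u)"

definition has_weak_deriv ::
  "'a::euclidean_space set \<Rightarrow> ('a \<Rightarrow> 'b::euclidean_space) \<Rightarrow> 'a \<Rightarrow> ('a \<Rightarrow> 'b) \<Rightarrow> bool" where
  "has_weak_deriv \<Omega> u v w \<longleftrightarrow>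
     locally_integrable_on \<Omega> u \<and> locally_integrable_on \<Omega> w \<and>
     (\<forall>\<phi> :: 'a \<Rightarrow> real. test_function \<Omega> \<phi> \<longrightarrow>
        (LINT x|lebesgue_on \<Omega>. frechet_derivative \<phi> (at x) v *\<^sub>R u x) =
        - (LINT x|lebesgue_on \<Omega>. \<phi> x *\<^sub>R w x))"

text \<open>The weak derivative is unique only up to null sets; the choice is immaterial below, where
  it occurs under integrals only.\<close>

definition weak_deriv ::
  "'a::euclidean_space set \<Rightarrow> ('a \<Rightarrow> 'b::euclidean_space) \<Rightarrow> 'a \<Rightarrow> 'a \<Rightarrow> 'b" where
  "weak_deriv \<Omega> u v = (SOME w. has_weak_deriv \<Omega> u v w)"

text \<open>For \<open>u\<close> with values in \<^typ>\<open>real^3^3\<close>, whose norm is the Frobenius norm, this is the sum of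
  the squares of all first partial derivatives of all entries.\<close>

definition weak_grad_sq :: "'a::euclidean_space set \<Rightarrow> ('a \<Rightarrow> 'b::euclidean_space) \<Rightarrow> 'a \<Rightarrow> real" where
  "weak_grad_sq \<Omega> u x = (\<Sum>v\<in>Basis. (norm (weak_deriv \<Omega> u v x))\<^sup>2)"

definition square_integrable_on :: "'a::euclidean_space set \<Rightarrow> ('a \<Rightarrow> 'b::euclidean_space) \<Rightarrow> bool" where
  "square_integrable_on \<Omega> u \<longleftrightarrow>
     u \<in> borel_measurable (lebesgue_on \<Omega>) \<and> integrable (lebesgue_on \<Omega>) (\<lambda>x. (norm (u x))\<^sup>2)"

definition W12 :: "'a::euclidean_space set \<Rightarrow> 'b::euclidean_space set \<Rightarrow> ('a \<Rightarrow> 'b) set" where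
  "W12 \<Omega> T = {u. square_integrable_on \<Omega> u \<and>
     (\<forall>v\<in>Basis. \<exists>w. has_weak_deriv \<Omega> u v w \<and> square_integrable_on \<Omega> w) \<and>
     (AE x in lebesgue_on \<Omega>. u x \<in> T)}"

definition W12_norm :: "'a::euclidean_space set \<Rightarrow> ('a \<Rightarrow> 'b::euclidean_space) \<Rightarrow> real" where
  "W12_norm \<Omega> u = sqrt (LINT x|lebesgue_on \<Omega>. (norm (u x))\<^sup>2 + weak_grad_sq \<Omega> u x)"

definition tendsto_W12 ::
  "'a::euclidean_space set \<Rightarrow> 'b::euclidean_space set \<Rightarrow> (nat \<Rightarrow> 'a \<Rightarrow> 'b) \<Rightarrow> ('a \<Rightarrow> 'b) \<Rightarrow> bool" where
  "tendsto_W12 \<Omega> T u v \<longleftrightarrow>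
     (\<forall>k. u k \<in> W12 \<Omega> T) \<and> v \<in> W12 \<Omega> T \<and>
     (\<lambda>k. W12_norm \<Omega> (\<lambda>x. u k x - v x)) \<longlonglongrightarrow> 0"

definition W12_0 :: "'a::euclidean_space set \<Rightarrow> ('a \<Rightarrow> 'b::euclidean_space) set" where
  "W12_0 \<Omega> = {u. \<exists>\<phi>. (\<forall>j. test_function \<Omega> (\<phi> j)) \<and> tendsto_W12 \<Omega> UNIV \<phi> u}"

text \<open>Boundary values of a Sobolev function: \<open>u\<close> differs by an element of \<^const>\<open>W12_0\<close> from a Sobolev
  function that is continuous up to the boundary and equals \<open>g\<close> there. Two such extensions of
  the same \<open>g\<close> differ by an element of \<^const>\<open>W12_0\<close>, so the choice of \<open>G\<close> does not matter.\<close>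

definition boundary_values :: "'a::euclidean_space set \<Rightarrow> ('a \<Rightarrow> 'b::euclidean_space) \<Rightarrow> ('a \<Rightarrow> 'b) \<Rightarrow> bool" where
  "boundary_values \<Omega> u g \<longleftrightarrow>
     (\<exists>G. G \<in> W12 \<Omega> UNIV \<and> continuous_on (closure \<Omega>) G \<and> (\<forall>x\<in>frontier \<Omega>. G x = g x) \<and>
          (\<lambda>x. u x - G x) \<in> W12_0 \<Omega>)"


section \<open>The Landau-de Gennes energy\<close>

definition S0 :: "(real^3^3) set" where
  "S0 = {Q. transpose Q = Q \<and> trace Q = 0}"

definition f_B :: "real \<Rightarrow> real \<Rightarrow> real \<Rightarrow> real^3^3 \<Rightarrow> real" where
  "f_B a b c Q =
     - (a\<^sup>2 / 2) * trace (Q ** Q) - (b\<^sup>2 / 3) * trace (Q ** Q ** Q)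
     + (c\<^sup>2 / 4) * (trace (Q ** Q))\<^sup>2"

definition f_B_tilde :: "real \<Rightarrow> real \<Rightarrow> real \<Rightarrow> real^3^3 \<Rightarrow> real" where
  "f_B_tilde a b c Q = f_B a b c Q - (INF P\<in>S0. f_B a b c P)"

definition s_plus :: "real \<Rightarrow> real \<Rightarrow> real \<Rightarrow> real" where
  "s_plus a b c = (b\<^sup>2 + sqrt (b ^ 4 + 24 * a\<^sup>2 * c\<^sup>2)) / (4 * c\<^sup>2)"

definition tensor :: "real^3 \<Rightarrow> real^3 \<Rightarrow> real^3^3" (infixl "\<otimes>" 70) where
  "m \<otimes> n = (\<chi> i j. m $ i * n $ j)"

definition uniaxial :: "real \<Rightarrow> (real^3 \<Rightarrow> real^3) \<Rightarrow> real^3 \<Rightarrow> real^3^3" where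
  "uniaxial s n x = s *\<^sub>R (n x \<otimes> n x - (1/3) *\<^sub>R mat 1)"

definition admissible_Q :: "(real^3) set \<Rightarrow> (real^3 \<Rightarrow> real^3^3) \<Rightarrow> (real^3 \<Rightarrow> real^3^3) set" where
  "admissible_Q \<Omega> Qb = {Q \<in> W12 \<Omega> S0. boundary_values \<Omega> Q Qb}"

text \<open>The integrand is nonnegative on \<^const>\<open>S0\<close>-valued maps; the integral is taken in \<^typ>\<open>ennreal\<close> so
  that a nonintegrable bulk term would give infinite energy instead of the default value 0.\<close>

definition F_LG ::
  "real \<Rightarrow> real \<Rightarrow> real \<Rightarrow> (real^3) set \<Rightarrow> real \<Rightarrow> (real^3 \<Rightarrow> real^3^3) \<Rightarrow> ennreal" where
  "F_LG a b c \<Omega> L Q =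
     (\<integral>\<^sup>+x. ennreal (L / 2 * weak_grad_sq \<Omega> Q x + f_B_tilde a b c (Q x)) \<partial>lebesgue_on \<Omega>)"


section \<open>Limiting harmonic maps\<close>

definition admissible_n :: "(real^3) set \<Rightarrow> (real^3 \<Rightarrow> real^3) \<Rightarrow> (real^3 \<Rightarrow> real^3) set" where
  "admissible_n \<Omega> nb = {n \<in> W12 \<Omega> (sphere 0 1). boundary_values \<Omega> n nb}"

definition dirichlet_energy :: "(real^3) set \<Rightarrow> (real^3 \<Rightarrow> real^3) \<Rightarrow> real" where
  "dirichlet_energy \<Omega> n = (LINT x|lebesgue_on \<Omega>. weak_grad_sq \<Omega> n x)"

definition limiting_harmonic_map ::
  "real \<Rightarrow> (real^3) set \<Rightarrow> (real^3 \<Rightarrow> real^3) \<Rightarrow> (real^3 \<Rightarrow> real^3^3) \<Rightarrow> bool" where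
  "limiting_harmonic_map s \<Omega> nb Q0 \<longleftrightarrow>
     (\<exists>n0. is_arg_min (dirichlet_energy \<Omega>) (\<lambda>n. n \<in> admissible_n \<Omega> nb) n0 \<and>
           (AE x in lebesgue_on \<Omega>. Q0 x = uniaxial s n0 x))"

text \<open>Smoothness of a Sobolev map near a point means that it agrees almost everywhere with a
  smooth function there.\<close>

definition singularities :: "(real^3) set \<Rightarrow> (real^3 \<Rightarrow> 'b::real_normed_vector) \<Rightarrow> (real^3) set" where
  "singularities \<Omega> u =
     {p \<in> \<Omega>. \<not> (\<exists>U g. p \<in> U \<and> U \<subseteq> \<Omega> \<and> smooth_on U g \<and> (AE x in lebesgue_on U. u x = g x))}"

end

theory Submission
  imports Defs
begin

text \<open>Write \<open>W\<close> for the bulk density \<^const>\<open>f_B_tilde\<close>, \<open>u\<^sub>k\<close> for the minimizer with constant \<open>L\<^sub>k\<close>, and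
  \<open>e\<^sub>k = |\<nabla>u\<^sub>k|\<^sup>2 / 2 + W(u\<^sub>k) / L\<^sub>k\<close> for its rescaled energy density. Suppose that \<open>W(u\<^sub>k(x)) \<ge> \<delta>\<close> at a point \<open>x\<close> near
  \<open>K\<close>. The length scale of \<open>u\<^sub>k\<close> is \<open>sqrt L\<^sub>k\<close>: interior estimates give \<open>|u\<^sub>k| \<le> M\<close> and \<open>|\<nabla>u\<^sub>k| \<le> G / sqrt L\<^sub>k\<close>
  (\<open>interior_bounds\<close>). Hence \<open>W(u\<^sub>k) \<ge> \<delta>/2\<close> on the ball of radius \<open>\<sigma> = \<kappa> sqrt L\<^sub>k\<close> around \<open>x\<close>, with \<open>\<kappa>\<close> independent of
  \<open>k\<close>, and \<open>(1/\<sigma>) \<integral> W(u\<^sub>k) / L\<^sub>k\<close> over this ball is bounded below by a positive constant. The monotonicity formula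
  (\<open>bulk_monotonicity\<close>) bounds it from above, up to a factor, by \<open>(1/R) \<integral> e\<^sub>k\<close> over the ball of a fixed radius \<open>R\<close>.

  The latter is small. By strong convergence the Dirichlet part is close to that of \<open>Q0\<close>, and the gradient of \<open>Q0\<close> is
  bounded near a point of smoothness, so it contributes \<open>O(R\<^sup>2)\<close>. The bulk part tends to zero because
  \<open>\<integral> W(u\<^sub>k) / L\<^sub>k\<close> over \<open>\<Omega>\<close> does (\<open>bulk_energy_over_L_tendsto_0\<close>). A small \<open>R\<close> and then a large \<open>k\<close> contradict the lower
  bound (\<open>bulk_uniformly_small_near_regular_point\<close>), and finitely many balls cover \<open>K\<close>.

  The decay of the bulk energy comes from comparing the minimizers with each other. They all have the same boundary
  data, and so do their modifications by test functions; no other competitors occur, apart from one that shows that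
  the energies are finite. The energy inequalities between \<open>u\<^sub>k\<close> and \<open>u\<^sub>j\<close> control \<open>\<integral> W(u\<^sub>k) / L\<^sub>k\<close> by the gap between the
  Dirichlet energy of \<open>u\<^sub>k\<close> and its limit.

  The interior estimates follow from the Euler-Lagrange equation (\<open>euler_lagrange\<close>) by pointwise maximum principles: a
  Keller-Osserman bound for \<open>|u|\<^sup>2\<close>, from the quartic growth of \<open>W\<close>, and a barrier for the gradient. The monotonicity
  formula is the divergence theorem for the stress tensor contracted with a radial field.\<close>

section \<open>Calculus of smooth functions\<close>

abbreviation pd :: "'a::euclidean_space \<Rightarrow> ('a \<Rightarrow> 'b::real_normed_vector) \<Rightarrow> 'a \<Rightarrow> 'b" where
  "pd v f x \<equiv> frechet_derivative f (at x) v"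

lemma Ck_on_SucD_derivative:
  "Ck_on (Suc n) U f \<Longrightarrow> x \<in> U \<Longrightarrow> (f has_derivative frechet_derivative f (at x)) (at x)"
  by (simp add: frechet_derivative_works[symmetric])

lemma Ck_on_cong:
  assumes "open U" "\<And>x. x \<in> U \<Longrightarrow> f x = g x" "Ck_on n U f"
  shows "Ck_on n U g"
  using assms(2,3)
proof (induction n arbitrary: f g)
  case 0
  then show ?case by (simp cong: continuous_on_cong)
next
  case (Suc n)
  have d: "(g has_derivative frechet_derivative f (at x)) (at x)" if "x \<in> U" for x
    using has_derivative_transform_within_open[OF Ck_on_SucD_derivative[OF Suc.prems(2) that] assms(1) that]
      Suc.prems(1) by blast
  have e: "frechet_derivative f (at x) = frechet_derivative g (at x)" if "x \<in> U" for x
    using d[OF that] frechet_derivative_at by blast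
  have "Ck_on n U (pd v g)" if "v \<in> Basis" for v
    using Suc.IH[of "pd v f" "pd v g"] Suc.prems that e by auto
  moreover have "g differentiable at x" if "x \<in> U" for x
    using d[OF that] by (rule differentiableI)
  ultimately show ?case by simp
qed

lemma Ck_on_SucI:
  assumes "open U" "\<And>x. x \<in> U \<Longrightarrow> (f has_derivative D x) (at x)"
    "\<And>v. v \<in> Basis \<Longrightarrow> Ck_on n U (\<lambda>x. D x v)"
  shows "Ck_on (Suc n) U f"
proof -
  have e: "D x v = pd v f x" if "x \<in> U" for x v
    using frechet_derivative_at[OF assms(2)[OF that]] by simp
  have "Ck_on n U (pd v f)" if "v \<in> Basis" for v
    using Ck_on_cong[OF assms(1) e assms(3)[OF that]] .
  moreover have "f differentiable at x" if "x \<in> U" for x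
    using assms(2)[OF that] by (rule differentiableI)
  ultimately show ?thesis by simp
qed

lemma Ck_on_subset: "Ck_on n U f \<Longrightarrow> V \<subseteq> U \<Longrightarrow> Ck_on n V f"
  by (induction n arbitrary: f) (auto intro: continuous_on_subset)

lemma Ck_on_Un:
  assumes "open U" "open V" "Ck_on n U f" "Ck_on n V f"
  shows "Ck_on n (U \<union> V) f"
  using assms(3,4)
  by (induction n arbitrary: f) (auto intro: continuous_on_open_Un assms)

lemma Ck_on_imp_continuous_on:
  assumes "Ck_on n U f"
  shows "continuous_on U f"
proof (cases n)
  case (Suc m)
  then show ?thesis
    using assms by (auto intro!: continuous_at_imp_continuous_on differentiable_imp_continuous_within)
qed (use assms in auto)

lemma Ck_on_SucD: "Ck_on (Suc n) U f \<Longrightarrow> Ck_on n U f"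
proof (induction n arbitrary: f)
  case 0
  then show ?case using Ck_on_imp_continuous_on[OF 0] by simp
next
  case (Suc n)
  then show ?case by (meson Ck_on.simps(2))
qed

lemma Ck_on_const: "Ck_on n U (\<lambda>x. c)"
  by (induction n arbitrary: c) auto

lemma Ck_on_add:
  assumes "open U" "Ck_on n U f" "Ck_on n U g"
  shows "Ck_on n U (\<lambda>x. f x + g x)"
  using assms(2,3)
proof (induction n arbitrary: f g)
  case 0
  then show ?case by (auto intro!: continuous_on_add)
next
  case (Suc n)
  show ?case
  proof (rule Ck_on_SucI[OF assms(1)])
    show "((\<lambda>x. f x + g x) has_derivative (\<lambda>v. pd v f x + pd v g x)) (at x)" if "x \<in> U" for x
      by (intro has_derivative_add Suc.prems[THEN Ck_on_SucD_derivative] that)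
    show "Ck_on n U (\<lambda>x. pd v f x + pd v g x)" if "v \<in> Basis" for v
      by (rule Suc.IH) (use Suc.prems that in auto)
  qed
qed

lemma Ck_on_bilinear:
  assumes "bounded_bilinear p" "open U" "Ck_on n U f" "Ck_on n U g"
  shows "Ck_on n U (\<lambda>x. p (f x) (g x))"
  using assms(3,4)
proof (induction n arbitrary: f g)
  case 0
  then show ?case using bounded_bilinear.continuous_on[OF assms(1)] by simp
next
  case (Suc n)
  note lower = Suc.prems[THEN Ck_on_SucD]
  show ?case
  proof (rule Ck_on_SucI[OF assms(2)])
    show "((\<lambda>x. p (f x) (g x)) has_derivative (\<lambda>v. p (f x) (pd v g x) + p (pd v f x) (g x))) (at x)"
      if "x \<in> U" for x
      by (intro bounded_bilinear.FDERIV[OF assms(1)] Suc.prems[THEN Ck_on_SucD_derivative] that)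
    show "Ck_on n U (\<lambda>x. p (f x) (pd v g x) + p (pd v f x) (g x))" if "v \<in> Basis" for v
      by (intro Ck_on_add[OF assms(2)] Suc.IH lower) (use Suc.prems that in auto)
  qed
qed

lemma Ck_on_bounded_linear:
  assumes "bounded_linear h" "open U" "Ck_on n U f"
  shows "Ck_on n U (\<lambda>x. h (f x))"
  using assms(3)
proof (induction n arbitrary: f)
  case 0
  then show ?case using bounded_linear.continuous_on[OF assms(1)] by simp
next
  case (Suc n)
  show ?case
  proof (rule Ck_on_SucI[OF assms(2)])
    show "((\<lambda>x. h (f x)) has_derivative (\<lambda>v. h (pd v f x))) (at x)" if "x \<in> U" for x
      by (intro bounded_linear.has_derivative[OF assms(1)] Suc.prems[THEN Ck_on_SucD_derivative] that)
    show "Ck_on n U (\<lambda>x. h (pd v f x))" if "v \<in> Basis" for v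
      by (rule Suc.IH) (use Suc.prems that in auto)
  qed
qed

lemma Ck_on_linear_map:
  assumes "bounded_linear h"
  shows "Ck_on n U h"
proof (cases n)
  case 0
  then show ?thesis using assms by (simp add: linear_continuous_on)
next
  case (Suc m)
  have "frechet_derivative h (at x) = h" for x
    using bounded_linear_imp_has_derivative[OF assms] frechet_derivative_at by metis
  then show ?thesis
    using Suc assms Ck_on_const bounded_linear_imp_differentiable by auto
qed

lemma Ck_on_sum:
  assumes "open U" "\<And>i. i \<in> I \<Longrightarrow> Ck_on n U (f i)"
  shows "Ck_on n U (\<lambda>x. \<Sum>i\<in>I. f i x)"
proof (cases "finite I")
  case True
  then show ?thesis using assms(2)
    by (induction I) (simp_all add: Ck_on_add[OF assms(1)] Ck_on_const)
qed (simp add: Ck_on_const)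

lemma Ck_on_prod:
  fixes f :: "'i \<Rightarrow> 'a::euclidean_space \<Rightarrow> real"
  assumes "open U" "\<And>i. i \<in> I \<Longrightarrow> Ck_on n U (f i)"
  shows "Ck_on n U (\<lambda>x. \<Prod>i\<in>I. f i x)"
proof (cases "finite I")
  case True
  then show ?thesis using assms(2)
    by (induction I) (simp_all add: Ck_on_bilinear[OF bounded_bilinear_mult assms(1)] Ck_on_const)
qed (simp add: Ck_on_const)

lemma Ck_on_exp:
  fixes q :: "'a::euclidean_space \<Rightarrow> real"
  assumes "open U" "\<And>n. Ck_on n U q"
  shows "Ck_on n U (\<lambda>x. exp (q x))"
proof (induction n)
  case 0
  then show ?case using assms(2)[of 0] by (auto intro!: continuous_on_exp)
next
  case (Suc n)
  show ?case
  proof (rule Ck_on_SucI[OF assms(1)])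
    show "((\<lambda>x. exp (q x)) has_derivative (\<lambda>v. exp (q x) * pd v q x)) (at x)" if "x \<in> U" for x
      using has_derivative_compose[OF Ck_on_SucD_derivative[OF assms(2) that]
          DERIV_exp[unfolded has_field_derivative_def]] by simp
    show "Ck_on n U (\<lambda>x. exp (q x) * pd v q x)" if "v \<in> Basis" for v
      by (intro Ck_on_bilinear[OF bounded_bilinear_mult assms(1)] Suc.IH)
        (use assms(2)[of "Suc n"] that in auto)
  qed
qed

lemma smooth_onD: "smooth_on U f \<Longrightarrow> Ck_on n U f"
  by (simp add: smooth_on_def)

lemma smooth_on_open: "smooth_on U f \<Longrightarrow> open U"
  by (simp add: smooth_on_def)

lemma smooth_on_has_derivative:
  "smooth_on U f \<Longrightarrow> x \<in> U \<Longrightarrow> (f has_derivative frechet_derivative f (at x)) (at x)"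
  using Ck_on_SucD_derivative smooth_onD by blast

lemma smooth_on_continuous_on: "smooth_on U f \<Longrightarrow> continuous_on U f"
  using smooth_onD[of U f 0] by simp

lemma smooth_on_pd: "smooth_on U f \<Longrightarrow> v \<in> Basis \<Longrightarrow> smooth_on U (pd v f)"
  unfolding smooth_on_def by (metis Ck_on.simps(2))

lemma smooth_on_subset: "smooth_on U f \<Longrightarrow> open V \<Longrightarrow> V \<subseteq> U \<Longrightarrow> smooth_on V f"
  unfolding smooth_on_def using Ck_on_subset by blast

lemma smooth_on_cong: "smooth_on U f \<Longrightarrow> (\<And>x. x \<in> U \<Longrightarrow> f x = g x) \<Longrightarrow> smooth_on U g"
  unfolding smooth_on_def using Ck_on_cong by blast

lemma smooth_on_Un: "smooth_on U f \<Longrightarrow> smooth_on V f \<Longrightarrow> smooth_on (U \<union> V) f"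
  unfolding smooth_on_def using Ck_on_Un by blast

lemma smooth_on_const: "open U \<Longrightarrow> smooth_on U (\<lambda>x. c)"
  by (simp add: smooth_on_def Ck_on_const)

lemma smooth_on_add: "smooth_on U f \<Longrightarrow> smooth_on U g \<Longrightarrow> smooth_on U (\<lambda>x. f x + g x)"
  by (simp add: smooth_on_def Ck_on_add)

lemma smooth_on_sum:
  "open U \<Longrightarrow> (\<And>i. i \<in> I \<Longrightarrow> smooth_on U (f i)) \<Longrightarrow> smooth_on U (\<lambda>x. \<Sum>i\<in>I. f i x)"
  by (simp add: smooth_on_def Ck_on_sum)

lemma smooth_on_bounded_linear: "bounded_linear h \<Longrightarrow> smooth_on U f \<Longrightarrow> smooth_on U (\<lambda>x. h (f x))"
  by (simp add: smooth_on_def Ck_on_bounded_linear)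

lemma smooth_on_bilinear:
  "bounded_bilinear p \<Longrightarrow> smooth_on U f \<Longrightarrow> smooth_on U g \<Longrightarrow> smooth_on U (\<lambda>x. p (f x) (g x))"
  by (simp add: smooth_on_def Ck_on_bilinear)

lemmas smooth_on_scaleR = smooth_on_bilinear[OF bounded_bilinear_scaleR]

lemma smooth_on_diff: "smooth_on U f \<Longrightarrow> smooth_on U g \<Longrightarrow> smooth_on U (\<lambda>x. f x - g x)"
  using smooth_on_add[OF _ smooth_on_bounded_linear[OF bounded_linear_minus[OF bounded_linear_ident]]]
  by fastforce

lemma smooth_on_exp:
  fixes q :: "'a::euclidean_space \<Rightarrow> real"
  shows "smooth_on U q \<Longrightarrow> smooth_on U (\<lambda>x. exp (q x))"
  by (simp add: smooth_on_def Ck_on_exp)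

lemma pd_eq_0_outside_closed:
  assumes "closed K" "\<And>x. x \<notin> K \<Longrightarrow> f x = 0" "x \<notin> K"
  shows "pd v f x = 0"
proof -
  have o: "open (- K)" using assms(1) by (rule open_Compl)
  have "(f has_derivative (\<lambda>_. 0)) (at x)"
    by (rule has_derivative_transform_within_open[OF has_derivative_const[of 0] o]) (use assms(2,3) in auto)
  from fun_cong[OF frechet_derivative_at[OF this], of v] show ?thesis by simp
qed

lemma difference_quotient_tendsto:
  assumes "(f has_derivative D) (at x)"
  shows "((\<lambda>t. (f (x + t *\<^sub>R v) - f x) /\<^sub>R t) \<longlongrightarrow> D v) (at 0)"
proof -
  have "((\<lambda>t. x + t *\<^sub>R v) has_derivative (\<lambda>s. s *\<^sub>R v)) (at 0)"
    by (auto intro!: derivative_eq_intros)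
  from has_derivative_compose[OF this, of f D] assms
  have "((\<lambda>t. f (x + t *\<^sub>R v)) has_derivative (\<lambda>s. s *\<^sub>R D v)) (at 0)"
    by (simp add: linear_scale[OF has_derivative_linear[OF assms]])
  then have "((\<lambda>h. norm (f (x + h *\<^sub>R v) - f x - h *\<^sub>R D v) / norm h) \<longlongrightarrow> 0) (at 0)"
    by (simp add: has_derivative_at)
  then have "((\<lambda>h. norm ((f (x + h *\<^sub>R v) - f x) /\<^sub>R h - D v)) \<longlongrightarrow> 0) (at 0)"
  proof (rule Lim_transform_eventually)
    have "norm (f (x + h *\<^sub>R v) - f x - h *\<^sub>R D v) / norm h
        = norm ((f (x + h *\<^sub>R v) - f x) /\<^sub>R h - D v)" if "h \<noteq> 0" for h
    proof -
      have "(f (x + h *\<^sub>R v) - f x) /\<^sub>R h - D v = (f (x + h *\<^sub>R v) - f x - h *\<^sub>R D v) /\<^sub>R h"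
        using that by (simp add: scaleR_diff_right)
      then show ?thesis by (simp add: divide_inverse_commute)
    qed
    then show "\<forall>\<^sub>F h in at 0. norm (f (x + h *\<^sub>R v) - f x - h *\<^sub>R D v) / norm h
        = norm ((f (x + h *\<^sub>R v) - f x) /\<^sub>R h - D v)"
      by (simp add: eventually_at_filter)
  qed
  then show ?thesis by (rule LIM_zero_cancel[OF tendsto_norm_zero_cancel])
qed

text \<open>Both sides are the derivative at \<open>t = 0\<close> of \<open>t \<mapsto> \<partial>\<^sub>v f (x + t w)\<close>: differentiating
  \<open>f (x + s v + t w) - f (x + s v) = \<integral>\<^sub>0\<^sup>t \<partial>\<^sub>w f (x + s v + \<tau> w) d\<tau>\<close> in \<open>s\<close> under the integral
  expresses this function as a primitive of \<open>\<tau> \<mapsto> \<partial>\<^sub>v \<partial>\<^sub>w f (x + \<tau> w)\<close>.\<close>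

lemma pd_commute:
  fixes f :: "'a::euclidean_space \<Rightarrow> 'b::euclidean_space"
  assumes f: "smooth_on U f" and x: "x \<in> U" and v: "v \<in> Basis" and w: "w \<in> Basis"
  shows "pd v (pd w f) x = pd w (pd v f) x"
proof -
  obtain r where r: "r > 0" "ball x r \<subseteq> U"
    using smooth_on_open[OF f] x openE by blast
  define e where "e = r / 3"
  have e: "e > 0" using r by (simp add: e_def)
  have inU: "x + s *\<^sub>R v + t *\<^sub>R w \<in> U" if "s \<in> {-e..e}" "t \<in> {0..e}" for s t
  proof -
    have "norm (s *\<^sub>R v + t *\<^sub>R w) \<le> \<bar>s\<bar> + \<bar>t\<bar>"
      using norm_triangle_ineq[of "s *\<^sub>R v" "t *\<^sub>R w"] v w by simp
    also have "\<dots> < r" using that e by (auto simp: e_def)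
    finally have "x + s *\<^sub>R v + t *\<^sub>R w \<in> ball x r"
      by (metis add.assoc add_diff_cancel_left' dist_norm mem_ball dist_commute)
    then show ?thesis using r by blast
  qed
  have line: "((\<lambda>s. h (y + s *\<^sub>R u)) has_vector_derivative pd u h (y + s *\<^sub>R u)) (at s within S)"
    if "smooth_on U h" "y + s *\<^sub>R u \<in> U" for h :: "'a \<Rightarrow> 'b" and y u s S
  proof -
    have "((\<lambda>s. y + s *\<^sub>R u) has_vector_derivative u) (at s within S)"
      by (auto intro!: derivative_eq_intros)
    from vector_derivative_diff_chain_within[OF this,
        OF has_derivative_at_withinI[OF smooth_on_has_derivative[OF that]]]
    show ?thesis by (simp add: o_def)
  qed
  note fw = smooth_on_pd[OF f w] and fv = smooth_on_pd[OF f v]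
  have cont: "continuous_on T (\<lambda>z. h (x + fst z *\<^sub>R v + snd z *\<^sub>R w))"
    if "smooth_on U h" "T \<subseteq> {-e..e} \<times> {0..e}" for h :: "'a \<Rightarrow> 'b" and T
    by (rule continuous_on_compose2[OF smooth_on_continuous_on[OF that(1)]])
      (use that inU in \<open>auto intro!: continuous_intros\<close>)
  have cont1: "continuous_on {0..t} (\<lambda>\<tau>. h (x + s *\<^sub>R v + \<tau> *\<^sub>R w))"
    if "smooth_on U h" "s \<in> {-e..e}" "t \<le> e" for h :: "'a \<Rightarrow> 'b" and s t
    by (rule continuous_on_compose2[OF smooth_on_continuous_on[OF that(1)]])
      (use that inU in \<open>auto intro!: continuous_intros\<close>)
  let ?k = "\<lambda>\<tau>. pd v (pd w f) (x + \<tau> *\<^sub>R w)"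
  have eq: "pd v f (x + t *\<^sub>R w) - pd v f x = integral {0..t} ?k" if t: "t \<in> {0..e}" for t
  proof -
    have ftc: "integral {0..t} (\<lambda>\<tau>. pd w f (x + s *\<^sub>R v + \<tau> *\<^sub>R w))
        = f (x + s *\<^sub>R v + t *\<^sub>R w) - f (x + s *\<^sub>R v)" if "s \<in> {-e..e}" for s
    proof -
      have "((\<lambda>\<tau>. pd w f (x + s *\<^sub>R v + \<tau> *\<^sub>R w)) has_integral
          f (x + s *\<^sub>R v + t *\<^sub>R w) - f (x + s *\<^sub>R v + 0 *\<^sub>R w)) {0..t}"
        by (rule fundamental_theorem_of_calculus) (use that t in \<open>auto intro!: line f inU\<close>)
      then show ?thesis by (simp add: integral_unique)
    qed
    have "((\<lambda>s. integral (cbox 0 t) (\<lambda>\<tau>. pd w f (x + s *\<^sub>R v + \<tau> *\<^sub>R w))) has_vector_derivative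
        integral (cbox 0 t) (\<lambda>\<tau>. pd v (pd w f) (x + 0 *\<^sub>R v + \<tau> *\<^sub>R w))) (at 0 within {-e..e})"
    proof (rule leibniz_rule_vector_derivative
        [where fx="\<lambda>s \<tau>. pd v (pd w f) (x + s *\<^sub>R v + \<tau> *\<^sub>R w)"])
      fix s \<tau> assume "s \<in> {-e..e}" "\<tau> \<in> cbox 0 t"
      then have "x + \<tau> *\<^sub>R w + s *\<^sub>R v \<in> U"
        using inU[of s \<tau>] t by (simp add: algebra_simps)
      from line[OF fw this]
      show "((\<lambda>s. pd w f (x + s *\<^sub>R v + \<tau> *\<^sub>R w)) has_vector_derivative
          pd v (pd w f) (x + s *\<^sub>R v + \<tau> *\<^sub>R w)) (at s within {-e..e})"
        by (simp add: algebra_simps)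
    next
      fix s assume "s \<in> {-e..e}"
      then show "(\<lambda>\<tau>. pd w f (x + s *\<^sub>R v + \<tau> *\<^sub>R w)) integrable_on cbox 0 t"
        using cont1[OF fw] t by (auto intro!: integrable_continuous_interval)
    next
      show "continuous_on ({-e..e} \<times> cbox 0 t) (\<lambda>(s, \<tau>). pd v (pd w f) (x + s *\<^sub>R v + \<tau> *\<^sub>R w))"
        unfolding case_prod_beta
        by (rule cont[OF smooth_on_pd[OF fw v]]) (use t in auto)
    qed (use e in auto)
    moreover have "((\<lambda>s. f (x + s *\<^sub>R v + t *\<^sub>R w) - f (x + s *\<^sub>R v)) has_vector_derivative
        pd v f (x + t *\<^sub>R w) - pd v f x) (at 0 within {-e..e})"
    proof (rule has_vector_derivative_diff)
      have "x + t *\<^sub>R w + 0 *\<^sub>R v \<in> U" "x + 0 *\<^sub>R v \<in> U"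
        using inU[of 0 t] inU[of 0 0] t e by auto
      from this[THEN line[OF f, of _ 0 v "{-e..e}"]]
      show "((\<lambda>s. f (x + s *\<^sub>R v + t *\<^sub>R w)) has_vector_derivative pd v f (x + t *\<^sub>R w)) (at 0 within {-e..e})"
        "((\<lambda>s. f (x + s *\<^sub>R v)) has_vector_derivative pd v f x) (at 0 within {-e..e})"
        by (simp_all add: algebra_simps)
    qed
    then have "((\<lambda>s. integral (cbox 0 t) (\<lambda>\<tau>. pd w f (x + s *\<^sub>R v + \<tau> *\<^sub>R w))) has_vector_derivative
        pd v f (x + t *\<^sub>R w) - pd v f x) (at 0 within {-e..e})"
      by (rule has_vector_derivative_transform[rotated 2]) (use e ftc in auto)
    ultimately show ?thesis
      using vector_derivative_unique_within_closed_interval[of "-e" e 0] e by auto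
  qed
  have "continuous_on {0..e} ?k"
    using cont1[OF smooth_on_pd[OF fw v], of 0 e] e by simp
  then have "((\<lambda>t. integral {0..t} ?k) has_vector_derivative ?k 0) (at 0 within {0..e})"
    by (rule integral_has_vector_derivative) (use e in auto)
  then have "((\<lambda>t. pd v f (x + t *\<^sub>R w) - pd v f x) has_vector_derivative ?k 0) (at 0 within {0..e})"
    by (rule has_vector_derivative_transform[rotated 2]) (use e eq in auto)
  moreover have "((\<lambda>t. pd v f (x + t *\<^sub>R w) - pd v f x) has_vector_derivative
      pd w (pd v f) (x + 0 *\<^sub>R w)) (at 0 within {0..e})"
    unfolding has_vector_derivative_diff_const
    by (rule line[OF fv]) (use x in simp)
  ultimately show ?thesis
    using vector_derivative_unique_within_closed_interval[of 0 e 0] e by auto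
qed

section \<open>Smooth bumps and cutoffs\<close>

text \<open>The functions \<open>p (1/t) * exp (-1/t)\<close>, extended by zero to \<open>t \<le> 0\<close>, with \<open>p\<close> a polynomial, are
  closed under differentiation; this is why the case \<open>p = 1\<close> is smooth.\<close>

definition flat :: "real poly \<Rightarrow> real \<Rightarrow> real" where
  "flat p t = (if t > 0 then poly p (1 / t) * exp (- (1 / t)) else 0)"

lemma tendsto_poly_exp_at_top: "((\<lambda>s::real. poly p s * exp (- s)) \<longlongrightarrow> 0) at_top"
proof -
  have "((\<lambda>s. \<Sum>i\<le>degree p. coeff p i * (s ^ i / exp s)) \<longlongrightarrow> (\<Sum>i\<le>degree p. coeff p i * 0)) at_top"
    by (intro tendsto_sum tendsto_mult tendsto_const tendsto_power_div_exp_0)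
  moreover have "(\<Sum>i\<le>degree p. coeff p i * (s ^ i / exp s)) = poly p s * exp (- s)" for s
    by (simp add: poly_altdef exp_minus sum_distrib_right divide_inverse mult.assoc)
  ultimately show ?thesis by simp
qed

lemma tendsto_flat_0: "(flat p \<longlongrightarrow> 0) (at 0)"
proof -
  have "((\<lambda>t. poly p (inverse t) * exp (- inverse t)) \<longlongrightarrow> 0) (at_right 0)"
    using filterlim_compose[OF tendsto_poly_exp_at_top filterlim_inverse_at_top_right] by blast
  moreover have "eventually (\<lambda>t. poly p (inverse t) * exp (- inverse t) = flat p t) (at_right 0)"
    unfolding eventually_at_right_field flat_def inverse_eq_divide by (intro exI[of _ 1]) simp
  ultimately have r: "(flat p \<longlongrightarrow> 0) (at_right 0)"
    by (rule Lim_transform_eventually)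
  have "eventually (\<lambda>t. 0 = flat p t) (at_left 0)"
    unfolding eventually_at_left_field flat_def by (intro exI[of _ "-1"]) simp
  then have l: "(flat p \<longlongrightarrow> 0) (at_left 0)"
    by (rule Lim_transform_eventually[OF tendsto_const])
  show ?thesis
    using l r by (simp add: filterlim_split_at)
qed

lemma flat_has_derivative:
  "(flat p has_real_derivative flat ([:0, 0, 1:] * (p - pderiv p)) t) (at t)"
proof -
  consider "t > 0" | "t = 0" | "t < 0" by linarith
  then show ?thesis
  proof cases
    case 1
    have a: "((\<lambda>t. 1 / t) has_real_derivative - (1 / t ^ 2)) (at t)"
      using 1 by (auto intro!: derivative_eq_intros simp: power2_eq_square)
    have "((\<lambda>t. poly p (1 / t) * exp (- (1 / t))) has_real_derivative
        flat ([:0, 0, 1:] * (p - pderiv p)) t) (at t)"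
      using DERIV_mult[OF DERIV_chain2[OF poly_DERIV a] DERIV_chain2[OF DERIV_exp DERIV_minus[OF a]]]
      by (rule DERIV_cong) (use 1 in \<open>simp add: flat_def algebra_simps power2_eq_square\<close>)
    then show ?thesis
      by (rule has_field_derivative_transform_within_open[where S="{0<..}"])
        (use 1 in \<open>auto simp: flat_def\<close>)
  next
    case 2
    have "((\<lambda>h. flat ([:0, 1:] * p) h) \<longlongrightarrow> 0) (at 0)"
      by (rule tendsto_flat_0)
    then have "((\<lambda>h. (flat p (0 + h) - flat p 0) / h) \<longlongrightarrow> 0) (at 0)"
      by (rule Lim_transform_eventually) (simp add: flat_def eventually_at_filter)
    then show ?thesis using 2 by (simp add: DERIV_def flat_def)
  next
    case 3
    have "((\<lambda>t. 0) has_real_derivative flat ([:0, 0, 1:] * (p - pderiv p)) t) (at t)"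
      using 3 by (simp add: flat_def)
    then show ?thesis
      by (rule has_field_derivative_transform_within_open[where S="{..<0}"])
        (use 3 in \<open>auto simp: flat_def\<close>)
  qed
qed

lemma Ck_on_flat:
  assumes "open U" "\<And>n. Ck_on n U q"
  shows "Ck_on n U (\<lambda>x. flat p (q x))"
proof (induction n arbitrary: p)
  case 0
  have "continuous_on UNIV (flat p)"
    using flat_has_derivative DERIV_continuous_on by blast
  then show ?case
    using assms(2)[of 0] by (auto intro: continuous_on_compose2[where t=UNIV])
next
  case (Suc n)
  let ?q = "[:0, 0, 1:] * (p - pderiv p)"
  show ?case
  proof (rule Ck_on_SucI[OF assms(1)])
    show "((\<lambda>x. flat p (q x)) has_derivative (\<lambda>v. flat ?q (q x) * pd v q x)) (at x)" if "x \<in> U" for x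
      using has_derivative_compose[OF Ck_on_SucD_derivative[OF assms(2) that]
          flat_has_derivative[unfolded has_field_derivative_def]] by simp
    show "Ck_on n U (\<lambda>x. flat ?q (q x) * pd v q x)" if "v \<in> Basis" for v
      by (intro Ck_on_bilinear[OF bounded_bilinear_mult assms(1)] Suc.IH)
        (use assms(2)[of "Suc n"] that in auto)
  qed
qed

definition box_bump :: "'a::euclidean_space \<Rightarrow> 'a \<Rightarrow> 'a \<Rightarrow> real" where
  "box_bump a b x = (\<Prod>i\<in>Basis. flat 1 (x \<bullet> i - a \<bullet> i) * flat 1 (b \<bullet> i - x \<bullet> i))"

lemma flat_1_pos_iff: "flat 1 t > 0 \<longleftrightarrow> t > 0" and flat_1_eq_0_iff: "flat 1 t = 0 \<longleftrightarrow> t \<le> 0"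
  by (auto simp: flat_def)

lemma smooth_on_box_bump: "smooth_on UNIV (box_bump a b)"
proof -
  have l: "Ck_on n UNIV (\<lambda>x::'a. x \<bullet> i - c)" "Ck_on n UNIV (\<lambda>x::'a. c - x \<bullet> i)" for n i c
    using smooth_on_diff[of UNIV "\<lambda>x::'a. x \<bullet> i" "\<lambda>x. c"] smooth_on_diff[of UNIV "\<lambda>x. c" "\<lambda>x::'a. x \<bullet> i"]
      smooth_on_const[of UNIV c] Ck_on_linear_map[OF bounded_linear_inner_left[of i]]
    by (auto simp: smooth_on_def)
  show ?thesis
    unfolding smooth_on_def box_bump_def
    by (intro conjI allI open_UNIV Ck_on_prod Ck_on_bilinear[OF bounded_bilinear_mult] Ck_on_flat l)
qed

lemma box_bump_pos: "x \<in> box a b \<Longrightarrow> box_bump a b x > 0"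
  by (auto simp: box_bump_def flat_1_pos_iff mem_box intro!: prod_pos)

lemma box_bump_eq_0: "x \<notin> box a b \<Longrightarrow> box_bump a b x = 0"
  by (auto simp: box_bump_def flat_1_eq_0_iff mem_box not_less prod_zero_iff)

lemma box_bump_eq_0_cbox: "x \<notin> cbox a b \<Longrightarrow> box_bump a b x = 0"
  by (rule box_bump_eq_0) (use box_subset_cbox in blast)

lemma box_bump_nonneg: "box_bump a b x \<ge> 0"
  by (metis box_bump_eq_0 box_bump_pos less_eq_real_def order_refl)

lemma test_function_box_bump: "cbox a b \<subseteq> \<Omega> \<Longrightarrow> test_function \<Omega> (box_bump a b)"
  unfolding test_function_def
  by (intro conjI exI[of _ "cbox a b"] allI impI smooth_on_box_bump compact_cbox box_bump_eq_0_cbox)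

lemma open_eq_countable_Union_boxes:
  fixes \<Omega> :: "'a::euclidean_space set"
  assumes "open \<Omega>"
  obtains a b :: "nat \<Rightarrow> 'a" where "\<And>m. cbox (a m) (b m) \<subseteq> \<Omega>" "\<Omega> = (\<Union>m. box (a m) (b m))"
proof -
  define F where "F = {(a, b). cbox a b \<subseteq> \<Omega>}"
  have cover: "\<exists>p\<in>F. x \<in> box (fst p) (snd p)" if "x \<in> \<Omega>" for x
    using open_contains_cbox[OF assms that] unfolding F_def by fastforce
  obtain G where G: "G \<subseteq> (\<lambda>p. box (fst p) (snd p)) ` F" "countable G" "\<Union>G = (\<Union>p\<in>F. box (fst p) (snd p))"
    using Lindelof[of "(\<lambda>p. box (fst p) (snd p)) ` F"] by (metis (no_types, lifting) image_iff open_box)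
  obtain C where C: "countable C" "C \<subseteq> F" "G = (\<lambda>p. box (fst p) (snd p)) ` C"
    using countable_subset_image[of G "\<lambda>p. box (fst p) (snd p)" F] G by blast
  define C' where "C' = insert (One, 0) C"
  have C': "countable C'" "C' \<subseteq> F" "C' \<noteq> {}"
  proof -
    have "cbox One (0::'a) = {}"
      unfolding box_eq_empty by (rule bexI[OF _ SOME_Basis]) (simp add: SOME_Basis)
    then show "countable C'" "C' \<subseteq> F" "C' \<noteq> {}"
      using C by (auto simp: C'_def F_def)
  qed
  have range: "range (from_nat_into C') = C'"
    by (rule range_from_nat_into) (use C' in auto)
  have "\<Omega> = (\<Union>p\<in>C'. box (fst p) (snd p))"
  proof
    show "\<Omega> \<subseteq> (\<Union>p\<in>C'. box (fst p) (snd p))"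
    proof
      fix x assume "x \<in> \<Omega>"
      then have "x \<in> \<Union>G" using cover unfolding G(3) by blast
      then show "x \<in> (\<Union>p\<in>C'. box (fst p) (snd p))" unfolding C(3) C'_def by auto
    qed
    show "(\<Union>p\<in>C'. box (fst p) (snd p)) \<subseteq> \<Omega>"
    proof (rule UN_least)
      fix p assume "p \<in> C'"
      then have "cbox (fst p) (snd p) \<subseteq> \<Omega>" using C'(2) by (cases p) (auto simp: F_def)
      with box_subset_cbox show "box (fst p) (snd p) \<subseteq> \<Omega>" by (rule subset_trans)
    qed
  qed
  then have "\<Omega> = (\<Union>m. box (fst (from_nat_into C' m)) (snd (from_nat_into C' m)))"
    unfolding image_image[symmetric, of "\<lambda>p. box (fst p) (snd p)" "from_nat_into C'"] range .
  moreover have "cbox (fst (from_nat_into C' m)) (snd (from_nat_into C' m)) \<subseteq> \<Omega>" for m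
    using from_nat_into[OF C'(3), of m] C'(2) by (cases "from_nat_into C' m") (auto simp: F_def)
  ultimately show ?thesis by (rule that[rotated])
qed

lemma tendsto_one_minus_exp:
  fixes f :: "nat \<Rightarrow> real"
  assumes "c > 0" "\<And>m. m \<ge> N \<Longrightarrow> f m \<ge> c"
  shows "(\<lambda>m. 1 - exp (- (real m * f m))) \<longlonglongrightarrow> 1"
proof -
  have "((\<lambda>m. exp (- (real m * c))) \<longlongrightarrow> 0) sequentially"
    by (rule filterlim_compose[OF exp_at_bot])
      (use assms(1) in \<open>auto simp: filterlim_uminus_at_bot intro!: filterlim_at_top_mult_tendsto_pos[OF tendsto_const _ filterlim_real_sequentially]\<close>)
  then have "(\<lambda>m. exp (- (real m * f m))) \<longlonglongrightarrow> 0"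
    by (rule tendsto_sandwich[OF _ _ tendsto_const, rotated 2])
      (use assms(2) in \<open>auto simp: eventually_sequentially intro!: exI[of _ N] mult_left_mono\<close>)
  from tendsto_diff[OF tendsto_const[of 1] this] show ?thesis by simp
qed

lemma smooth_on_one_minus_exp:
  fixes q :: "'a::euclidean_space \<Rightarrow> real"
  assumes "smooth_on U q"
  shows "smooth_on U (\<lambda>x. 1 - exp (- (c * q x)))"
  using smooth_on_diff[OF smooth_on_const[of U 1] smooth_on_exp[OF
      smooth_on_bounded_linear[OF bounded_linear_mult_right[of "-c"] assms]]]
    smooth_on_open[OF assms] by simp

text \<open>Exhaust \<open>\<Omega>\<close> by countably many boxes. A sum \<open>\<beta>\<close> of finitely many of their bumps is positive on the boxes
  used so far, and composing with \<open>t \<mapsto> 1 - exp (- m t)\<close> lifts its values there towards 1.\<close>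

lemma exists_cutoff_sequence:
  fixes \<Omega> :: "'a::euclidean_space set"
  assumes "open \<Omega>"
  obtains \<eta> :: "nat \<Rightarrow> 'a \<Rightarrow> real" where "\<And>m. test_function \<Omega> (\<eta> m)"
    "\<And>m x. 0 \<le> \<eta> m x" "\<And>m x. \<eta> m x \<le> 1" "\<And>x. x \<in> \<Omega> \<Longrightarrow> (\<lambda>m. \<eta> m x) \<longlonglongrightarrow> 1"
proof -
  obtain a b :: "nat \<Rightarrow> 'a" where ab: "\<And>m. cbox (a m) (b m) \<subseteq> \<Omega>" "\<Omega> = (\<Union>m. box (a m) (b m))"
    using open_eq_countable_Union_boxes[OF assms] by blast
  define \<beta> where "\<beta> m x = (\<Sum>i<m. box_bump (a i) (b i) x)" for m x
  define \<eta> where "\<eta> m x = 1 - exp (- (real m * \<beta> m x))" for m x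
  have nn: "\<beta> m x \<ge> 0" for m x
    by (simp add: \<beta>_def sum_nonneg box_bump_nonneg)
  have "smooth_on UNIV (\<beta> m)" for m
    unfolding \<beta>_def by (intro smooth_on_sum open_UNIV smooth_on_box_bump)
  from smooth_on_one_minus_exp[OF this] have smooth: "smooth_on UNIV (\<eta> m)" for m
    unfolding \<eta>_def .
  have supp: "\<eta> m x = 0" if "x \<notin> (\<Union>i<m. cbox (a i) (b i))" for m x
  proof -
    have "box_bump (a i) (b i) x = 0" if "i < m" for i
      using \<open>x \<notin> _\<close> that box_subset_cbox[of "a i" "b i"] by (intro box_bump_eq_0) blast
    then show ?thesis by (simp add: \<eta>_def \<beta>_def)
  qed
  show ?thesis
  proof (rule that[of \<eta>])
    show "test_function \<Omega> (\<eta> m)" for m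
      unfolding test_function_def
    proof (intro conjI exI[of _ "\<Union>i<m. cbox (a i) (b i)"])
      show "compact (\<Union>i<m. cbox (a i) (b i))" by (intro compact_UN) auto
      show "(\<Union>i<m. cbox (a i) (b i)) \<subseteq> \<Omega>" using ab(1) by (rule UN_least)
    qed (use smooth supp in auto)
    show "0 \<le> \<eta> m x" "\<eta> m x \<le> 1" for m x using nn by (auto simp: \<eta>_def)
    show "(\<lambda>m. \<eta> m x) \<longlonglongrightarrow> 1" if "x \<in> \<Omega>" for x
    proof -
      obtain k where k: "x \<in> box (a k) (b k)" using \<open>x \<in> \<Omega>\<close> unfolding ab(2) by (elim UN_E)
      show ?thesis
        unfolding \<eta>_def
      proof (rule tendsto_one_minus_exp[OF box_bump_pos[OF k]])
        show "box_bump (a k) (b k) x \<le> \<beta> m x" if "m \<ge> Suc k" for m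
          unfolding \<beta>_def by (rule member_le_sum) (use that box_bump_nonneg in auto)
      qed
    qed
  qed
qed

section \<open>Integration by parts and the fundamental lemma\<close>

text \<open>The integral of a difference quotient of the extension by zero vanishes by translation invariance;
  the quotients are bounded with a common compact support, so the limit may be taken under the integral.\<close>

lemma integral_derivative_compact_support:
  fixes \<psi> :: "'a::euclidean_space \<Rightarrow> 'b::euclidean_space"
  assumes "open \<Omega>" "compact K" "K \<subseteq> \<Omega>"
    and der: "\<And>x. x \<in> \<Omega> \<Longrightarrow> (\<psi> has_derivative \<psi>' x) (at x)"
    and cont: "continuous_on \<Omega> (\<lambda>x. \<psi>' x v)"
    and zero: "\<And>x. x \<in> \<Omega> \<Longrightarrow> x \<notin> K \<Longrightarrow> \<psi> x = 0"
  shows "integrable (lebesgue_on \<Omega>) (\<lambda>x. \<psi>' x v)"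
    and "(LINT x|lebesgue_on \<Omega>. \<psi>' x v) = 0"
proof -
  define g where "g x = (if x \<in> K then \<psi> x else 0)" for x
  define g' where "g' x = (if x \<in> K then \<psi>' x v else 0)" for x
  define G where "G x = (if x \<in> \<Omega> then \<psi>' x else (\<lambda>_. 0))" for x
  have oK: "open (- K)" using assms(2) compact_imp_closed by blast
  have gder: "(g has_derivative G x) (at x)" for x
  proof (cases "x \<in> \<Omega>")
    case True
    show ?thesis
      using has_derivative_transform_within_open[OF der[OF True] assms(1) True, of g] zero True
      by (auto simp: g_def G_def)
  next
    case False
    then have "x \<in> - K" using assms(3) by blast
    from has_derivative_transform_within_open[OF has_derivative_const[of 0] oK this, of g]
    show ?thesis using False by (auto simp: g_def G_def)
  qed
  have Gv: "G x v = g' x" for x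
  proof (cases "x \<in> K")
    case False
    from has_derivative_transform_within_open[OF has_derivative_const[of 0] oK, of x g] False
    have "(g has_derivative (\<lambda>_. 0)) (at x)" by (auto simp: g_def)
    then have "G x = (\<lambda>_. 0)" using gder has_derivative_unique by blast
    then show ?thesis using False by (simp add: g'_def)
  qed (use assms(3) in \<open>auto simp: G_def g'_def\<close>)
  have eq: "\<psi>' x v = g' x" if "x \<in> \<Omega>" for x
    using Gv[of x] that by (simp add: G_def)
  have "continuous_on (\<Omega> \<union> - K) g'"
  proof (rule continuous_on_open_Un[OF assms(1) oK])
    show "continuous_on \<Omega> g'" using cont eq by (simp cong: continuous_on_cong)
    show "continuous_on (- K) g'"
      by (rule continuous_on_eq[of _ "\<lambda>_. 0"]) (auto simp: g'_def)
  qed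
  moreover have "\<Omega> \<union> - K = UNIV" using assms(3) by auto
  ultimately have g'c: "continuous_on UNIV g'" by simp
  have gc: "continuous_on UNIV g"
    using gder has_derivative_continuous_on has_derivative_at_withinI by metis
  have "bounded (g' ` K)"
    using compact_continuous_image[OF continuous_on_subset[OF g'c]] assms(2) compact_imp_bounded by blast
  then obtain M where M: "M > 0" "\<And>x. x \<in> K \<Longrightarrow> norm (g' x) \<le> M"
    by (auto simp: bounded_pos)
  then have M': "norm (g' x) \<le> M" for x by (cases "x \<in> K") (auto simp: g'_def)
  obtain R where R: "R > 0" "\<And>x. x \<in> K \<Longrightarrow> norm x \<le> R"
    using compact_imp_bounded[OF assms(2)] by (auto simp: bounded_pos)
  define d where "d n x = (g (x + (1 / Suc n) *\<^sub>R v) - g x) /\<^sub>R (1 / Suc n)" for n :: nat and x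
  have line: "((\<lambda>t. g (x + t *\<^sub>R v)) has_derivative (\<lambda>s. s *\<^sub>R g' (x + t *\<^sub>R v))) (at t)" for x t
  proof -
    have "((\<lambda>t. x + t *\<^sub>R v) has_derivative (\<lambda>s. s *\<^sub>R v)) (at t)"
      by (auto intro!: derivative_eq_intros)
    from has_derivative_compose[OF this gder]
    show ?thesis
      using linear_scale[OF has_derivative_linear[OF gder]] Gv by simp
  qed
  have dlim: "(\<lambda>n. d n x) \<longlonglongrightarrow> g' x" for x
  proof -
    have "((\<lambda>h. (g (x + h *\<^sub>R v) - g x) /\<^sub>R h) \<longlongrightarrow> g' x) (at 0)"
      using difference_quotient_tendsto[OF gder, of x v] by (simp only: Gv)
    moreover have "filterlim (\<lambda>n. 1 / real (Suc n)) (at 0) sequentially"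
      using LIMSEQ_Suc[OF lim_1_over_n] by (auto simp: filterlim_at intro!: tendsto_intros)
    ultimately show ?thesis
      unfolding d_def using filterlim_compose by blast
  qed
  have dbound: "norm (d n x) \<le> M * indicat_real (cball 0 (R + norm v)) x" for n x
  proof (cases "x \<in> cball 0 (R + norm v)")
    case True
    have "norm (g (x + (1 / Suc n) *\<^sub>R v) - g (x + 0 *\<^sub>R v)) \<le> M * norm (1 / real (Suc n) - 0)"
    proof (rule differentiable_bound[where S=UNIV])
      show "onorm (\<lambda>s. s *\<^sub>R g' (x + t *\<^sub>R v)) \<le> M" for t
        using M' by (intro onorm_le) (simp add: mult.commute[of M] mult_left_mono)
    qed (use line in auto)
    moreover have "norm (d n x) = Suc n * norm (g (x + (1 / Suc n) *\<^sub>R v) - g x)"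
      by (simp add: d_def)
    ultimately show ?thesis using True by (simp add: field_simps)
  next
    case False
    have "norm (x + (1 / Suc n) *\<^sub>R v) > R"
    proof -
      have "norm x > R + norm v" using False by simp
      moreover have "norm ((1 / Suc n) *\<^sub>R v) \<le> norm v" by (simp add: field_simps mult_le_cancel_right1)
      ultimately show ?thesis using norm_diff_ineq[of x "(1 / Suc n) *\<^sub>R v"] by linarith
    qed
    moreover have "norm x > R" using False norm_ge_zero[of v] by (simp del: norm_ge_zero)
    ultimately show ?thesis using False R by (auto simp: d_def g_def not_le dest: leD)
  qed
  have gint: "integrable lborel g"
  proof -
    have "integrable lborel (\<lambda>x. indicat_real K x *\<^sub>R g x)"
      using borel_integrable_compact[OF assms(2) continuous_on_subset[OF gc]] by simp
    moreover have "(\<lambda>x. indicat_real K x *\<^sub>R g x) = g" by (auto simp: g_def indicator_def)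
    ultimately show ?thesis by simp
  qed
  have trans: "integrable lborel (\<lambda>x. g (x + c))" "(LINT x|lborel. g (x + c)) = (LINT x|lborel. g x)" for c
  proof -
    have m: "(+) c \<in> measurable lborel borel" "g \<in> borel_measurable borel"
      using gc borel_measurable_continuous_onI by auto
    show "(LINT x|lborel. g (x + c)) = (LINT x|lborel. g x)"
      using integral_distr[OF m] by (simp add: lborel_distr_plus add.commute)
    show "integrable lborel (\<lambda>x. g (x + c))"
      using integrable_distr_eq[OF m] gint by (simp add: lborel_distr_plus add.commute)
  qed
  have d0: "(LINT x|lborel. d n x) = 0" for n
    unfolding d_def using trans gint by simp
  have dm: "d n \<in> borel_measurable lborel" for n
    unfolding d_def using trans(1) gint by (intro borel_measurable_scaleR borel_measurable_diff) auto
  have g'm: "g' \<in> borel_measurable borel" using g'c borel_measurable_continuous_onI by blast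
  have bint: "integrable lborel (\<lambda>x::'a. M * indicat_real (cball 0 (R + norm v)) x)"
    by (intro integrable_mult_right integrable_real_indicator) (use emeasure_lborel_cball_finite[of "0::'a" "R + norm v"] in auto)
  have "(\<lambda>n. LINT x|lborel. d n x) \<longlonglongrightarrow> (LINT x|lborel. g' x)"
    by (rule integral_dominated_convergence[OF _ _ bint]) (use g'm dm dbound dlim in auto)
  then have I0: "(LINT x|lborel. g' x) = 0"
    using d0 LIMSEQ_unique by (simp add: LIMSEQ_const_iff)
  have gi: "integrable lborel g'"
    by (rule integrable_dominated_convergence[OF _ _ bint, where s=d]) (use g'm dm dbound dlim in auto)
  have ind: "indicator \<Omega> x *\<^sub>R \<psi>' x v = g' x" for x
    using eq[of x] assms(3) by (cases "x \<in> \<Omega>") (auto simp: g'_def)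
  have \<Omega>: "\<Omega> \<inter> space lebesgue \<in> sets lebesgue" using assms(1) by simp
  show "integrable (lebesgue_on \<Omega>) (\<lambda>x. \<psi>' x v)"
    using gi g'm by (simp add: integrable_restrict_space[OF \<Omega>] ind integrable_completion)
  show "(LINT x|lebesgue_on \<Omega>. \<psi>' x v) = 0"
    using I0 g'm by (simp add: integral_restrict_space[OF \<Omega>] ind integral_completion)
qed

text \<open>The test functions \<open>1 - exp (- m \<beta>)\<close>, with \<open>\<beta>\<close> the bump of the box, converge boundedly to the indicator
  of the open box.\<close>

lemma integral_box_eq_0_if_weakly_zero:
  fixes w :: "'a::euclidean_space \<Rightarrow> 'b::euclidean_space"
  assumes "open \<Omega>" "locally_integrable_on \<Omega> w"
    and weak: "\<And>\<phi> :: 'a \<Rightarrow> real. test_function \<Omega> \<phi> \<Longrightarrow> (LINT x|lebesgue_on \<Omega>. \<phi> x *\<^sub>R w x) = 0"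
    and ab: "cbox a b \<subseteq> \<Omega>"
  shows "integral (cbox a b) w = 0"
proof -
  have \<Omega>: "\<Omega> \<inter> space lebesgue \<in> sets lebesgue" using assms(1) by simp
  define \<phi> where "\<phi> m x = 1 - exp (- (real m * box_bump a b x))" for m x
  have off: "\<phi> m x = 0" if "x \<notin> box a b" for m x
    using box_bump_eq_0[OF that] by (simp add: \<phi>_def)
  have "test_function \<Omega> (\<phi> m)" for m
    unfolding test_function_def
  proof (intro conjI exI[of _ "cbox a b"])
    show "smooth_on UNIV (\<phi> m)"
      unfolding \<phi>_def by (rule smooth_on_one_minus_exp[OF smooth_on_box_bump])
  qed (use ab off box_subset_cbox[of a b] in auto)
  then have z: "(LINT x|lebesgue_on \<Omega>. \<phi> m x *\<^sub>R w x) = 0" for m by (rule weak)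
  have ind: "indicator \<Omega> x *\<^sub>R (\<phi> m x *\<^sub>R w x) = indicator (cbox a b) x *\<^sub>R (\<phi> m x *\<^sub>R w x)" for m x
    
    using off[of x m] ab box_subset_cbox[of a b] by (auto simp: indicator_def)
  have z': "(LINT x|lebesgue_on (cbox a b). \<phi> m x *\<^sub>R w x) = 0" for m
    using z[of m] by (simp only: integral_restrict_space[OF \<Omega>] ind) (simp add: integral_restrict_space)
  have wi: "integrable (lebesgue_on (cbox a b)) w"
    using assms(2) ab by (simp add: locally_integrable_on_def)
  have \<phi>c: "continuous_on UNIV (\<phi> m)" for m
    unfolding \<phi>_def by (intro continuous_intros smooth_on_continuous_on[OF smooth_on_box_bump])
  have \<phi>m: "\<phi> m \<in> borel_measurable (lebesgue_on (cbox a b))" for m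
    using \<phi>c by (intro continuous_imp_measurable_on_sets_lebesgue) (auto intro: continuous_on_subset)
  have \<phi>b: "\<bar>\<phi> m x\<bar> \<le> 1" for m x
    by (auto simp: \<phi>_def box_bump_nonneg)
  let ?w = "\<lambda>x. indicat_real (box a b) x *\<^sub>R w x"
  have "(\<lambda>m. LINT x|lebesgue_on (cbox a b). \<phi> m x *\<^sub>R w x) \<longlonglongrightarrow> (LINT x|lebesgue_on (cbox a b). ?w x)"
  proof (rule integral_dominated_convergence)
    show "?w \<in> borel_measurable (lebesgue_on (cbox a b))"
      using wi by (auto intro!: borel_measurable_scaleR borel_measurable_indicator simp: sets_restrict_space_iff borel_measurable_integrable dest: box_subset_cbox[THEN subsetD])
    show "(\<lambda>x. \<phi> m x *\<^sub>R w x) \<in> borel_measurable (lebesgue_on (cbox a b))" for m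
      using wi by (intro borel_measurable_scaleR \<phi>m) auto
    show "integrable (lebesgue_on (cbox a b)) (\<lambda>x. norm (w x))" using wi by simp
    show "AE x in lebesgue_on (cbox a b). norm (\<phi> m x *\<^sub>R w x) \<le> norm (w x)" for m
      using \<phi>b by (auto intro!: AE_I2 mult_left_le_one_le)
    show "AE x in lebesgue_on (cbox a b). (\<lambda>m. \<phi> m x *\<^sub>R w x) \<longlonglongrightarrow> ?w x"
    proof (intro AE_I2)
      fix x
      show "(\<lambda>m. \<phi> m x *\<^sub>R w x) \<longlonglongrightarrow> ?w x"
      proof (cases "x \<in> box a b")
        case True
        have "(\<lambda>m. \<phi> m x) \<longlonglongrightarrow> 1"
          unfolding \<phi>_def by (rule tendsto_one_minus_exp[OF box_bump_pos[OF True], of 0]) simp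
        from tendsto_scaleR[OF this tendsto_const[of "w x"]] show ?thesis using True by simp
      qed (simp add: off)
    qed
  qed
  then have "(LINT x|lebesgue_on (cbox a b). ?w x) = 0"
    unfolding z' by (simp add: LIMSEQ_const_iff)
  moreover have "(LINT x|lebesgue_on (cbox a b). ?w x) = (LINT x|lebesgue_on (cbox a b). w x)"
  proof (rule integral_cong_AE)
    have "AE x in lebesgue. x \<notin> cbox a b - box a b"
      using negligible_frontier_interval[of a b] unfolding negligible_iff_null_sets by (rule AE_not_in)
    then show "AE x in lebesgue_on (cbox a b). ?w x = w x"
      by (subst AE_restrict_space_iff) (auto elim!: eventually_mono)
  qed (use wi in \<open>auto intro!: borel_measurable_scaleR borel_measurable_indicator simp: sets_restrict_space_iff borel_measurable_integrable dest: box_subset_cbox[THEN subsetD]\<close>)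
  ultimately show ?thesis
    using lebesgue_integral_eq_integral[OF wi] by simp
qed

text \<open>By Lebesgue's differentiation theorem, vanishing integrals over small boxes suffice.\<close>

lemma AE_eq_0_if_weakly_zero:
  fixes w :: "'a::euclidean_space \<Rightarrow> 'b::euclidean_space"
  assumes "open \<Omega>" "locally_integrable_on \<Omega> w"
    and weak: "\<And>\<phi> :: 'a \<Rightarrow> real. test_function \<Omega> \<phi> \<Longrightarrow> (LINT x|lebesgue_on \<Omega>. \<phi> x *\<^sub>R w x) = 0"
  shows "AE x in lebesgue_on \<Omega>. w x = 0"
proof -
  obtain a b :: "nat \<Rightarrow> 'a" where ab: "\<And>m. cbox (a m) (b m) \<subseteq> \<Omega>" "\<Omega> = (\<Union>m. box (a m) (b m))"
    using open_eq_countable_Union_boxes[OF assms(1)] by blast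
  have "negligible {x \<in> box (a m) (b m). w x \<noteq> 0}" for m
  proof -
    define f where "f x = (if x \<in> cbox (a m) (b m) then w x else 0)" for x
    have "integrable (lebesgue_on (cbox (a m) (b m))) w"
      using assms(2) ab by (simp add: locally_integrable_on_def)
    then have "w absolutely_integrable_on cbox (a m) (b m)"
      by (simp add: absolutely_integrable_on_iff_nonneg integrable_restrict_space set_integrable_def)
    then have "w integrable_on cbox (a m) (b m)"
      using set_lebesgue_integral_eq_integral(1) by blast
    then have "f integrable_on UNIV"
      unfolding f_def using integrable_restrict_UNIV by blast
    then have "f integrable_on cbox c d" for c d
      using integrable_on_subcbox by blast
    then obtain N where N: "negligible N" "\<And>x e. x \<notin> N \<Longrightarrow> 0 < e \<Longrightarrow> \<exists>d>0. \<forall>h. 0 < h \<and> h < d \<longrightarrow>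
        norm (integral (cbox x (x + h *\<^sub>R One)) f /\<^sub>R h ^ DIM('a) - f x) < e"
      using integrable_ccontinuous_explicit[of f] by metis
    have "w x = 0" if x: "x \<in> box (a m) (b m)" "x \<notin> N" for x
    proof (rule ccontr)
      assume "w x \<noteq> 0"
      moreover have fx: "f x = w x" using x(1) box_subset_cbox by (auto simp: f_def)
      ultimately obtain d where d: "d > 0" "\<And>h. 0 < h \<Longrightarrow> h < d \<Longrightarrow>
          norm (integral (cbox x (x + h *\<^sub>R One)) f /\<^sub>R h ^ DIM('a) - f x) < norm (w x)"
        using N(2)[OF x(2), of "norm (w x)"] by auto
      obtain r where r: "r > 0" "cball x r \<subseteq> box (a m) (b m)"
        using open_contains_cball x(1) open_box by blast
      \<comment> \<open>a cube of side \<open>h\<close> with corner \<open>x\<close> lies in the ball of radius \<open>h * DIM('a)\<close> around \<open>x\<close>\<close>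
      define h where "h = min (d / 2) (r / DIM('a))"
      have h: "0 < h" "h < d" "h * DIM('a) \<le> r"
        using d(1) r(1) by (auto simp: h_def min_def field_simps)
      have sub: "cbox x (x + h *\<^sub>R One) \<subseteq> box (a m) (b m)"
      proof
        fix y assume y: "y \<in> cbox x (x + h *\<^sub>R One)"
        have "norm (y - x) \<le> (\<Sum>i\<in>Basis. \<bar>(y - x) \<bullet> i\<bar>)" by (rule norm_le_l1)
        also have "\<dots> \<le> (\<Sum>i\<in>(Basis::'a set). h)"
          by (rule sum_mono) (use y in \<open>auto simp: mem_box inner_diff_left inner_add_left\<close>)
        also have "\<dots> \<le> r" using h(3) by (simp add: mult.commute)
        finally have "y \<in> cball x r" by (simp add: dist_norm norm_minus_commute)
        then show "y \<in> box (a m) (b m)" using r by blast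
      qed
      have "integral (cbox x (x + h *\<^sub>R One)) f = integral (cbox x (x + h *\<^sub>R One)) w"
        by (rule integral_cong) (use sub box_subset_cbox in \<open>auto simp: f_def\<close>)
      also have "\<dots> = 0"
        by (rule integral_box_eq_0_if_weakly_zero[OF assms
              subset_trans[OF sub subset_trans[OF box_subset_cbox ab(1)]]])
      finally show False using d(2)[OF h(1,2)] fx by simp
    qed
    then have "{x \<in> box (a m) (b m). w x \<noteq> 0} \<subseteq> N" by blast
    then show ?thesis using N(1) negligible_subset by blast
  qed
  then have "negligible (\<Union>m. {x \<in> box (a m) (b m). w x \<noteq> 0})"
    by (intro negligible_countable_Union) auto
  moreover have "(\<Union>m. {x \<in> box (a m) (b m). w x \<noteq> 0}) = {x \<in> \<Omega>. w x \<noteq> 0}" using ab(2) by auto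
  ultimately have "AE x in lebesgue. x \<notin> {x \<in> \<Omega>. w x \<noteq> 0}"
    unfolding negligible_iff_null_sets by (intro AE_not_in) simp
  then show ?thesis
    using assms(1) by (subst AE_restrict_space_iff) (auto elim!: eventually_mono)
qed

section \<open>Weak derivatives\<close>

lemma space_lebesgue_inter: "open \<Omega> \<Longrightarrow> \<Omega> \<inter> space lebesgue \<in> sets lebesgue"
  by simp

lemma borel_measurable_lebesgue_on_AE:
  fixes f g :: "'a::euclidean_space \<Rightarrow> 'b::euclidean_space"
  assumes "open \<Omega>" "f \<in> borel_measurable (lebesgue_on \<Omega>)" "AE x in lebesgue_on \<Omega>. f x = g x"
  shows "g \<in> borel_measurable (lebesgue_on \<Omega>)"
proof -
  have "(\<lambda>x. indicator \<Omega> x *\<^sub>R f x) \<in> borel_measurable lebesgue"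
    using assms(1,2) by (simp add: borel_measurable_restrict_space_iff)
  moreover have "AE x in lebesgue. indicator \<Omega> x *\<^sub>R f x = indicator \<Omega> x *\<^sub>R g x"
    using assms(1,3) by (subst (asm) AE_restrict_space_iff) (auto elim!: eventually_mono)
  ultimately have "(\<lambda>x. indicator \<Omega> x *\<^sub>R g x) \<in> borel_measurable lebesgue"
    by (rule borel_measurable_AE)
  then show ?thesis
    using assms(1) by (simp add: borel_measurable_restrict_space_iff)
qed

lemma continuous_on_imp_borel_measurable_lebesgue_on:
  "open \<Omega> \<Longrightarrow> continuous_on \<Omega> f \<Longrightarrow> f \<in> borel_measurable (lebesgue_on \<Omega>)"
  by (simp add: continuous_imp_measurable_on_sets_lebesgue)

lemma locally_integrable_continuous:
  fixes u :: "'a::euclidean_space \<Rightarrow> 'b::euclidean_space"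
  assumes "continuous_on \<Omega> u"
  shows "locally_integrable_on \<Omega> u"
  unfolding locally_integrable_on_def
proof (intro allI impI)
  fix K assume K: "compact K \<and> K \<subseteq> \<Omega>"
  have "integrable lborel (\<lambda>x. indicator K x *\<^sub>R u x)"
    using borel_integrable_compact[of K u] K assms continuous_on_subset by blast
  then have "integrable lebesgue (\<lambda>x. indicator K x *\<^sub>R u x)"
    by (simp add: integrable_completion)
  then show "integrable (lebesgue_on K) u"
    using K by (simp add: integrable_restrict_space compact_imp_closed)
qed

lemma integrable_compactly_supported_scaleR:
  fixes u :: "'a::euclidean_space \<Rightarrow> 'b::euclidean_space"
  assumes "open \<Omega>" "locally_integrable_on \<Omega> u" "continuous_on \<Omega> \<phi>"
    and K: "compact K" "K \<subseteq> \<Omega>" "\<And>x. x \<in> \<Omega> \<Longrightarrow> x \<notin> K \<Longrightarrow> \<phi> x = (0::real)"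
  shows "integrable (lebesgue_on \<Omega>) (\<lambda>x. \<phi> x *\<^sub>R u x)"
proof -
  have Kc: "K \<in> sets lebesgue" using borel_compact[OF K(1)] by simp
  have ui: "integrable (lebesgue_on K) u"
    using assms(2) K by (simp add: locally_integrable_on_def)
  have "bounded (\<phi> ` K)"
    using compact_continuous_image continuous_on_subset[OF assms(3) K(2)] K(1) compact_imp_bounded by blast
  then obtain M where M: "\<And>x. x \<in> K \<Longrightarrow> \<bar>\<phi> x\<bar> \<le> M" by (auto simp: bounded_iff)
  have "integrable (lebesgue_on K) (\<lambda>x. \<phi> x *\<^sub>R u x)"
  proof (rule Bochner_Integration.integrable_bound)
    show "integrable (lebesgue_on K) (\<lambda>x. M *\<^sub>R norm (u x))" using ui by simp
    have "\<phi> \<in> borel_measurable (lebesgue_on K)"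
      using continuous_imp_measurable_on_sets_lebesgue[OF continuous_on_subset[OF assms(3) K(2)] Kc] .
    then show "(\<lambda>x. \<phi> x *\<^sub>R u x) \<in> borel_measurable (lebesgue_on K)"
      using ui by (intro borel_measurable_scaleR) auto
    show "AE x in lebesgue_on K. norm (\<phi> x *\<^sub>R u x) \<le> norm (M *\<^sub>R norm (u x))"
      using M by (auto intro!: AE_I2 mult_right_mono order_trans[OF M abs_ge_self] simp: abs_mult)
  qed
  moreover have "indicator K x *\<^sub>R (\<phi> x *\<^sub>R u x) = indicator \<Omega> x *\<^sub>R (\<phi> x *\<^sub>R u x)" for x
    using K(2,3) by (cases "x \<in> \<Omega>"; cases "x \<in> K") auto
  ultimately show ?thesis
    using Kc assms(1) by (simp only: integrable_restrict_space Int_UNIV_right space_completion space_lborel space_borel sets_completionI_sets) (simp add: assms(1) integrable_restrict_space Kc)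
qed

lemma test_function_smooth: "test_function \<Omega> \<phi> \<Longrightarrow> smooth_on UNIV \<phi>"
  by (simp add: test_function_def)

lemma test_function_support:
  assumes "test_function \<Omega> \<phi>"
  obtains K where "compact K" "K \<subseteq> \<Omega>" "\<And>x. x \<notin> K \<Longrightarrow> \<phi> x = 0"
    "\<And>x v. x \<notin> K \<Longrightarrow> pd v \<phi> x = 0"
proof -
  obtain K where K: "compact K" "K \<subseteq> \<Omega>" "\<And>x. x \<notin> K \<Longrightarrow> \<phi> x = 0"
    using assms by (auto simp: test_function_def)
  have "pd v \<phi> x = 0" if "x \<notin> K" for x v
    by (rule pd_eq_0_outside_closed[OF compact_imp_closed[OF K(1)] K(3) that])
  with K that show ?thesis by blast
qed

lemma test_function_subset: "test_function U \<phi> \<Longrightarrow> U \<subseteq> \<Omega> \<Longrightarrow> test_function \<Omega> \<phi>"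
  unfolding test_function_def by blast

lemma integrable_test_scaleR:
  fixes u :: "'a::euclidean_space \<Rightarrow> 'b::euclidean_space" and \<phi> :: "'a \<Rightarrow> real"
  assumes "open \<Omega>" "locally_integrable_on \<Omega> u" "test_function \<Omega> \<phi>"
  shows "integrable (lebesgue_on \<Omega>) (\<lambda>x. \<phi> x *\<^sub>R u x)"
    and "v \<in> Basis \<Longrightarrow> integrable (lebesgue_on \<Omega>) (\<lambda>x. pd v \<phi> x *\<^sub>R u x)"
proof -
  obtain K where K: "compact K" "K \<subseteq> \<Omega>" "\<And>x. x \<notin> K \<Longrightarrow> \<phi> x = 0"
    "\<And>x v. x \<notin> K \<Longrightarrow> pd v \<phi> x = 0"
    by (rule test_function_support[OF assms(3)]) blast
  note s = test_function_smooth[OF assms(3)]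
  show "integrable (lebesgue_on \<Omega>) (\<lambda>x. \<phi> x *\<^sub>R u x)"
    by (rule integrable_compactly_supported_scaleR[OF assms(1,2) _ K(1,2)])
      (use K(3) continuous_on_subset[OF smooth_on_continuous_on[OF s]] in auto)
  show "integrable (lebesgue_on \<Omega>) (\<lambda>x. pd v \<phi> x *\<^sub>R u x)" if "v \<in> Basis"
    by (rule integrable_compactly_supported_scaleR[OF assms(1,2) _ K(1,2)])
      (use K(4) continuous_on_subset[OF smooth_on_continuous_on[OF smooth_on_pd[OF s that]]] in auto)
qed

lemma locally_integrable_diff:
  "locally_integrable_on \<Omega> u \<Longrightarrow> locally_integrable_on \<Omega> w \<Longrightarrow> locally_integrable_on \<Omega> (\<lambda>x. u x - w x)"
  by (auto simp: locally_integrable_on_def)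

lemma locally_integrable_add:
  "locally_integrable_on \<Omega> u \<Longrightarrow> locally_integrable_on \<Omega> w \<Longrightarrow> locally_integrable_on \<Omega> (\<lambda>x. u x + w x)"
  by (auto simp: locally_integrable_on_def)

lemma AE_eq_if_weakly_eq:
  fixes w w' :: "'a::euclidean_space \<Rightarrow> 'b::euclidean_space"
  assumes "open \<Omega>" "locally_integrable_on \<Omega> w" "locally_integrable_on \<Omega> w'"
    and "\<And>\<phi> :: 'a \<Rightarrow> real. test_function \<Omega> \<phi> \<Longrightarrow>
      (LINT x|lebesgue_on \<Omega>. \<phi> x *\<^sub>R w x) = (LINT x|lebesgue_on \<Omega>. \<phi> x *\<^sub>R w' x)"
  shows "AE x in lebesgue_on \<Omega>. w x = w' x"
proof -
  have "AE x in lebesgue_on \<Omega>. w x - w' x = 0"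
  proof (rule AE_eq_0_if_weakly_zero[OF assms(1)])
    fix \<phi> :: "'a \<Rightarrow> real" assume t: "test_function \<Omega> \<phi>"
    with assms(4)[OF t] integrable_test_scaleR(1)[OF assms(1,2) t] integrable_test_scaleR(1)[OF assms(1,3) t]
    show "(LINT x|lebesgue_on \<Omega>. \<phi> x *\<^sub>R (w x - w' x)) = 0"
      by (simp add: scaleR_diff_right)
  qed (rule locally_integrable_diff[OF assms(2,3)])
  then show ?thesis by simp
qed

lemma has_weak_deriv_unique:
  fixes u :: "'a::euclidean_space \<Rightarrow> 'b::euclidean_space"
  assumes "open \<Omega>" "has_weak_deriv \<Omega> u v w" "has_weak_deriv \<Omega> u v w'"
  shows "AE x in lebesgue_on \<Omega>. w x = w' x"
proof (rule AE_eq_if_weakly_eq[OF assms(1)])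
  fix \<phi> :: "'a \<Rightarrow> real" assume "test_function \<Omega> \<phi>"
  then show "(LINT x|lebesgue_on \<Omega>. \<phi> x *\<^sub>R w x) = (LINT x|lebesgue_on \<Omega>. \<phi> x *\<^sub>R w' x)"
    using assms(2,3) unfolding has_weak_deriv_def by (metis neg_equal_iff_equal)
qed (use assms in \<open>auto simp: has_weak_deriv_def\<close>)

lemma has_weak_deriv_weak_deriv:
  "has_weak_deriv \<Omega> u v w \<Longrightarrow> has_weak_deriv \<Omega> u v (weak_deriv \<Omega> u v)"
  unfolding weak_deriv_def by (rule someI[of "has_weak_deriv \<Omega> u v"])

lemma weak_deriv_AE:
  fixes u :: "'a::euclidean_space \<Rightarrow> 'b::euclidean_space"
  shows "open \<Omega> \<Longrightarrow> has_weak_deriv \<Omega> u v w \<Longrightarrow> AE x in lebesgue_on \<Omega>. weak_deriv \<Omega> u v x = w x"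
  using has_weak_deriv_unique has_weak_deriv_weak_deriv by blast

lemma has_weak_deriv_add:
  fixes u :: "'a::euclidean_space \<Rightarrow> 'b::euclidean_space"
  assumes "open \<Omega>" "v \<in> Basis" and u: "has_weak_deriv \<Omega> u v w" and u': "has_weak_deriv \<Omega> u' v w'"
  shows "has_weak_deriv \<Omega> (\<lambda>x. u x + u' x) v (\<lambda>x. w x + w' x)"
  unfolding has_weak_deriv_def
proof (intro conjI allI impI)
  have l: "locally_integrable_on \<Omega> u" "locally_integrable_on \<Omega> u'"
      "locally_integrable_on \<Omega> w" "locally_integrable_on \<Omega> w'"
    using u u' by (auto simp: has_weak_deriv_def)
  then show "locally_integrable_on \<Omega> (\<lambda>x. u x + u' x)" "locally_integrable_on \<Omega> (\<lambda>x. w x + w' x)"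
    by (simp_all add: locally_integrable_add)
  fix \<phi> :: "'a \<Rightarrow> real" assume t: "test_function \<Omega> \<phi>"
  show "(LINT x|lebesgue_on \<Omega>. pd v \<phi> x *\<^sub>R (u x + u' x)) = - (LINT x|lebesgue_on \<Omega>. \<phi> x *\<^sub>R (w x + w' x))"
    using u u' t integrable_test_scaleR(2)[OF assms(1) l(1) t assms(2)]
      integrable_test_scaleR(2)[OF assms(1) l(2) t assms(2)]
      integrable_test_scaleR(1)[OF assms(1) l(3) t] integrable_test_scaleR(1)[OF assms(1) l(4) t]
    by (simp add: has_weak_deriv_def scaleR_add_right)
qed

lemma has_weak_deriv_bounded_linear:
  fixes u :: "'a::euclidean_space \<Rightarrow> 'b::euclidean_space"
    and h :: "'b \<Rightarrow> 'c::euclidean_space"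
  assumes h: "bounded_linear h" and "open \<Omega>" "v \<in> Basis" and u: "has_weak_deriv \<Omega> u v w"
  shows "has_weak_deriv \<Omega> (\<lambda>x. h (u x)) v (\<lambda>x. h (w x))"
  unfolding has_weak_deriv_def
proof (intro conjI allI impI)
  show "locally_integrable_on \<Omega> (\<lambda>x. h (u x))" "locally_integrable_on \<Omega> (\<lambda>x. h (w x))"
    using u integrable_bounded_linear[OF h] by (auto simp: has_weak_deriv_def locally_integrable_on_def)
  fix \<phi> :: "'a \<Rightarrow> real" assume t: "test_function \<Omega> \<phi>"
  have eq: "(LINT x|lebesgue_on \<Omega>. f x *\<^sub>R h (g x)) = h (LINT x|lebesgue_on \<Omega>. f x *\<^sub>R g x)"
    if "integrable (lebesgue_on \<Omega>) (\<lambda>x. f x *\<^sub>R g x)" for f :: "'a \<Rightarrow> real" and g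
    using integral_bounded_linear[OF h that] by (simp add: linear_simps(5)[OF h])
  show "(LINT x|lebesgue_on \<Omega>. pd v \<phi> x *\<^sub>R h (u x)) = - (LINT x|lebesgue_on \<Omega>. \<phi> x *\<^sub>R h (w x))"
    using u t integrable_test_scaleR[OF assms(2) _ t, of u] integrable_test_scaleR[OF assms(2) _ t, of w] assms(3)
    by (simp add: has_weak_deriv_def eq linear_neg[OF bounded_linear.linear[OF h]])
qed

lemma has_weak_deriv_diff:
  fixes u :: "'a::euclidean_space \<Rightarrow> 'b::euclidean_space"
  assumes "open \<Omega>" "v \<in> Basis" "has_weak_deriv \<Omega> u v w" "has_weak_deriv \<Omega> u' v w'"
  shows "has_weak_deriv \<Omega> (\<lambda>x. u x - u' x) v (\<lambda>x. w x - w' x)"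
  using has_weak_deriv_add[OF assms(1-3) has_weak_deriv_bounded_linear[OF bounded_linear_minus[OF bounded_linear_ident] assms(1,2,4)]]
  by simp

lemma has_weak_deriv_smooth:
  fixes g :: "'a::euclidean_space \<Rightarrow> 'b::euclidean_space"
  assumes g: "smooth_on \<Omega> g" and v: "v \<in> Basis"
  shows "has_weak_deriv \<Omega> g v (pd v g)"
  unfolding has_weak_deriv_def
proof (intro conjI allI impI)
  note o = smooth_on_open[OF g] and c = smooth_on_continuous_on[OF g]
    smooth_on_continuous_on[OF smooth_on_pd[OF g v]]
  show l: "locally_integrable_on \<Omega> g" "locally_integrable_on \<Omega> (pd v g)"
    using c by (simp_all add: locally_integrable_continuous)
  fix \<phi> :: "'a \<Rightarrow> real" assume t: "test_function \<Omega> \<phi>"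
  note s = test_function_smooth[OF t]
  obtain K where K: "compact K" "K \<subseteq> \<Omega>" "\<And>x. x \<notin> K \<Longrightarrow> \<phi> x = 0"
    by (rule test_function_support[OF t]) blast
  have "(LINT x|lebesgue_on \<Omega>. \<phi> x *\<^sub>R pd v g x + pd v \<phi> x *\<^sub>R g x) = 0"
  proof (rule integral_derivative_compact_support(2)[OF o K(1,2),
        where \<psi>="\<lambda>x. \<phi> x *\<^sub>R g x" and \<psi>'="\<lambda>x v. \<phi> x *\<^sub>R pd v g x + pd v \<phi> x *\<^sub>R g x"])
    show "((\<lambda>x. \<phi> x *\<^sub>R g x) has_derivative (\<lambda>v. \<phi> x *\<^sub>R pd v g x + pd v \<phi> x *\<^sub>R g x)) (at x)"
      if "x \<in> \<Omega>" for x
      by (intro has_derivative_scaleR smooth_on_has_derivative[OF g that] smooth_on_has_derivative[OF s UNIV_I])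
    show "continuous_on \<Omega> (\<lambda>x. \<phi> x *\<^sub>R pd v g x + pd v \<phi> x *\<^sub>R g x)"
      by (intro continuous_intros c continuous_on_subset[OF smooth_on_continuous_on[OF s]]
          continuous_on_subset[OF smooth_on_continuous_on[OF smooth_on_pd[OF s v]]]) auto
  qed (use K in auto)
  then show "(LINT x|lebesgue_on \<Omega>. pd v \<phi> x *\<^sub>R g x) = - (LINT x|lebesgue_on \<Omega>. \<phi> x *\<^sub>R pd v g x)"
    using integrable_test_scaleR[OF o l(1) t] integrable_test_scaleR[OF o l(2) t] v
    by (simp add: add_eq_0_iff2)
qed

lemma has_weak_deriv_subset:
  fixes u :: "'a::euclidean_space \<Rightarrow> 'b::euclidean_space"
  assumes "open \<Omega>" "open U" "U \<subseteq> \<Omega>" "has_weak_deriv \<Omega> u v w"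
  shows "has_weak_deriv U u v w"
  unfolding has_weak_deriv_def
proof (intro conjI allI impI)
  show "locally_integrable_on U u" "locally_integrable_on U w"
    using assms by (auto simp: has_weak_deriv_def locally_integrable_on_def)
  fix \<phi> :: "'a \<Rightarrow> real" assume t: "test_function U \<phi>"
  have eq: "(LINT x|lebesgue_on U. f x *\<^sub>R g x) = (LINT x|lebesgue_on \<Omega>. f x *\<^sub>R g x)"
    if "\<And>x. x \<notin> U \<Longrightarrow> f x = 0" for f :: "'a \<Rightarrow> real" and g :: "'a \<Rightarrow> 'b"
  proof -
    have "indicator U x *\<^sub>R (f x *\<^sub>R g x) = indicator \<Omega> x *\<^sub>R (f x *\<^sub>R g x)" for x
      using that[of x] assms(3) by (cases "x \<in> U"; cases "x \<in> \<Omega>") auto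
    then show ?thesis
      by (simp only: integral_restrict_space[OF space_lebesgue_inter[OF assms(1)]]
        integral_restrict_space[OF space_lebesgue_inter[OF assms(2)]])
  qed
  obtain K where K: "compact K" "K \<subseteq> U" "\<And>x. x \<notin> K \<Longrightarrow> \<phi> x = 0"
    "\<And>x v. x \<notin> K \<Longrightarrow> pd v \<phi> x = 0"
    by (rule test_function_support[OF t]) blast
  show "(LINT x|lebesgue_on U. pd v \<phi> x *\<^sub>R u x) = - (LINT x|lebesgue_on U. \<phi> x *\<^sub>R w x)"
  proof -
    have z: "\<phi> x = 0" "pd v \<phi> x = 0" if "x \<notin> U" for x using K(2-4) that by blast+
    have "(LINT x|lebesgue_on U. pd v \<phi> x *\<^sub>R u x) = (LINT x|lebesgue_on \<Omega>. pd v \<phi> x *\<^sub>R u x)"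
      "(LINT x|lebesgue_on U. \<phi> x *\<^sub>R w x) = (LINT x|lebesgue_on \<Omega>. \<phi> x *\<^sub>R w x)"
      by (intro eq z; assumption)+
    then show ?thesis
      using assms(4) test_function_subset[OF t assms(3)] by (simp add: has_weak_deriv_def)
  qed
qed

text \<open>The link between the weak derivatives that enter the energy and the classical ones. It serves twice: for
  a smooth minimizer on all of \<open>\<Omega>\<close>, and for the limit map near a point where it is smooth.\<close>

lemma weak_deriv_eq_pd_if_AE_eq_smooth:
  fixes u :: "'a::euclidean_space \<Rightarrow> 'b::euclidean_space"
  assumes g: "smooth_on U g" and ae: "AE x in lebesgue_on U. u x = g x"
    and v: "v \<in> Basis" and w: "has_weak_deriv U u v w"
  shows "AE x in lebesgue_on U. w x = pd v g x"
proof (rule AE_eq_if_weakly_eq[OF smooth_on_open[OF g]])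
  note o = smooth_on_open[OF g] and gw = has_weak_deriv_smooth[OF g v]
  show l: "locally_integrable_on U w" "locally_integrable_on U (pd v g)"
    using w gw by (auto simp: has_weak_deriv_def)
  have lu: "locally_integrable_on U u" "locally_integrable_on U g"
    using w gw by (auto simp: has_weak_deriv_def)
  fix \<phi> :: "'a \<Rightarrow> real" assume t: "test_function U \<phi>"
  have "(LINT x|lebesgue_on U. pd v \<phi> x *\<^sub>R u x) = (LINT x|lebesgue_on U. pd v \<phi> x *\<^sub>R g x)"
    using integrable_test_scaleR(2)[OF o lu(1) t v] integrable_test_scaleR(2)[OF o lu(2) t v] ae
    by (intro integral_cong_AE) (auto elim!: eventually_mono)
  then show "(LINT x|lebesgue_on U. \<phi> x *\<^sub>R w x) = (LINT x|lebesgue_on U. \<phi> x *\<^sub>R pd v g x)"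
    using w gw t by (simp add: has_weak_deriv_def)
qed

section \<open>Sobolev functions and boundary values\<close>

lemma square_integrable_on_integrable:
  "square_integrable_on \<Omega> u \<Longrightarrow> integrable (lebesgue_on \<Omega>) (\<lambda>x. (norm (u x))\<^sup>2)"
  by (simp add: square_integrable_on_def)

lemma square_integrable_on_measurable:
  "square_integrable_on \<Omega> u \<Longrightarrow> u \<in> borel_measurable (lebesgue_on \<Omega>)"
  by (simp add: square_integrable_on_def)

lemma square_integrable_on_bound:
  fixes u :: "'a::euclidean_space \<Rightarrow> 'b::euclidean_space"
  assumes "u \<in> borel_measurable (lebesgue_on \<Omega>)" "integrable (lebesgue_on \<Omega>) h"
    "AE x in lebesgue_on \<Omega>. (norm (u x))\<^sup>2 \<le> h x"
  shows "square_integrable_on \<Omega> u"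
  unfolding square_integrable_on_def
proof
  show "integrable (lebesgue_on \<Omega>) (\<lambda>x. (norm (u x))\<^sup>2)"
    by (rule Bochner_Integration.integrable_bound[OF assms(2)])
      (use assms(1,3) in \<open>auto elim!: eventually_mono\<close>)
qed (fact assms(1))

lemma norm_add_power2_le: "(norm (a + b))\<^sup>2 \<le> 2 * (norm a)\<^sup>2 + 2 * (norm (b :: 'a::real_normed_vector))\<^sup>2"
proof -
  have "(norm (a + b))\<^sup>2 \<le> (norm a + norm b)\<^sup>2"
    by (intro power_mono norm_triangle_ineq) simp
  also have "\<dots> \<le> 2 * (norm a)\<^sup>2 + 2 * (norm b)\<^sup>2"
    using sum_squares_bound[of "norm a" "norm b"] by (simp add: power2_sum)
  finally show ?thesis .
qed

lemma square_integrable_on_add: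
  fixes u :: "'a::euclidean_space \<Rightarrow> 'b::euclidean_space"
  assumes "square_integrable_on \<Omega> u" "square_integrable_on \<Omega> w"
  shows "square_integrable_on \<Omega> (\<lambda>x. u x + w x)"
  by (rule square_integrable_on_bound[where h="\<lambda>x. 2 * (norm (u x))\<^sup>2 + 2 * (norm (w x))\<^sup>2"])
    (use assms in \<open>auto simp: square_integrable_on_def norm_add_power2_le\<close>)

lemma square_integrable_on_bounded_linear:
  fixes u :: "'a::euclidean_space \<Rightarrow> 'b::euclidean_space"
    and h :: "'b \<Rightarrow> 'c::euclidean_space"
  assumes h: "bounded_linear h" and u: "square_integrable_on \<Omega> u"
  shows "square_integrable_on \<Omega> (\<lambda>x. h (u x))"
proof -
  obtain C where C: "\<And>y. norm (h y) \<le> norm y * C" using bounded_linear.bounded[OF h] by blast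
  show ?thesis
  proof (rule square_integrable_on_bound[where h="\<lambda>x. C\<^sup>2 * (norm (u x))\<^sup>2"])
    show "(\<lambda>x. h (u x)) \<in> borel_measurable (lebesgue_on \<Omega>)"
      using square_integrable_on_measurable[OF u] linear_continuous_on[OF h, of UNIV]
      by (metis borel_measurable_continuous_onI measurable_compose)
    show "AE x in lebesgue_on \<Omega>. (norm (h (u x)))\<^sup>2 \<le> C\<^sup>2 * (norm (u x))\<^sup>2"
      using power_mono[OF C norm_ge_zero, of _ 2] by (simp add: power_mult_distrib mult.commute)
  qed (use square_integrable_on_integrable[OF u] in simp)
qed

lemma square_integrable_on_AE_cong:
  fixes u :: "'a::euclidean_space \<Rightarrow> 'b::euclidean_space"
  assumes "open \<Omega>" "square_integrable_on \<Omega> u" "AE x in lebesgue_on \<Omega>. w x = u x"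
  shows "square_integrable_on \<Omega> w"
proof (rule square_integrable_on_bound[OF _ square_integrable_on_integrable[OF assms(2)]])
  have "AE x in lebesgue_on \<Omega>. u x = w x" using assms(3) by (auto elim!: eventually_mono)
  then show "w \<in> borel_measurable (lebesgue_on \<Omega>)"
    by (rule borel_measurable_lebesgue_on_AE[OF assms(1) square_integrable_on_measurable[OF assms(2)]])
  show "AE x in lebesgue_on \<Omega>. (norm (w x))\<^sup>2 \<le> (norm (u x))\<^sup>2"
    using assms(3) by (auto elim!: eventually_mono)
qed

lemma W12_square_integrable: "u \<in> W12 \<Omega> T \<Longrightarrow> square_integrable_on \<Omega> u"
  by (simp add: W12_def)

lemma W12_has_weak_deriv:
  "u \<in> W12 \<Omega> T \<Longrightarrow> v \<in> Basis \<Longrightarrow> has_weak_deriv \<Omega> u v (weak_deriv \<Omega> u v)"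
  unfolding W12_def using has_weak_deriv_weak_deriv by blast

lemma W12_square_integrable_deriv:
  fixes u :: "'a::euclidean_space \<Rightarrow> 'b::euclidean_space"
  assumes "open \<Omega>" "u \<in> W12 \<Omega> T" "v \<in> Basis"
  shows "square_integrable_on \<Omega> (weak_deriv \<Omega> u v)"
proof -
  obtain w where "has_weak_deriv \<Omega> u v w" "square_integrable_on \<Omega> w"
    using assms(2,3) by (auto simp: W12_def)
  then show ?thesis
    using square_integrable_on_AE_cong[OF assms(1) _ weak_deriv_AE[OF assms(1)]] by blast
qed

lemma W12_I:
  assumes "square_integrable_on \<Omega> u" "\<And>v. v \<in> Basis \<Longrightarrow> has_weak_deriv \<Omega> u v (w v)"
    "\<And>v. v \<in> Basis \<Longrightarrow> square_integrable_on \<Omega> (w v)" "AE x in lebesgue_on \<Omega>. u x \<in> T"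
  shows "u \<in> W12 \<Omega> T"
  using assms unfolding W12_def by blast

lemma weak_grad_sq_nonneg: "weak_grad_sq \<Omega> u x \<ge> 0"
  by (simp add: weak_grad_sq_def sum_nonneg)

lemma integrable_weak_grad_sq:
  fixes u :: "'a::euclidean_space \<Rightarrow> 'b::euclidean_space"
  assumes "open \<Omega>" "u \<in> W12 \<Omega> T"
  shows "integrable (lebesgue_on \<Omega>) (weak_grad_sq \<Omega> u)"
  unfolding weak_grad_sq_def
  by (intro Bochner_Integration.integrable_sum square_integrable_on_integrable
      W12_square_integrable_deriv[OF assms])

lemma W12_UNIV: "u \<in> W12 \<Omega> T \<Longrightarrow> u \<in> W12 \<Omega> UNIV"
  by (auto simp: W12_def)

lemma W12_add:
  fixes u :: "'a::euclidean_space \<Rightarrow> 'b::euclidean_space"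
  assumes "open \<Omega>" "u \<in> W12 \<Omega> S" "w \<in> W12 \<Omega> T"
  shows "(\<lambda>x. u x + w x) \<in> W12 \<Omega> UNIV"
proof (rule W12_I[where w="\<lambda>v x. weak_deriv \<Omega> u v x + weak_deriv \<Omega> w v x"])
  show "square_integrable_on \<Omega> (\<lambda>x. u x + w x)"
    by (rule square_integrable_on_add[OF W12_square_integrable[OF assms(2)] W12_square_integrable[OF assms(3)]])
  fix v :: 'a assume v: "v \<in> Basis"
  show "has_weak_deriv \<Omega> (\<lambda>x. u x + w x) v (\<lambda>x. weak_deriv \<Omega> u v x + weak_deriv \<Omega> w v x)"
    by (rule has_weak_deriv_add[OF assms(1) v W12_has_weak_deriv[OF assms(2) v] W12_has_weak_deriv[OF assms(3) v]])
  show "square_integrable_on \<Omega> (\<lambda>x. weak_deriv \<Omega> u v x + weak_deriv \<Omega> w v x)"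
    by (rule square_integrable_on_add[OF W12_square_integrable_deriv[OF assms(1,2) v]
          W12_square_integrable_deriv[OF assms(1,3) v]])
qed simp

lemma W12_bounded_linear:
  fixes u :: "'a::euclidean_space \<Rightarrow> 'b::euclidean_space"
    and h :: "'b \<Rightarrow> 'c::euclidean_space"
  assumes "open \<Omega>" "u \<in> W12 \<Omega> S" "bounded_linear h" "\<And>y. h y \<in> T"
  shows "(\<lambda>x. h (u x)) \<in> W12 \<Omega> T"
proof (rule W12_I[where w="\<lambda>v x. h (weak_deriv \<Omega> u v x)"])
  show "square_integrable_on \<Omega> (\<lambda>x. h (u x))"
    by (rule square_integrable_on_bounded_linear[OF assms(3) W12_square_integrable[OF assms(2)]])
  fix v :: 'a assume v: "v \<in> Basis"
  show "has_weak_deriv \<Omega> (\<lambda>x. h (u x)) v (\<lambda>x. h (weak_deriv \<Omega> u v x))"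
    by (rule has_weak_deriv_bounded_linear[OF assms(3,1) v W12_has_weak_deriv[OF assms(2) v]])
  show "square_integrable_on \<Omega> (\<lambda>x. h (weak_deriv \<Omega> u v x))"
    by (rule square_integrable_on_bounded_linear[OF assms(3) W12_square_integrable_deriv[OF assms(1,2) v]])
qed (simp add: assms(4))

lemma W12_diff:
  fixes u :: "'a::euclidean_space \<Rightarrow> 'b::euclidean_space"
  assumes "open \<Omega>" "u \<in> W12 \<Omega> S" "w \<in> W12 \<Omega> T"
  shows "(\<lambda>x. u x - w x) \<in> W12 \<Omega> UNIV"
  using W12_add[OF assms(1,2) W12_bounded_linear[OF assms(1,3) bounded_linear_minus[OF bounded_linear_ident], of UNIV]]
  by simp

lemma square_integrable_on_continuous_compact_support:
  fixes \<phi> :: "'a::euclidean_space \<Rightarrow> 'b::euclidean_space"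
  assumes "open \<Omega>" "continuous_on UNIV \<phi>" "compact K" "K \<subseteq> \<Omega>" "\<And>x. x \<notin> K \<Longrightarrow> \<phi> x = 0"
  shows "square_integrable_on \<Omega> \<phi>"
proof -
  have c: "continuous_on \<Omega> (\<lambda>x. (norm (\<phi> x))\<^sup>2)"
    using continuous_on_subset[OF assms(2)] by (auto intro!: continuous_intros)
  have "integrable (lebesgue_on \<Omega>) (\<lambda>x. (norm (\<phi> x))\<^sup>2 *\<^sub>R (1::real))"
    by (rule integrable_compactly_supported_scaleR[OF assms(1) locally_integrable_continuous c assms(3,4)])
      (use assms(5) in auto)
  then show ?thesis
    using continuous_on_imp_borel_measurable_lebesgue_on[OF assms(1) continuous_on_subset[OF assms(2)]]
    by (simp add: square_integrable_on_def)
qed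

lemma test_function_W12:
  fixes \<phi> :: "'a::euclidean_space \<Rightarrow> 'b::euclidean_space"
  assumes "open \<Omega>" "test_function \<Omega> \<phi>"
  shows "\<phi> \<in> W12 \<Omega> UNIV"
proof (rule W12_I[where w="\<lambda>v. pd v \<phi>"])
  note s = test_function_smooth[OF assms(2)]
  obtain K where K: "compact K" "K \<subseteq> \<Omega>" "\<And>x. x \<notin> K \<Longrightarrow> \<phi> x = 0"
    "\<And>x v. x \<notin> K \<Longrightarrow> pd v \<phi> x = 0"
    by (rule test_function_support[OF assms(2)]) blast
  show "square_integrable_on \<Omega> \<phi>"
    by (rule square_integrable_on_continuous_compact_support[OF assms(1) smooth_on_continuous_on[OF s] K(1-3)])
  fix v :: 'a assume v: "v \<in> Basis"
  show "square_integrable_on \<Omega> (pd v \<phi>)"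
    by (rule square_integrable_on_continuous_compact_support[OF assms(1)
          smooth_on_continuous_on[OF smooth_on_pd[OF s v]] K(1,2,4)])
  show "has_weak_deriv \<Omega> \<phi> v (pd v \<phi>)"
    by (rule has_weak_deriv_smooth[OF smooth_on_subset[OF s assms(1)] v]) simp
qed auto

lemma test_function_add:
  "test_function \<Omega> \<phi> \<Longrightarrow> test_function \<Omega> \<psi> \<Longrightarrow> test_function \<Omega> (\<lambda>x. \<phi> x + \<psi> x)"
proof -
  assume a: "test_function \<Omega> \<phi>" "test_function \<Omega> \<psi>"
  then obtain K K' where "compact K" "K \<subseteq> \<Omega>" "\<forall>x. x \<notin> K \<longrightarrow> \<phi> x = 0"
    "compact K'" "K' \<subseteq> \<Omega>" "\<forall>x. x \<notin> K' \<longrightarrow> \<psi> x = 0"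
    unfolding test_function_def by blast
  then have "compact (K \<union> K') \<and> K \<union> K' \<subseteq> \<Omega> \<and> (\<forall>x. x \<notin> K \<union> K' \<longrightarrow> \<phi> x + \<psi> x = 0)"
    by auto
  then show ?thesis
    using a smooth_on_add unfolding test_function_def by blast
qed

text \<open>All competitors below arise by adding a test function. Adding it to the whole approximating sequence as
  well leaves the differences that have to tend to zero unchanged.\<close>

lemma boundary_values_add_test_function:
  fixes u :: "'a::euclidean_space \<Rightarrow> 'b::euclidean_space"
  assumes "open \<Omega>" "boundary_values \<Omega> u g" "test_function \<Omega> \<phi>"
  shows "boundary_values \<Omega> (\<lambda>x. u x + \<phi> x) g"
proof -
  obtain G \<psi> where G: "G \<in> W12 \<Omega> UNIV" "continuous_on (closure \<Omega>) G" "\<forall>x\<in>frontier \<Omega>. G x = g x"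
    and \<psi>: "\<And>j. test_function \<Omega> (\<psi> j)" "tendsto_W12 \<Omega> UNIV \<psi> (\<lambda>x. u x - G x)"
    using assms(2) unfolding boundary_values_def W12_0_def by blast
  have "tendsto_W12 \<Omega> UNIV (\<lambda>j x. \<psi> j x + \<phi> x) (\<lambda>x. u x + \<phi> x - G x)"
    unfolding tendsto_W12_def
  proof (intro conjI allI)
    have t: "test_function \<Omega> (\<lambda>x. \<psi> j x + \<phi> x)" for j
      by (rule test_function_add[OF \<psi>(1) assms(3)])
    show "(\<lambda>x. \<psi> j x + \<phi> x) \<in> W12 \<Omega> UNIV" for j
      by (rule test_function_W12[OF assms(1) t])
    have "(\<lambda>x. (u x - G x) + \<phi> x) \<in> W12 \<Omega> UNIV"
      using \<psi>(2) test_function_W12[OF assms(1,3)] by (intro W12_add[OF assms(1)]) (auto simp: tendsto_W12_def)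
    then show "(\<lambda>x. u x + \<phi> x - G x) \<in> W12 \<Omega> UNIV" by (simp add: algebra_simps)
    have "(\<lambda>x. \<psi> j x + \<phi> x - (u x + \<phi> x - G x)) = (\<lambda>x. \<psi> j x - (u x - G x))" for j
      by (auto simp: algebra_simps)
    then show "(\<lambda>j. W12_norm \<Omega> (\<lambda>x. \<psi> j x + \<phi> x - (u x + \<phi> x - G x))) \<longlonglongrightarrow> 0"
      using \<psi>(2) by (simp add: tendsto_W12_def)
  qed
  then have "(\<lambda>x. u x + \<phi> x - G x) \<in> W12_0 \<Omega>"
    unfolding W12_0_def using test_function_add[OF \<psi>(1) assms(3)] by (intro CollectI exI conjI allI)
  then show ?thesis unfolding boundary_values_def using G by blast
qed

lemma test_function_zero: "test_function \<Omega> (\<lambda>x. 0)"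
  by (auto simp: test_function_def smooth_on_const)

lemma W12_norm_zero:
  assumes "open \<Omega>"
  shows "W12_norm \<Omega> (\<lambda>x::'a::euclidean_space. 0 :: 'b::euclidean_space) = 0"
proof -
  have "AE x in lebesgue_on \<Omega>. weak_deriv \<Omega> (\<lambda>x::'a. 0 :: 'b) v x = 0" if "v \<in> Basis" for v
    using weak_deriv_AE[OF assms has_weak_deriv_smooth[OF smooth_on_const[OF assms] that, of "0::'b"]] by simp
  then have "AE x in lebesgue_on \<Omega>. \<forall>v\<in>Basis. weak_deriv \<Omega> (\<lambda>x::'a. 0 :: 'b) v x = 0"
    by (simp add: AE_finite_all)
  then have "AE x in lebesgue_on \<Omega>. weak_grad_sq \<Omega> (\<lambda>x::'a. 0 :: 'b) x = 0"
    by (auto elim!: eventually_mono simp: weak_grad_sq_def)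
  then have "(LINT x|lebesgue_on \<Omega>. weak_grad_sq \<Omega> (\<lambda>x::'a. 0 :: 'b) x) = 0"
    by (rule integral_eq_zero_AE)
  then show ?thesis by (simp add: W12_norm_def)
qed

lemma zero_in_W12_0: "open \<Omega> \<Longrightarrow> (\<lambda>x. 0) \<in> W12_0 \<Omega>"
  unfolding W12_0_def tendsto_W12_def
  by (intro CollectI exI[of _ "\<lambda>_ _. 0"])
    (simp add: W12_norm_zero test_function_zero test_function_W12[OF _ test_function_zero])

lemma boundary_values_self:
  assumes "open \<Omega>" "G \<in> W12 \<Omega> UNIV" "continuous_on (closure \<Omega>) G" "\<And>x. x \<in> frontier \<Omega> \<Longrightarrow> G x = g x"
  shows "boundary_values \<Omega> G g"
  unfolding boundary_values_def using assms zero_in_W12_0[OF assms(1)] by (intro exI[of _ G]) auto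

lemma weak_grad_sq_AE_eq:
  fixes u :: "'a::euclidean_space \<Rightarrow> 'b::euclidean_space"
  assumes "open \<Omega>" "\<And>v. v \<in> Basis \<Longrightarrow> has_weak_deriv \<Omega> u v (w v)"
  shows "AE x in lebesgue_on \<Omega>. weak_grad_sq \<Omega> u x = (\<Sum>v\<in>Basis. (norm (w v x))\<^sup>2)"
proof -
  have "AE x in lebesgue_on \<Omega>. \<forall>v\<in>Basis. weak_deriv \<Omega> u v x = w v x"
    using weak_deriv_AE[OF assms(1) assms(2)] by (simp add: AE_finite_all)
  then show ?thesis by (auto elim!: eventually_mono simp: weak_grad_sq_def)
qed

lemma weak_grad_sq_diff_AE:
  fixes u :: "'a::euclidean_space \<Rightarrow> 'b::euclidean_space"
  assumes "open \<Omega>" "u \<in> W12 \<Omega> S" "w \<in> W12 \<Omega> T"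
  shows "AE x in lebesgue_on \<Omega>. weak_grad_sq \<Omega> (\<lambda>x. u x - w x) x =
    (\<Sum>v\<in>Basis. (norm (weak_deriv \<Omega> u v x - weak_deriv \<Omega> w v x))\<^sup>2)"
  by (intro weak_grad_sq_AE_eq[OF assms(1)] has_weak_deriv_diff[OF assms(1)]
      W12_has_weak_deriv[OF assms(2)] W12_has_weak_deriv[OF assms(3)])

lemma weak_grad_sq_triangle_AE:
  fixes u :: "'a::euclidean_space \<Rightarrow> 'b::euclidean_space"
  assumes "open \<Omega>" "u \<in> W12 \<Omega> S" "w \<in> W12 \<Omega> T"
  shows "AE x in lebesgue_on \<Omega>. weak_grad_sq \<Omega> u x \<le>
    2 * weak_grad_sq \<Omega> w x + 2 * weak_grad_sq \<Omega> (\<lambda>x. u x - w x) x"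
  using weak_grad_sq_diff_AE[OF assms]
proof eventually_elim
  case (elim x)
  have "weak_grad_sq \<Omega> u x \<le> (\<Sum>v\<in>Basis. 2 * (norm (weak_deriv \<Omega> w v x))\<^sup>2 +
      2 * (norm (weak_deriv \<Omega> u v x - weak_deriv \<Omega> w v x))\<^sup>2)"
    unfolding weak_grad_sq_def
  proof (rule sum_mono)
    fix v
    show "(norm (weak_deriv \<Omega> u v x))\<^sup>2 \<le> 2 * (norm (weak_deriv \<Omega> w v x))\<^sup>2 +
      2 * (norm (weak_deriv \<Omega> u v x - weak_deriv \<Omega> w v x))\<^sup>2"
      using norm_add_power2_le[of "weak_deriv \<Omega> w v x" "weak_deriv \<Omega> u v x - weak_deriv \<Omega> w v x"] by simp
  qed
  then show ?case unfolding elim by (simp add: weak_grad_sq_def sum.distrib sum_distrib_left)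
qed

text \<open>The coefficient of \<open>|b|\<^sup>2\<close> is at our disposal, which turns convergence to zero of \<open>|a - b|\<^sup>2\<close> in the mean
  into convergence of Dirichlet energies.\<close>

lemma abs_norm_power2_diff_le:
  fixes a b :: "'a::real_inner"
  assumes "\<delta> > 0"
  shows "\<bar>(norm a)\<^sup>2 - (norm b)\<^sup>2\<bar> \<le> \<delta> * (norm b)\<^sup>2 + (1 + 1 / \<delta>) * (norm (a - b))\<^sup>2"
proof -
  have "(norm a)\<^sup>2 - (norm b)\<^sup>2 = (norm (a - b))\<^sup>2 + 2 * ((a - b) \<bullet> b)"
    by (simp add: power2_norm_eq_inner inner_diff_left inner_diff_right inner_commute algebra_simps)
  moreover have "\<bar>2 * ((a - b) \<bullet> b)\<bar> \<le> 2 * (norm (a - b) * norm b)"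
    using Cauchy_Schwarz_ineq2[of "a - b" b] by simp
  moreover have "2 * (norm (a - b) * norm b) \<le> \<delta> * (norm b)\<^sup>2 + (1 / \<delta>) * (norm (a - b))\<^sup>2"
  proof -
    have "0 \<le> (\<delta> * norm b - norm (a - b))\<^sup>2 / \<delta>" using assms by simp
    also have "\<dots> = \<delta> * (norm b)\<^sup>2 + (1 / \<delta>) * (norm (a - b))\<^sup>2 - 2 * (norm (a - b) * norm b)"
      using assms by (simp add: power2_eq_square field_simps)
    finally show ?thesis by simp
  qed
  moreover have "(1 + 1 / \<delta>) * (norm (a - b))\<^sup>2 = (norm (a - b))\<^sup>2 + (1 / \<delta>) * (norm (a - b))\<^sup>2"
    by (simp add: distrib_right)
  moreover have "0 \<le> (norm (a - b))\<^sup>2" by simp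
  ultimately show ?thesis by linarith
qed

lemma tendsto_W12_grad:
  fixes v :: "'a::euclidean_space \<Rightarrow> 'b::euclidean_space"
  assumes "open \<Omega>" "tendsto_W12 \<Omega> T u v"
  shows "(\<lambda>k. LINT x|lebesgue_on \<Omega>. weak_grad_sq \<Omega> (\<lambda>x. u k x - v x) x) \<longlonglongrightarrow> 0"
proof -
  have uv: "u k \<in> W12 \<Omega> T" "v \<in> W12 \<Omega> T" for k using assms(2) by (auto simp: tendsto_W12_def)
  note d = W12_diff[OF assms(1) uv]
  let ?n = "\<lambda>k. W12_norm \<Omega> (\<lambda>x. u k x - v x)"
  let ?I = "\<lambda>k. LINT x|lebesgue_on \<Omega>. weak_grad_sq \<Omega> (\<lambda>x. u k x - v x) x"
  have I: "0 \<le> ?I k" "?I k \<le> (?n k)\<^sup>2" for k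
  proof -
    show "0 \<le> ?I k" by (simp add: weak_grad_sq_nonneg)
    have i: "integrable (lebesgue_on \<Omega>) (\<lambda>x. (norm (u k x - v x))\<^sup>2)"
      using square_integrable_on_integrable[OF W12_square_integrable[OF d]] .
    note i' = integrable_weak_grad_sq[OF assms(1) d[of k]]
    have "?I k \<le> (LINT x|lebesgue_on \<Omega>. (norm (u k x - v x))\<^sup>2 + weak_grad_sq \<Omega> (\<lambda>x. u k x - v x) x)"
      by (intro integral_mono i' Bochner_Integration.integrable_add i) simp
    moreover have "0 \<le> (LINT x|lebesgue_on \<Omega>. (norm (u k x - v x))\<^sup>2 + weak_grad_sq \<Omega> (\<lambda>x. u k x - v x) x)"
      by (intro integral_nonneg_AE AE_I2) (simp add: weak_grad_sq_nonneg)
    ultimately show "?I k \<le> (?n k)\<^sup>2" by (simp add: W12_norm_def)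
  qed
  have "(\<lambda>k. (?n k)\<^sup>2) \<longlonglongrightarrow> 0\<^sup>2"
    using assms(2) by (intro tendsto_power) (simp add: tendsto_W12_def)
  then have lim: "(\<lambda>k. (?n k)\<^sup>2) \<longlonglongrightarrow> 0" by simp
  show ?thesis
    by (rule tendsto_sandwich[OF _ _ tendsto_const lim]) (use I in \<open>auto intro!: always_eventually\<close>)
qed

lemma tendsto_W12_dirichlet:
  fixes v :: "'a::euclidean_space \<Rightarrow> 'b::euclidean_space"
  assumes "open \<Omega>" "tendsto_W12 \<Omega> T u v"
  shows "(\<lambda>k. LINT x|lebesgue_on \<Omega>. weak_grad_sq \<Omega> (u k) x) \<longlonglongrightarrow> (LINT x|lebesgue_on \<Omega>. weak_grad_sq \<Omega> v x)"
proof -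
  have uv: "u k \<in> W12 \<Omega> T" "v \<in> W12 \<Omega> T" for k using assms(2) by (auto simp: tendsto_W12_def)
  let ?I = "\<lambda>k. LINT x|lebesgue_on \<Omega>. weak_grad_sq \<Omega> (\<lambda>x. u k x - v x) x"
  let ?J = "\<lambda>u. LINT x|lebesgue_on \<Omega>. weak_grad_sq \<Omega> u x"
  note i = integrable_weak_grad_sq[OF assms(1)]
  have bound: "\<bar>?J (u k) - ?J v\<bar> \<le> \<delta> * ?J v + (1 + 1 / \<delta>) * ?I k" if \<delta>: "\<delta> > 0" for \<delta> k
  proof -
    have ae: "AE x in lebesgue_on \<Omega>. \<bar>weak_grad_sq \<Omega> (u k) x - weak_grad_sq \<Omega> v x\<bar> \<le>
        \<delta> * weak_grad_sq \<Omega> v x + (1 + 1 / \<delta>) * weak_grad_sq \<Omega> (\<lambda>x. u k x - v x) x"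
      using weak_grad_sq_diff_AE[OF assms(1) uv(1)[of k] uv(2)]
    proof eventually_elim
      case (elim x)
      have "\<bar>weak_grad_sq \<Omega> (u k) x - weak_grad_sq \<Omega> v x\<bar> \<le> (\<Sum>i\<in>Basis.
          \<bar>(norm (weak_deriv \<Omega> (u k) i x))\<^sup>2 - (norm (weak_deriv \<Omega> v i x))\<^sup>2\<bar>)"
        unfolding weak_grad_sq_def sum_subtractf[symmetric] by (rule sum_abs)
      also have "\<dots> \<le> (\<Sum>i\<in>Basis. \<delta> * (norm (weak_deriv \<Omega> v i x))\<^sup>2 +
          (1 + 1 / \<delta>) * (norm (weak_deriv \<Omega> (u k) i x - weak_deriv \<Omega> v i x))\<^sup>2)"
        by (intro sum_mono abs_norm_power2_diff_le[OF \<delta>])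
      also have "\<dots> = \<delta> * weak_grad_sq \<Omega> v x + (1 + 1 / \<delta>) * weak_grad_sq \<Omega> (\<lambda>x. u k x - v x) x"
        unfolding elim by (simp add: weak_grad_sq_def sum.distrib sum_distrib_left)
      finally show ?case .
    qed
    have "\<bar>?J (u k) - ?J v\<bar> = \<bar>LINT x|lebesgue_on \<Omega>. weak_grad_sq \<Omega> (u k) x - weak_grad_sq \<Omega> v x\<bar>"
      using i[OF uv(1)] i[OF uv(2)] by simp
    also have "\<dots> \<le> (LINT x|lebesgue_on \<Omega>. \<bar>weak_grad_sq \<Omega> (u k) x - weak_grad_sq \<Omega> v x\<bar>)"
      by (rule integral_abs_bound)
    also have "\<dots> \<le> (LINT x|lebesgue_on \<Omega>. \<delta> * weak_grad_sq \<Omega> v x +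
        (1 + 1 / \<delta>) * weak_grad_sq \<Omega> (\<lambda>x. u k x - v x) x)"
      using i[OF uv(1)] i[OF uv(2)] i[OF W12_diff[OF assms(1) uv]] ae
      by (intro integral_mono_AE) auto
    also have "\<dots> = \<delta> * ?J v + (1 + 1 / \<delta>) * ?I k"
      using i[OF uv(2)] i[OF W12_diff[OF assms(1) uv]] by simp
    finally show ?thesis .
  qed
  have Jv: "?J v \<ge> 0" by (simp add: weak_grad_sq_nonneg)
  show ?thesis
  proof (rule LIMSEQ_I)
    fix r :: real assume r: "r > 0"
    define \<delta> where "\<delta> = r / (2 * (?J v + 1))"
    have \<delta>: "\<delta> > 0" using r Jv by (simp add: \<delta>_def)
    have \<delta>J: "\<delta> * ?J v \<le> r / 2" using r Jv by (simp add: \<delta>_def field_simps)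
    have pos': "1 + 1 / \<delta> > 0" using \<delta> by (simp add: add_pos_pos)
    have pos: "r / 2 / (1 + 1 / \<delta>) > 0" using r \<delta> by (simp add: add_pos_pos)
    obtain n where n: "\<And>k. k \<ge> n \<Longrightarrow> ?I k < r / 2 / (1 + 1 / \<delta>)"
      using order_tendstoD(2)[OF tendsto_W12_grad[OF assms] pos] by (auto simp: eventually_sequentially)
    have "norm (?J (u k) - ?J v) < r" if "k \<ge> n" for k
    proof -
      have "(1 + 1 / \<delta>) * ?I k < r / 2"
        using n[OF that] unfolding pos_less_divide_eq[OF pos'] by (simp only: mult.commute)
      then show ?thesis using bound[OF \<delta>, of k] \<delta>J unfolding real_norm_def by linarith
    qed
    then show "\<exists>n. \<forall>k\<ge>n. norm (?J (u k) - ?J v) < r" by blast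
  qed
qed

section \<open>The bulk potential\<close>

lemma trace_matrix_mult_symmetric:
  fixes A B :: "real^'n^'n"
  assumes "transpose B = B"
  shows "trace (A ** B) = A \<bullet> B"
proof -
  have "B $ k $ i = B $ i $ k" for i k
  proof -
    have "transpose B $ k $ i = B $ i $ k" by (simp add: transpose_def)
    then show ?thesis unfolding assms .
  qed
  then have "A $ i $ k * B $ k $ i = A $ i $ k * B $ i $ k" for i k by metis
  then show ?thesis
    by (simp only: trace_def matrix_matrix_mult_def inner_vec_def vec_lambda_beta inner_real_def)
qed

lemma bounded_bilinear_matrix_matrix_mult:
  "bounded_bilinear ((**) :: real^'n^'n \<Rightarrow> real^'n^'n \<Rightarrow> real^'n^'n)"
  unfolding bilinear_conv_bounded_bilinear[symmetric] bilinear_def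
  by (auto intro!: linearI simp: matrix_add_ldistrib matrix_matrix_mult_def vec_eq_iff sum.distrib
      algebra_simps sum_distrib_left)

text \<open>On symmetric matrices \<open>tr (Q\<^sup>2)\<close> is \<open>Q \<bullet> Q\<close> and \<open>tr (Q\<^sup>3)\<close> is \<open>(Q ** Q) \<bullet> Q\<close>, so this polynomial on all
  matrices extends \<^const>\<open>f_B\<close> from \<^const>\<open>S0\<close>. In this form it is differentiated by the product rule.\<close>

definition bulk :: "real \<Rightarrow> real \<Rightarrow> real \<Rightarrow> real^3^3 \<Rightarrow> real" where
  "bulk a b c Q = - (a\<^sup>2 / 2) * (Q \<bullet> Q) - (b\<^sup>2 / 3) * ((Q ** Q) \<bullet> Q) + (c\<^sup>2 / 4) * (Q \<bullet> Q)\<^sup>2"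

definition bulk_deriv :: "real \<Rightarrow> real \<Rightarrow> real \<Rightarrow> real^3^3 \<Rightarrow> real^3^3 \<Rightarrow> real" where
  "bulk_deriv a b c Q H = - a\<^sup>2 * (Q \<bullet> H) - (b\<^sup>2 / 3) * ((Q ** H + H ** Q) \<bullet> Q + (Q ** Q) \<bullet> H)
     + c\<^sup>2 * (Q \<bullet> Q) * (Q \<bullet> H)"

lemma f_B_eq_bulk: "Q \<in> S0 \<Longrightarrow> f_B a b c Q = bulk a b c Q"
  by (simp add: f_B_def bulk_def S0_def trace_matrix_mult_symmetric)

lemma bulk_has_derivative: "(bulk a b c has_derivative bulk_deriv a b c Q) (at Q)"
proof -
  note d = bounded_bilinear.FDERIV[OF bounded_bilinear_matrix_matrix_mult has_derivative_ident has_derivative_ident]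
  have "(bulk a b c has_derivative
    (\<lambda>H. - (a\<^sup>2 / 2) * (Q \<bullet> H + H \<bullet> Q) - (b\<^sup>2 / 3) * ((Q ** Q) \<bullet> H + (Q ** H + H ** Q) \<bullet> Q)
       + (c\<^sup>2 / 4) * (of_nat 2 * (Q \<bullet> H + H \<bullet> Q) * (Q \<bullet> Q) ^ (2 - 1)))) (at Q)"
    unfolding bulk_def[abs_def]
    by (intro has_derivative_add has_derivative_diff has_derivative_mult_right has_derivative_power
        has_derivative_inner has_derivative_ident d)
  then show ?thesis
  proof (rule has_derivative_eq_rhs, intro ext)
    fix H
    have "of_nat 2 * (Q \<bullet> H + H \<bullet> Q) * (Q \<bullet> Q) ^ (2 - 1) = 4 * ((Q \<bullet> Q) * (Q \<bullet> H))"
      by (simp add: inner_commute[of H Q])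
    then show "- (a\<^sup>2 / 2) * (Q \<bullet> H + H \<bullet> Q) - (b\<^sup>2 / 3) * ((Q ** Q) \<bullet> H + (Q ** H + H ** Q) \<bullet> Q)
       + (c\<^sup>2 / 4) * (of_nat 2 * (Q \<bullet> H + H \<bullet> Q) * (Q \<bullet> Q) ^ (2 - 1)) = bulk_deriv a b c Q H"
      by (simp add: bulk_deriv_def inner_commute[of H Q] add.commute)
  qed
qed

lemma continuous_on_matrix_mult [continuous_intros]:
  fixes f g :: "'a::topological_space \<Rightarrow> real^'n^'n"
  shows "continuous_on S f \<Longrightarrow> continuous_on S g \<Longrightarrow> continuous_on S (\<lambda>x. f x ** g x)"
  by (rule bounded_bilinear.continuous_on[OF bounded_bilinear_matrix_matrix_mult])

lemma continuous_on_bulk: "continuous_on S (bulk a b c)"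
  unfolding bulk_def[abs_def] by (intro continuous_intros)

lemma continuous_on_bulk_deriv:
  "continuous_on S f \<Longrightarrow> continuous_on S g \<Longrightarrow> continuous_on S (\<lambda>x. bulk_deriv a b c (f x) (g x))"
  unfolding bulk_deriv_def by (intro continuous_intros)

lemma matrix_mult_norm_bound:
  obtains m where "m > 0" "\<And>(A::real^'n^'n) (B::real^'n^'n). norm (A ** B) \<le> norm A * norm B * m"
proof -
  have "\<exists>m>0. \<forall>(A::real^'n^'n) (B::real^'n^'n). norm (A ** B) \<le> norm A * norm B * m"
    by (rule bounded_bilinear.pos_bounded[OF bounded_bilinear_matrix_matrix_mult])
  with that show ?thesis by blast
qed

text \<open>Young's inequality with an explicit constant: compare \<open>t\<close> with \<open>1 + (p + q) / \<epsilon>\<close>.\<close>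

lemma cubic_le_quartic:
  fixes t :: real
  assumes "\<epsilon> > 0" "t \<ge> 0" "p \<ge> 0" "q \<ge> 0"
  shows "p * t\<^sup>2 + q * t ^ 3 \<le> \<epsilon> * t ^ 4 + (p + q) * (1 + (p + q) / \<epsilon>) ^ 3"
proof -
  define T where "T = 1 + (p + q) / \<epsilon>"
  have T: "T \<ge> 1" using assms by (simp add: T_def)
  show ?thesis
  proof (cases "t \<le> T")
    case True
    have "t\<^sup>2 \<le> T ^ 2" "t ^ 3 \<le> T ^ 3" using True assms by (auto intro: power_mono)
    moreover have "T ^ 2 \<le> T ^ 3" using T by (intro power_increasing) auto
    ultimately have "t\<^sup>2 \<le> T ^ 3" "t ^ 3 \<le> T ^ 3" by auto
    then have "p * t\<^sup>2 + q * t ^ 3 \<le> p * T ^ 3 + q * T ^ 3"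
      using assms by (intro add_mono mult_left_mono) auto
    also have "\<dots> \<le> \<epsilon> * t ^ 4 + (p + q) * T ^ 3" using assms by (simp add: algebra_simps)
    finally show ?thesis by (simp add: T_def)
  next
    case False
    then have "(p + q) / \<epsilon> \<le> t" by (simp add: T_def)
    then have t: "t \<ge> 1" "(p + q) \<le> \<epsilon> * t"
      using False T assms(1) by (simp_all add: pos_divide_le_eq mult.commute)
    have "t\<^sup>2 \<le> t ^ 3" using t(1) by (intro power_increasing) auto
    then have "p * t\<^sup>2 \<le> p * t ^ 3" using assms by (intro mult_left_mono) auto
    then have "p * t\<^sup>2 + q * t ^ 3 \<le> (p + q) * t ^ 3" by (simp add: distrib_right)
    also have "\<dots> \<le> (\<epsilon> * t) * t ^ 3" using t assms by (intro mult_right_mono) auto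
    also have "\<dots> = \<epsilon> * t ^ 4" by (simp add: power_numeral_reduce algebra_simps)
    finally show ?thesis using assms T by (auto simp: T_def intro!: add_increasing2)
  qed
qed

lemma norm_power4: "(Q \<bullet> Q)\<^sup>2 = norm Q ^ 4"
  by (simp add: power2_norm_eq_inner[symmetric] flip: power_mult)

lemma bulk_eq_norm:
  "bulk a b c Q = - (a\<^sup>2 / 2) * (norm Q)\<^sup>2 - (b\<^sup>2 / 3) * ((Q ** Q) \<bullet> Q) + (c\<^sup>2 / 4) * norm Q ^ 4"
  by (simp add: bulk_def norm_power4 power2_norm_eq_inner)

lemma triple_product_bound:
  fixes A B C :: "real^'n^'n"
  assumes "\<And>(A::real^'n^'n) (B::real^'n^'n). norm (A ** B) \<le> norm A * norm B * m"
  shows "\<bar>(A ** B) \<bullet> C\<bar> \<le> m * (norm A * norm B * norm C)"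
proof -
  have "\<bar>(A ** B) \<bullet> C\<bar> \<le> norm (A ** B) * norm C" by (rule Cauchy_Schwarz_ineq2)
  also have "\<dots> \<le> (norm A * norm B * m) * norm C" by (rule mult_right_mono[OF assms]) simp
  finally show ?thesis by (simp add: mult_ac)
qed

lemma bulk_lower_bound:
  assumes "c\<^sup>2 > 0"
  obtains C where "\<And>Q. bulk a b c Q \<ge> (c\<^sup>2 / 8) * norm Q ^ 4 - C"
    "\<And>Q. bulk_deriv a b c Q Q \<ge> (c\<^sup>2 / 2) * norm Q ^ 4 - C"
proof -
  obtain m where m: "m > 0" "\<And>(A::real^3^3) (B::real^3^3). norm (A ** B) \<le> norm A * norm B * m"
    using matrix_mult_norm_bound by blast
  define C1 where "C1 = (a\<^sup>2 / 2 + b\<^sup>2 / 3 * m) * (1 + (a\<^sup>2 / 2 + b\<^sup>2 / 3 * m) / (c\<^sup>2 / 8)) ^ 3"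
  define C2 where "C2 = (a\<^sup>2 + b\<^sup>2 * m) * (1 + (a\<^sup>2 + b\<^sup>2 * m) / (c\<^sup>2 / 2)) ^ 3"
  have cub: "\<bar>(Q ** Q) \<bullet> Q\<bar> \<le> m * norm Q ^ 3" for Q :: "real^3^3"
    using triple_product_bound[OF m(2), of Q Q Q] by (simp add: power3_eq_cube)
  have l1: "bulk a b c Q \<ge> (c\<^sup>2 / 8) * norm Q ^ 4 - C1" for Q
  proof -
    have "a\<^sup>2 / 2 * (norm Q)\<^sup>2 + b\<^sup>2 / 3 * m * norm Q ^ 3 \<le> c\<^sup>2 / 8 * norm Q ^ 4 + C1"
      unfolding C1_def by (rule cubic_le_quartic) (use assms m in auto)
    moreover have "b\<^sup>2 / 3 * ((Q ** Q) \<bullet> Q) \<le> b\<^sup>2 / 3 * (m * norm Q ^ 3)"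
      using cub[of Q] by (intro mult_left_mono) auto
    ultimately show ?thesis
      unfolding bulk_def norm_power4 power2_norm_eq_inner[symmetric] by (simp add: algebra_simps)
  qed
  have l2: "bulk_deriv a b c Q Q \<ge> (c\<^sup>2 / 2) * norm Q ^ 4 - C2" for Q
  proof -
    have "a\<^sup>2 * (norm Q)\<^sup>2 + b\<^sup>2 * m * norm Q ^ 3 \<le> c\<^sup>2 / 2 * norm Q ^ 4 + C2"
      unfolding C2_def by (rule cubic_le_quartic) (use assms m in auto)
    moreover have "b\<^sup>2 * ((Q ** Q) \<bullet> Q) \<le> b\<^sup>2 * (m * norm Q ^ 3)"
      using cub[of Q] by (intro mult_left_mono) auto
    moreover have "bulk_deriv a b c Q Q = - a\<^sup>2 * (norm Q)\<^sup>2 - b\<^sup>2 * ((Q ** Q) \<bullet> Q) + c\<^sup>2 * norm Q ^ 4"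
      unfolding norm_power4[symmetric] power2_norm_eq_inner
      unfolding bulk_deriv_def inner_add_left by (simp add: power2_eq_square)
    ultimately show ?thesis by (simp add: algebra_simps)
  qed
  show ?thesis
    by (rule that[of "max C1 C2"]) (use l1 l2 in \<open>smt (verit) max.cobounded1 max.cobounded2\<close>)+
qed

lemma bulk_upper_bound:
  obtains C where "C \<ge> 0" "\<And>Q. bulk a b c Q \<le> C * (1 + norm Q ^ 4)"
proof -
  obtain m where m: "m > 0" "\<And>(A::real^3^3) (B::real^3^3). norm (A ** B) \<le> norm A * norm B * m"
    using matrix_mult_norm_bound by blast
  define E where "E = b\<^sup>2 / 3 * m * (1 + b\<^sup>2 / 3 * m) ^ 3"
  have E: "E \<ge> 0" using m by (simp add: E_def)
  define C where "C = E + c\<^sup>2 / 4 + 1"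
  have "bulk a b c Q \<le> C * (1 + norm Q ^ 4)" for Q
  proof -
    have "b\<^sup>2 / 3 * m * norm Q ^ 3 \<le> norm Q ^ 4 + b\<^sup>2 / 3 * m * (1 + b\<^sup>2 / 3 * m) ^ 3"
      using cubic_le_quartic[of 1 "norm Q" 0 "b\<^sup>2 / 3 * m"] m by simp
    moreover have "- (b\<^sup>2 / 3) * ((Q ** Q) \<bullet> Q) \<le> b\<^sup>2 / 3 * m * norm Q ^ 3"
    proof -
      have "- ((Q ** Q) \<bullet> Q) \<le> m * norm Q ^ 3"
        using triple_product_bound[OF m(2), of Q Q Q] by (simp add: power3_eq_cube)
      from mult_left_mono[OF this, of "b\<^sup>2 / 3"] show ?thesis by simp
    qed
    moreover have "0 \<le> a\<^sup>2 / 2 * (norm Q)\<^sup>2" by simp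
    ultimately have "bulk a b c Q \<le> (1 + c\<^sup>2 / 4) * norm Q ^ 4 + E"
      unfolding E_def bulk_eq_norm distrib_right mult_minus_left by linarith
    also have "\<dots> \<le> C * (1 + norm Q ^ 4)"
    proof -
      have "0 \<le> E * norm Q ^ 4" "0 \<le> c\<^sup>2 / 4" using E by auto
      moreover have "C * (1 + norm Q ^ 4) = (1 + c\<^sup>2 / 4) * norm Q ^ 4 + E + (E * norm Q ^ 4 + c\<^sup>2 / 4 + 1)"
        by (simp add: C_def algebra_simps)
      ultimately show ?thesis by linarith
    qed
    finally show ?thesis .
  qed
  moreover have "C \<ge> 0" using E by (simp add: C_def)
  ultimately show ?thesis using that by blast
qed

lemma bulk_deriv_bound:
  obtains K where "K \<ge> 0" "\<And>Q H. \<bar>bulk_deriv a b c Q H\<bar> \<le> K * (1 + norm Q ^ 3) * norm H"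
proof -
  obtain m where m: "m > 0" "\<And>(A::real^3^3) (B::real^3^3). norm (A ** B) \<le> norm A * norm B * m"
    using matrix_mult_norm_bound by blast
  define K where "K = a\<^sup>2 + b\<^sup>2 * m + c\<^sup>2"
  have "\<bar>bulk_deriv a b c Q H\<bar> \<le> K * (1 + norm Q ^ 3) * norm H" for Q H
  proof -
    let ?q = "norm Q" and ?h = "norm H"
    have pow: "?q \<le> 1 + ?q ^ 3" "?q\<^sup>2 \<le> 1 + ?q ^ 3"
    proof -
      have "?q \<le> max 1 (?q ^ 3)" "?q\<^sup>2 \<le> max 1 (?q ^ 3)"
        by (cases "?q \<le> 1"; simp add: power_le_one self_le_power power_increasing max.coboundedI2 max.coboundedI1)+
      then show "?q \<le> 1 + ?q ^ 3" "?q\<^sup>2 \<le> 1 + ?q ^ 3"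
        by (auto simp: max_def split: if_splits intro: order_trans)
    qed
    have 1: "\<bar>a\<^sup>2 * (Q \<bullet> H)\<bar> \<le> a\<^sup>2 * ((1 + ?q ^ 3) * ?h)"
    proof -
      have "\<bar>Q \<bullet> H\<bar> \<le> ?q * ?h" by (rule Cauchy_Schwarz_ineq2)
      also have "\<dots> \<le> (1 + ?q ^ 3) * ?h" using pow by (intro mult_right_mono) auto
      finally show ?thesis by (simp add: abs_mult mult_left_mono)
    qed
    have 2: "\<bar>(b\<^sup>2 / 3) * ((Q ** H + H ** Q) \<bullet> Q + (Q ** Q) \<bullet> H)\<bar> \<le> b\<^sup>2 * m * ((1 + ?q ^ 3) * ?h)"
    proof -
      note t = triple_product_bound[OF m(2)]
      have "\<bar>(Q ** H + H ** Q) \<bullet> Q + (Q ** Q) \<bullet> H\<bar> \<le> 3 * (m * (?q\<^sup>2 * ?h))"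
        using t[of Q H Q] t[of H Q Q] t[of Q Q H]
        by (simp add: inner_add_left power2_eq_square mult_ac)
      also have "\<dots> \<le> 3 * (m * ((1 + ?q ^ 3) * ?h))"
        using pow m by (intro mult_left_mono mult_right_mono) auto
      finally have "b\<^sup>2 / 3 * \<bar>(Q ** H + H ** Q) \<bullet> Q + (Q ** Q) \<bullet> H\<bar> \<le> b\<^sup>2 / 3 * (3 * (m * ((1 + ?q ^ 3) * ?h)))"
        by (intro mult_left_mono) auto
      then show ?thesis by (simp add: abs_mult)
    qed
    have 3: "\<bar>c\<^sup>2 * (Q \<bullet> Q) * (Q \<bullet> H)\<bar> \<le> c\<^sup>2 * ((1 + ?q ^ 3) * ?h)"
    proof -
      have "\<bar>(Q \<bullet> Q) * (Q \<bullet> H)\<bar> \<le> ?q\<^sup>2 * (?q * ?h)"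
        using Cauchy_Schwarz_ineq2[of Q H] by (simp add: abs_mult power2_norm_eq_inner mult_left_mono)
      also have "\<dots> \<le> (1 + ?q ^ 3) * ?h" by (simp add: power2_eq_square power3_eq_cube algebra_simps)
      finally show ?thesis by (simp add: abs_mult mult_left_mono mult.assoc)
    qed
    have "K * (1 + ?q ^ 3) * ?h = a\<^sup>2 * ((1 + ?q ^ 3) * ?h) + b\<^sup>2 * m * ((1 + ?q ^ 3) * ?h) + c\<^sup>2 * ((1 + ?q ^ 3) * ?h)"
      by (simp add: K_def algebra_simps)
    then show ?thesis using 1 2 3 unfolding bulk_deriv_def by (simp add: abs_if split: if_splits)
  qed
  moreover have "K \<ge> 0" using m by (simp add: K_def)
  ultimately show ?thesis using that by blast
qed

lemma subspace_S0: "subspace S0"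
  by (auto simp: subspace_def S0_def transpose_def vec_eq_iff trace_def sum.distrib simp flip: sum_distrib_left)

lemma closed_S0: "closed S0"
  using closed_subspace[OF subspace_S0] .

lemma f_B_bdd_below: "c\<^sup>2 > 0 \<Longrightarrow> bdd_below (f_B a b c ` S0)"
proof -
  assume c: "c\<^sup>2 > 0"
  obtain C where C: "\<And>Q. bulk a b c Q \<ge> (c\<^sup>2 / 8) * norm Q ^ 4 - C"
    using bulk_lower_bound[OF c] by blast
  have "f_B a b c Q \<ge> - C" if "Q \<in> S0" for Q
  proof -
    have "0 \<le> c\<^sup>2 / 8 * norm Q ^ 4" by simp
    then show ?thesis using C[of Q] unfolding f_B_eq_bulk[OF that] by linarith
  qed
  then show ?thesis by (rule bdd_belowI2)
qed

lemma f_B_tilde_nonneg: "c\<^sup>2 > 0 \<Longrightarrow> Q \<in> S0 \<Longrightarrow> f_B_tilde a b c Q \<ge> 0"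
  unfolding f_B_tilde_def using cINF_lower[OF f_B_bdd_below] by simp

lemma f_B_tilde_attains_zero:
  assumes c: "c\<^sup>2 > 0"
  obtains Qs where "Qs \<in> S0" "f_B_tilde a b c Qs = 0"
proof -
  obtain C where C: "\<And>Q. bulk a b c Q \<ge> (c\<^sup>2 / 8) * norm Q ^ 4 - C"
    using bulk_lower_bound[OF c] by blast
  have b0: "bulk a b c 0 = 0" by (simp add: bulk_def)
  have C0: "C \<ge> 0" using C[of 0] b0 by simp
  \<comment> \<open>outside this radius the quartic lower bound exceeds the value at 0\<close>
  define R where "R = 1 + 8 * C / c\<^sup>2"
  have R: "R \<ge> 1" using C0 by (simp add: R_def)
  have zero: "0 \<in> S0 \<inter> cball 0 R" using subspace_0[OF subspace_S0] R by simp
  have "compact (S0 \<inter> cball (0::real^3^3) R)"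
    using closed_S0 by (intro closed_Int_compact) auto
  then obtain Qs where Qs: "Qs \<in> S0 \<inter> cball 0 R" "\<And>Q. Q \<in> S0 \<inter> cball 0 R \<Longrightarrow> bulk a b c Qs \<le> bulk a b c Q"
    using continuous_attains_inf[OF _ _ continuous_on_bulk, of "S0 \<inter> cball 0 R"] zero by blast
  have "bulk a b c Qs \<le> bulk a b c Q" if "Q \<in> S0" for Q
  proof (cases "norm Q \<le> R")
    case False
    then have n: "norm Q \<ge> 1" "norm Q \<ge> 8 * C / c\<^sup>2" using R by (auto simp: R_def)
    have "norm Q \<le> norm Q ^ 4" using n(1) by (rule self_le_power) simp
    then have "8 * C / c\<^sup>2 \<le> norm Q ^ 4" using n(2) by linarith
    then have "C \<le> c\<^sup>2 / 8 * norm Q ^ 4" using c by (simp add: field_simps)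
    then have "0 \<le> bulk a b c Q" using C[of Q] by linarith
    moreover have "bulk a b c Qs \<le> 0" using Qs(2)[OF zero] b0 by simp
    ultimately show ?thesis by linarith
  qed (use Qs(2) that in auto)
  then have min: "f_B a b c Qs \<le> f_B a b c Q" if "Q \<in> S0" for Q
    using that Qs(1) by (simp add: f_B_eq_bulk)
  then have "(INF P\<in>S0. f_B a b c P) = f_B a b c Qs"
    using Qs(1) by (intro cInf_eq_minimum) auto
  then show ?thesis using that[of Qs] Qs(1) by (simp add: f_B_tilde_def)
qed

section \<open>Decay of the bulk energy of minimizers\<close>

text \<open>The orthogonal projection onto \<^const>\<open>S0\<close>. The continuous extension of the boundary data need not have values
  in \<^const>\<open>S0\<close>; its projection has.\<close>

definition S0_proj :: "real^3^3 \<Rightarrow> real^3^3" where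
  "S0_proj A = (1/2) *\<^sub>R (A + transpose A) - (trace A / 3) *\<^sub>R mat 1"

lemma bounded_linear_S0_proj: "bounded_linear S0_proj"
proof -
  have "linear S0_proj"
    by (rule linearI) (auto simp: S0_proj_def vec_eq_iff transpose_def trace_def sum.distrib
        mat_def add_divide_distrib algebra_simps sum_distrib_left[symmetric])
  then show ?thesis using linear_conv_bounded_linear by blast
qed

lemma S0_proj_in: "S0_proj A \<in> S0"
  by (auto simp: S0_proj_def S0_def vec_eq_iff transpose_def trace_def mat_def sum_3) (simp add: field_simps)

lemma S0_proj_id: "A \<in> S0 \<Longrightarrow> S0_proj A = A"
  by (simp add: S0_proj_def S0_def scaleR_2[symmetric])

lemma uniaxial_in_S0:
  assumes "norm (n x) = 1"
  shows "uniaxial s n x \<in> S0"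
proof -
  have "(\<Sum>i\<in>UNIV. n x $ i * n x $ i) = 1"
    using assms by (simp add: norm_eq_1 inner_vec_def)
  then show ?thesis
    by (auto simp: uniaxial_def S0_def vec_eq_iff transpose_def trace_def mat_def tensor_def
        sum_subtractf mult.commute simp flip: sum_distrib_left)
qed

lemma f_B_tilde_eq_bulk: "Q \<in> S0 \<Longrightarrow> f_B_tilde a b c Q = bulk a b c Q - (INF P\<in>S0. f_B a b c P)"
  by (simp add: f_B_tilde_def f_B_eq_bulk)

lemma continuous_on_f_B_tilde: "continuous_on S (f_B_tilde a b c)"
proof -
  have t: "continuous_on S (trace :: real^3^3 \<Rightarrow> real)" for S
    unfolding trace_def[abs_def] by (intro continuous_intros)
  have t': "continuous_on S (\<lambda>x. trace (f x))" if "continuous_on S f" for S and f :: "real^3^3 \<Rightarrow> real^3^3"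
    by (rule continuous_on_compose2[OF t that]) auto
  show ?thesis
    unfolding f_B_tilde_def[abs_def] f_B_def by (intro continuous_intros t')
qed

lemma f_B_tilde_measurable:
  "Q \<in> borel_measurable M \<Longrightarrow> (\<lambda>x. f_B_tilde a b c (Q x)) \<in> borel_measurable M"
  using borel_measurable_continuous_onI[OF continuous_on_f_B_tilde] measurable_compose by blast

text \<open>On a bounded domain the bulk energy of a map with values in \<^const>\<open>S0\<close> is finite exactly if the map is in \<open>L\<^sup>4\<close>.\<close>

lemma f_B_tilde_two_sided_bound:
  assumes c: "c\<^sup>2 > 0"
  obtains C where "C \<ge> 0" "\<And>Q. Q \<in> S0 \<Longrightarrow> norm Q ^ 4 \<le> C * (1 + f_B_tilde a b c Q)"
    "\<And>Q. Q \<in> S0 \<Longrightarrow> f_B_tilde a b c Q \<le> C * (1 + norm Q ^ 4)"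
proof -
  define m where "m = (INF P\<in>S0. f_B a b c P)"
  obtain C1 where C1: "\<And>Q. bulk a b c Q \<ge> (c\<^sup>2 / 8) * norm Q ^ 4 - C1"
    using bulk_lower_bound[OF c] by blast
  obtain C2 where C2: "C2 \<ge> 0" "\<And>Q. bulk a b c Q \<le> C2 * (1 + norm Q ^ 4)"
    using bulk_upper_bound by blast
  define C where "C = (1 + \<bar>C1\<bar> + \<bar>m\<bar>) * 8 / c\<^sup>2 + C2 + \<bar>m\<bar>"
  have lower: "norm Q ^ 4 \<le> C * (1 + f_B_tilde a b c Q)" if "Q \<in> S0" for Q
  proof -
    have f0: "f_B_tilde a b c Q \<ge> 0" by (rule f_B_tilde_nonneg[OF c that])
    have "c\<^sup>2 / 8 * norm Q ^ 4 \<le> f_B_tilde a b c Q + (\<bar>C1\<bar> + \<bar>m\<bar>)"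
      using C1[of Q] f_B_tilde_eq_bulk[OF that, of a b c] by (simp add: m_def)
    also have "\<dots> \<le> (1 + \<bar>C1\<bar> + \<bar>m\<bar>) * (1 + f_B_tilde a b c Q)"
      using f0 by (simp add: algebra_simps)
    finally have "norm Q ^ 4 \<le> (1 + \<bar>C1\<bar> + \<bar>m\<bar>) * 8 / c\<^sup>2 * (1 + f_B_tilde a b c Q)"
      using c by (simp add: field_simps)
    also have "\<dots> \<le> C * (1 + f_B_tilde a b c Q)"
      using f0 C2(1) by (intro mult_right_mono) (auto simp: C_def)
    finally show ?thesis .
  qed
  have upper: "f_B_tilde a b c Q \<le> C * (1 + norm Q ^ 4)" if "Q \<in> S0" for Q
  proof -
    have "f_B_tilde a b c Q \<le> C2 * (1 + norm Q ^ 4) + \<bar>m\<bar> * 1"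
      using C2(2)[of Q] f_B_tilde_eq_bulk[OF that, of a b c] by (simp add: m_def)
    also have "\<dots> \<le> C2 * (1 + norm Q ^ 4) + \<bar>m\<bar> * (1 + norm Q ^ 4)"
      using C2(1) by (intro add_mono mult_left_mono) auto
    also have "\<dots> = (C2 + \<bar>m\<bar>) * (1 + norm Q ^ 4)" by (simp add: distrib_right)
    also have "\<dots> \<le> C * (1 + norm Q ^ 4)"
      using C2(1) by (intro mult_right_mono) (auto simp: C_def)
    finally show ?thesis .
  qed
  have "C \<ge> 0" using C2(1) by (simp add: C_def)
  with lower upper that show ?thesis by blast
qed

text \<open>The energy takes values in the extended half line; for competitors with integrable bulk density it
  may be computed with real integrals.\<close>

lemma F_LG_eq:
  assumes c: "c\<^sup>2 > 0" and "open \<Omega>" "L > 0" and P: "P \<in> W12 \<Omega> S0"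
    and i: "integrable (lebesgue_on \<Omega>) (\<lambda>x. f_B_tilde a b c (P x))"
  shows "F_LG a b c \<Omega> L P = ennreal (L / 2 * (LINT x|lebesgue_on \<Omega>. weak_grad_sq \<Omega> P x)
      + (LINT x|lebesgue_on \<Omega>. f_B_tilde a b c (P x)))"
proof -
  note g = integrable_weak_grad_sq[OF assms(2) P]
  have "AE x in lebesgue_on \<Omega>. P x \<in> S0" using P by (simp add: W12_def)
  then have "AE x in lebesgue_on \<Omega>. 0 \<le> L / 2 * weak_grad_sq \<Omega> P x + f_B_tilde a b c (P x)"
  proof eventually_elim
    case (elim x)
    have "0 \<le> L / 2 * weak_grad_sq \<Omega> P x" using assms(3) weak_grad_sq_nonneg[of \<Omega> P x] by simp
    then show ?case using f_B_tilde_nonneg[OF c elim, of a b] by simp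
  qed
  moreover have "integrable (lebesgue_on \<Omega>) (\<lambda>x. L / 2 * weak_grad_sq \<Omega> P x + f_B_tilde a b c (P x))"
    by (intro Bochner_Integration.integrable_add integrable_mult_right g i)
  ultimately have "F_LG a b c \<Omega> L P = ennreal (LINT x|lebesgue_on \<Omega>. L / 2 * weak_grad_sq \<Omega> P x + f_B_tilde a b c (P x))"
    unfolding F_LG_def by (intro nn_integral_eq_integral)
  then show ?thesis using g i by simp
qed

lemma f_B_tilde_integrable_if_F_LG_finite:
  assumes c: "c\<^sup>2 > 0" and "open \<Omega>" "L > 0" and P: "P \<in> W12 \<Omega> S0"
    and fin: "F_LG a b c \<Omega> L P < \<infinity>"
  shows "integrable (lebesgue_on \<Omega>) (\<lambda>x. f_B_tilde a b c (P x))"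
proof (rule integrableI_bounded)
  show "(\<lambda>x. f_B_tilde a b c (P x)) \<in> borel_measurable (lebesgue_on \<Omega>)"
    by (rule f_B_tilde_measurable[OF square_integrable_on_measurable[OF W12_square_integrable[OF P]]])
  have "AE x in lebesgue_on \<Omega>. P x \<in> S0" using P by (simp add: W12_def)
  then have "AE x in lebesgue_on \<Omega>. ennreal (norm (f_B_tilde a b c (P x))) \<le>
      ennreal (L / 2 * weak_grad_sq \<Omega> P x + f_B_tilde a b c (P x))"
  proof eventually_elim
    case (elim x)
    have "0 \<le> L / 2 * weak_grad_sq \<Omega> P x" using assms(3) weak_grad_sq_nonneg[of \<Omega> P x] by simp
    then show ?case using f_B_tilde_nonneg[OF c elim, of a b] by (intro ennreal_leI) simp
  qed
  then have "(\<integral>\<^sup>+x. ennreal (norm (f_B_tilde a b c (P x))) \<partial>lebesgue_on \<Omega>) \<le> F_LG a b c \<Omega> L P"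
    unfolding F_LG_def by (rule nn_integral_mono_AE)
  then show "(\<integral>\<^sup>+x. ennreal (norm (f_B_tilde a b c (P x))) \<partial>lebesgue_on \<Omega>) < \<infinity>"
    using fin by (rule order_le_less_trans)
qed

lemma integrable_lebesgue_on_subset:
  fixes f :: "'a::euclidean_space \<Rightarrow> 'b::euclidean_space"
  assumes "integrable (lebesgue_on A) f" "A \<in> sets lebesgue" "B \<in> sets lebesgue" "B \<subseteq> A"
  shows "integrable (lebesgue_on B) f"
  using set_integrable_subset[of lebesgue A f B] assms
  by (simp add: integrable_restrict_space set_integrable_def)

text \<open>The energy of minimizers has to be shown finite. An extension of the boundary data that is continuous up
  to the boundary is bounded, hence of finite energy once it is projected to \<^const>\<open>S0\<close>.\<close>

lemma admissible_Q_bounded_extension: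
  assumes "open \<Omega>" "bounded \<Omega>" "admissible_Q \<Omega> Qb \<noteq> {}" "\<And>x. x \<in> frontier \<Omega> \<Longrightarrow> Qb x \<in> S0"
  obtains P where "P \<in> admissible_Q \<Omega> Qb" "integrable (lebesgue_on \<Omega>) (\<lambda>x. f_B_tilde a b c (P x))"
proof -
  obtain G where G: "G \<in> W12 \<Omega> UNIV" "continuous_on (closure \<Omega>) G" "\<And>x. x \<in> frontier \<Omega> \<Longrightarrow> G x = Qb x"
    using assms(3) unfolding admissible_Q_def boundary_values_def by blast
  define P where "P x = S0_proj (G x)" for x
  have PW: "P \<in> W12 \<Omega> S0"
    unfolding P_def by (rule W12_bounded_linear[OF assms(1) G(1) bounded_linear_S0_proj S0_proj_in])
  have Pc: "continuous_on (closure \<Omega>) P"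
    unfolding P_def by (rule bounded_linear.continuous_on[OF bounded_linear_S0_proj G(2)])
  have "boundary_values \<Omega> P Qb"
    by (rule boundary_values_self[OF assms(1) W12_UNIV[OF PW] Pc])
      (simp add: P_def G(3) S0_proj_id assms(4))
  then have adm: "P \<in> admissible_Q \<Omega> Qb" using PW by (simp add: admissible_Q_def)
  have cl: "compact (closure \<Omega>)" using assms(2) by (simp add: compact_closure)
  have "integrable (lebesgue_on (closure \<Omega>)) (\<lambda>x. f_B_tilde a b c (P x))"
    using locally_integrable_continuous[OF continuous_on_compose2[OF continuous_on_f_B_tilde Pc], of UNIV] cl
    unfolding locally_integrable_on_def by auto
  then have "integrable (lebesgue_on \<Omega>) (\<lambda>x. f_B_tilde a b c (P x))"
    by (rule integrable_lebesgue_on_subset) (use assms(1) closure_subset in auto)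
  with adm that show ?thesis by blast
qed

lemma admissible_Q_add_test_function:
  assumes "open \<Omega>" "u \<in> admissible_Q \<Omega> Qb" "test_function \<Omega> \<phi>" "\<And>x. x \<in> \<Omega> \<Longrightarrow> \<phi> x \<in> S0"
  shows "(\<lambda>x. u x + \<phi> x) \<in> admissible_Q \<Omega> Qb"
proof -
  have u: "u \<in> W12 \<Omega> S0" "boundary_values \<Omega> u Qb" using assms(2) by (auto simp: admissible_Q_def)
  have "(\<lambda>x. u x + \<phi> x) \<in> W12 \<Omega> UNIV"
    by (rule W12_add[OF assms(1) u(1) test_function_W12[OF assms(1,3)]])
  moreover have "AE x in lebesgue_on \<Omega>. u x \<in> S0" using u(1) by (simp add: W12_def)
  then have "AE x in lebesgue_on \<Omega>. u x + \<phi> x \<in> S0"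
    using AE_space by eventually_elim (simp add: subspace_add[OF subspace_S0] assms(4))
  ultimately have "(\<lambda>x. u x + \<phi> x) \<in> W12 \<Omega> S0" by (simp add: W12_def)
  then show ?thesis
    using boundary_values_add_test_function[OF assms(1) u(2) assms(3)] by (simp add: admissible_Q_def)
qed

lemma is_arg_min_F_LG_le:
  assumes c: "c\<^sup>2 > 0" and "open \<Omega>" "L > 0"
    and min: "is_arg_min (F_LG a b c \<Omega> L) (\<lambda>P. P \<in> admissible_Q \<Omega> Qb) u"
    and P: "P \<in> admissible_Q \<Omega> Qb" and i: "integrable (lebesgue_on \<Omega>) (\<lambda>x. f_B_tilde a b c (P x))"
  shows "integrable (lebesgue_on \<Omega>) (\<lambda>x. f_B_tilde a b c (u x))"
    "L / 2 * (LINT x|lebesgue_on \<Omega>. weak_grad_sq \<Omega> u x) + (LINT x|lebesgue_on \<Omega>. f_B_tilde a b c (u x))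
      \<le> L / 2 * (LINT x|lebesgue_on \<Omega>. weak_grad_sq \<Omega> P x) + (LINT x|lebesgue_on \<Omega>. f_B_tilde a b c (P x))"
proof -
  have W: "u \<in> W12 \<Omega> S0" "P \<in> W12 \<Omega> S0" using min P by (auto simp: is_arg_min_def admissible_Q_def)
  have le: "F_LG a b c \<Omega> L u \<le> F_LG a b c \<Omega> L P" using min P by (auto simp: is_arg_min_def not_less)
  note eP = F_LG_eq[OF c assms(2,3) W(2) i]
  have "F_LG a b c \<Omega> L u < \<infinity>" using le eP by (auto simp: top_unique less_top[symmetric])
  then show iu: "integrable (lebesgue_on \<Omega>) (\<lambda>x. f_B_tilde a b c (u x))"
    by (rule f_B_tilde_integrable_if_F_LG_finite[OF c assms(2,3) W(1)])
  have "AE x in lebesgue_on \<Omega>. 0 \<le> f_B_tilde a b c (P x)"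
    using W(2) f_B_tilde_nonneg[OF c] by (auto simp: W12_def elim!: eventually_mono)
  then have "0 \<le> (LINT x|lebesgue_on \<Omega>. f_B_tilde a b c (P x))" by (rule integral_nonneg_AE)
  moreover have "0 \<le> L / 2 * (LINT x|lebesgue_on \<Omega>. weak_grad_sq \<Omega> P x)"
    using assms(3) by (intro mult_nonneg_nonneg integral_nonneg_AE) (auto simp: weak_grad_sq_nonneg)
  ultimately show "L / 2 * (LINT x|lebesgue_on \<Omega>. weak_grad_sq \<Omega> u x) + (LINT x|lebesgue_on \<Omega>. f_B_tilde a b c (u x))
      \<le> L / 2 * (LINT x|lebesgue_on \<Omega>. weak_grad_sq \<Omega> P x) + (LINT x|lebesgue_on \<Omega>. f_B_tilde a b c (P x))"
    using le unfolding eP F_LG_eq[OF c assms(2,3) W(1) iu] by (subst (asm) ennreal_le_iff) auto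
qed

text \<open>Cutoffs paste a constant minimizer \<open>Qs\<close> of the bulk density into \<open>u\<close> on most of \<open>\<Omega>\<close>. As \<open>|u|\<^sup>4\<close> is
  integrable, the bulk energy of what remains near the boundary tends to zero.\<close>

lemma admissible_Q_small_bulk:
  assumes c: "c\<^sup>2 > 0" and "open \<Omega>" "bounded \<Omega>" and u: "u \<in> admissible_Q \<Omega> Qb"
    and smooth: "smooth_on \<Omega> u" and uS: "\<And>x. x \<in> \<Omega> \<Longrightarrow> u x \<in> S0"
    and i: "integrable (lebesgue_on \<Omega>) (\<lambda>x. f_B_tilde a b c (u x))" and "\<epsilon> > 0"
  obtains P where "P \<in> admissible_Q \<Omega> Qb" "integrable (lebesgue_on \<Omega>) (\<lambda>x. f_B_tilde a b c (P x))"
    "(LINT x|lebesgue_on \<Omega>. f_B_tilde a b c (P x)) < \<epsilon>"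
proof -
  obtain \<eta> :: "nat \<Rightarrow> real^3 \<Rightarrow> real" where \<eta>: "\<And>m. test_function \<Omega> (\<eta> m)"
    "\<And>m x. 0 \<le> \<eta> m x" "\<And>m x. \<eta> m x \<le> 1" "\<And>x. x \<in> \<Omega> \<Longrightarrow> (\<lambda>m. \<eta> m x) \<longlonglongrightarrow> 1"
    using exists_cutoff_sequence[OF assms(2)] by blast
  obtain Qs where Qs: "Qs \<in> S0" "f_B_tilde a b c Qs = 0"
    using f_B_tilde_attains_zero[OF c] by blast
  obtain C where C: "C \<ge> 0" "\<And>Q. Q \<in> S0 \<Longrightarrow> norm Q ^ 4 \<le> C * (1 + f_B_tilde a b c Q)"
    "\<And>Q. Q \<in> S0 \<Longrightarrow> f_B_tilde a b c Q \<le> C * (1 + norm Q ^ 4)"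
    using f_B_tilde_two_sided_bound[OF c] by blast
  define P where "P m x = u x + \<eta> m x *\<^sub>R (Qs - u x)" for m x
  have adm: "P m \<in> admissible_Q \<Omega> Qb" for m
    unfolding P_def
  proof (rule admissible_Q_add_test_function[OF assms(2) u])
    obtain K where K: "compact K" "K \<subseteq> \<Omega>" "\<And>x. x \<notin> K \<Longrightarrow> \<eta> m x = 0"
      by (rule test_function_support[OF \<eta>(1)[of m]]) blast
    have oK: "open (- K)" using K(1) compact_imp_closed by blast
    have "smooth_on \<Omega> (\<lambda>x. \<eta> m x *\<^sub>R (Qs - u x))"
      by (intro smooth_on_scaleR smooth_on_diff smooth smooth_on_const assms(2)
          smooth_on_subset[OF test_function_smooth[OF \<eta>(1)]]) auto
    moreover have "smooth_on (- K) (\<lambda>x. \<eta> m x *\<^sub>R (Qs - u x))"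
      by (rule smooth_on_cong[OF smooth_on_const[OF oK, of 0]]) (simp add: K(3))
    ultimately have "smooth_on (\<Omega> \<union> - K) (\<lambda>x. \<eta> m x *\<^sub>R (Qs - u x))" by (rule smooth_on_Un)
    moreover have "\<Omega> \<union> - K = UNIV" using K(2) by auto
    ultimately show "test_function \<Omega> (\<lambda>x. \<eta> m x *\<^sub>R (Qs - u x))"
      unfolding test_function_def using K by auto
    show "\<eta> m x *\<^sub>R (Qs - u x) \<in> S0" if "x \<in> \<Omega>" for x
      by (intro subspace_scale[OF subspace_S0] subspace_diff[OF subspace_S0] Qs uS that)
  qed
  have PS: "P m x \<in> S0" if "x \<in> \<Omega>" for m x
    unfolding P_def by (intro subspace_add[OF subspace_S0] subspace_scale[OF subspace_S0]
        subspace_diff[OF subspace_S0] Qs uS that)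
  have Pn: "norm (P m x) \<le> norm (u x) + norm Qs" for m x
  proof -
    have "P m x = (1 - \<eta> m x) *\<^sub>R u x + \<eta> m x *\<^sub>R Qs" by (simp add: P_def algebra_simps)
    then have "norm (P m x) \<le> (1 - \<eta> m x) * norm (u x) + \<eta> m x * norm Qs"
      using norm_triangle_ineq[of "(1 - \<eta> m x) *\<^sub>R u x" "\<eta> m x *\<^sub>R Qs"] \<eta>(2,3)[of m x] by simp
    also have "\<dots> \<le> 1 * norm (u x) + 1 * norm Qs"
      using \<eta>(2,3)[of m x] by (intro add_mono mult_right_mono) auto
    finally show ?thesis by simp
  qed
  define h where "h x = C * (1 + 8 * (C * (1 + f_B_tilde a b c (u x)) + norm Qs ^ 4))" for x
  have fin: "emeasure (lebesgue_on \<Omega>) (space (lebesgue_on \<Omega>)) < \<infinity>"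
    using emeasure_bounded_finite[OF assms(3)] assms(2) by (simp add: emeasure_restrict_space)
  have const: "integrable (lebesgue_on \<Omega>) (\<lambda>x. k)" for k :: real
    using fin by (intro finite_measure.integrable_const finite_measureI) auto
  have hi: "integrable (lebesgue_on \<Omega>) h"
    unfolding h_def by (intro integrable_mult_right Bochner_Integration.integrable_add const i)
  have bound: "norm (f_B_tilde a b c (P m x)) \<le> h x" if x: "x \<in> \<Omega>" for m x
  proof -
    have "norm (P m x) ^ 4 \<le> (norm (u x) + norm Qs) ^ 4" by (intro power_mono Pn) simp
    also have "\<dots> \<le> 8 * (norm (u x) ^ 4 + norm Qs ^ 4)"
    proof -
      have sq: "(s + t)\<^sup>2 \<le> 2 * (s\<^sup>2 + t\<^sup>2)" for s t :: real
        using sum_squares_bound[of s t] by (simp add: power2_sum)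
      have "(s + t) ^ 4 \<le> 8 * (s ^ 4 + t ^ 4)" for s t :: real
      proof -
        have "(s + t) ^ 4 = ((s + t)\<^sup>2)\<^sup>2" by (simp flip: power_mult)
        also have "\<dots> \<le> (2 * (s\<^sup>2 + t\<^sup>2))\<^sup>2" by (intro power_mono sq) simp
        also have "\<dots> = 4 * (s\<^sup>2 + t\<^sup>2)\<^sup>2" by (simp only: power_mult_distrib) simp
        also have "\<dots> \<le> 4 * (2 * ((s\<^sup>2)\<^sup>2 + (t\<^sup>2)\<^sup>2))" by (intro mult_left_mono sq) simp
        also have "\<dots> = 8 * (s ^ 4 + t ^ 4)" by (simp flip: power_mult)
        finally show ?thesis .
      qed
      then show ?thesis by blast
    qed
    also have "\<dots> \<le> 8 * (C * (1 + f_B_tilde a b c (u x)) + norm Qs ^ 4)"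
      using C(2)[OF uS[OF x]] by simp
    finally have "C * (1 + norm (P m x) ^ 4) \<le> h x"
      unfolding h_def using C(1) by (intro mult_left_mono) auto
    then show ?thesis
      using C(3)[OF PS[OF x]] f_B_tilde_nonneg[OF c PS[OF x]] by (smt (verit) real_norm_def)
  qed
  have meas: "(\<lambda>x. f_B_tilde a b c (P m x)) \<in> borel_measurable (lebesgue_on \<Omega>)" for m
    using adm[of m] square_integrable_on_measurable[OF W12_square_integrable]
    by (intro f_B_tilde_measurable) (auto simp: admissible_Q_def)
  have Pi: "integrable (lebesgue_on \<Omega>) (\<lambda>x. f_B_tilde a b c (P m x))" for m
    by (rule Bochner_Integration.integrable_bound[OF hi meas])
      (use bound in \<open>auto intro!: AE_I2 order_trans[OF _ abs_ge_self]\<close>)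
  have "(\<lambda>m. LINT x|lebesgue_on \<Omega>. f_B_tilde a b c (P m x)) \<longlonglongrightarrow> (LINT x|lebesgue_on \<Omega>. 0)"
  proof (rule integral_dominated_convergence[OF _ meas hi])
    show "AE x in lebesgue_on \<Omega>. (\<lambda>m. f_B_tilde a b c (P m x)) \<longlonglongrightarrow> 0"
    proof (intro AE_I2)
      fix x assume "x \<in> space (lebesgue_on \<Omega>)"
      then have x: "x \<in> \<Omega>" by simp
      have "(\<lambda>m. P m x) \<longlonglongrightarrow> u x + 1 *\<^sub>R (Qs - u x)"
        unfolding P_def by (intro tendsto_intros \<eta>(4) x)
      from continuous_on_tendsto_compose[OF continuous_on_f_B_tilde[of UNIV a b c] this]
      show "(\<lambda>m. f_B_tilde a b c (P m x)) \<longlonglongrightarrow> 0" using Qs(2) by simp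
    qed
  qed (use bound in \<open>auto intro!: AE_I2\<close>)
  then have "(\<lambda>m. LINT x|lebesgue_on \<Omega>. f_B_tilde a b c (P m x)) \<longlonglongrightarrow> 0" by simp
  from order_tendstoD(2)[OF this \<open>\<epsilon> > 0\<close>]
  obtain m where "(LINT x|lebesgue_on \<Omega>. f_B_tilde a b c (P m x)) < \<epsilon>"
    by (auto simp: eventually_sequentially)
  with that adm Pi show ?thesis by blast
qed

text \<open>Let \<open>D\<close> be half the Dirichlet energy and \<open>\<phi> k\<close> the bulk energy of \<open>u k\<close>. Minimality of \<open>u k\<close> against the
  admissible map \<open>u j\<close> reads \<open>\<phi> k - \<phi> j \<le> L k * (D (u j) - D (u k))\<close>. Here \<open>\<phi> j\<close> tends to zero by comparison with
  maps of small bulk energy, and \<open>D (u j)\<close> tends to \<open>D v\<close> by strong convergence. For \<open>j \<rightarrow> \<infinity>\<close> this gives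
  \<open>\<phi> k / L k \<le> D v - D (u k)\<close>, and the right-hand side tends to zero.\<close>

lemma bulk_energy_over_L_tendsto_0:
  fixes u :: "nat \<Rightarrow> real^3 \<Rightarrow> real^3^3"
  assumes c: "c\<^sup>2 > 0" and o: "open \<Omega>" and "bounded \<Omega>" and L: "\<And>k. L k > 0" "L \<longlonglongrightarrow> 0"
    and Qb: "\<And>x. x \<in> frontier \<Omega> \<Longrightarrow> Qb x \<in> S0"
    and min: "\<And>k. is_arg_min (F_LG a b c \<Omega> (L k)) (\<lambda>P. P \<in> admissible_Q \<Omega> Qb) (u k)"
    and smooth: "smooth_on \<Omega> (u 0)" and uS: "\<And>x. x \<in> \<Omega> \<Longrightarrow> u 0 x \<in> S0"
    and lim: "tendsto_W12 \<Omega> S0 u v"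
  shows "integrable (lebesgue_on \<Omega>) (\<lambda>x. f_B_tilde a b c (u k x))"
    and "(\<lambda>k. (LINT x|lebesgue_on \<Omega>. f_B_tilde a b c (u k x)) / L k) \<longlonglongrightarrow> 0"
proof -
  have adm: "u k \<in> admissible_Q \<Omega> Qb" for k using min by (simp add: is_arg_min_def)
  have ne: "admissible_Q \<Omega> Qb \<noteq> {}" using adm[of 0] by blast
  obtain P0 where P0: "P0 \<in> admissible_Q \<Omega> Qb" "integrable (lebesgue_on \<Omega>) (\<lambda>x. f_B_tilde a b c (P0 x))"
    by (rule admissible_Q_bounded_extension[OF o assms(3) ne Qb, where a=a and b=b and c=c])
  note le = is_arg_min_F_LG_le[OF c o L(1) min]
  show i: "integrable (lebesgue_on \<Omega>) (\<lambda>x. f_B_tilde a b c (u k x))" for k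
    by (rule le(1)[OF P0])
  define \<phi> where "\<phi> k = (LINT x|lebesgue_on \<Omega>. f_B_tilde a b c (u k x))" for k
  define D where "D P = (LINT x|lebesgue_on \<Omega>. weak_grad_sq \<Omega> P x) / 2" for P :: "real^3 \<Rightarrow> real^3^3"
  have \<phi>0: "\<phi> k \<ge> 0" for k
  proof -
    have "AE x in lebesgue_on \<Omega>. 0 \<le> f_B_tilde a b c (u k x)"
      using adm[of k] f_B_tilde_nonneg[OF c] by (auto simp: admissible_Q_def W12_def elim!: eventually_mono)
    then show ?thesis unfolding \<phi>_def by (rule integral_nonneg_AE)
  qed
  have D0: "D P \<ge> 0" for P by (simp add: D_def weak_grad_sq_nonneg)
  have "\<phi> \<longlonglongrightarrow> 0"
  proof (rule LIMSEQ_I)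
    fix \<epsilon> :: real assume \<epsilon>: "\<epsilon> > 0"
    obtain P where P: "P \<in> admissible_Q \<Omega> Qb" "integrable (lebesgue_on \<Omega>) (\<lambda>x. f_B_tilde a b c (P x))"
      "(LINT x|lebesgue_on \<Omega>. f_B_tilde a b c (P x)) < \<epsilon> / 2"
      using admissible_Q_small_bulk[OF c o assms(3) adm smooth uS i, of "\<epsilon> / 2"] \<epsilon> by auto
    have "(\<lambda>k. L k * D P) \<longlonglongrightarrow> 0 * D P" by (intro tendsto_intros L)
    then have "eventually (\<lambda>k. L k * D P < \<epsilon> / 2) sequentially"
      using \<epsilon> by (intro order_tendstoD(2)) auto
    then obtain n where n: "\<And>k. k \<ge> n \<Longrightarrow> L k * D P < \<epsilon> / 2" by (auto simp: eventually_sequentially)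
    have "norm (\<phi> k - 0) < \<epsilon>" if "k \<ge> n" for k
    proof -
      have "L k * D (u k) + \<phi> k \<le> L k * D P + (LINT x|lebesgue_on \<Omega>. f_B_tilde a b c (P x))"
        using le(2)[OF P(1,2), of k] by (simp add: D_def \<phi>_def)
      moreover have "0 \<le> L k * D (u k)" using L(1)[of k] D0 by simp
      ultimately have "\<phi> k < \<epsilon>" using n[OF that] P(3) by linarith
      then show ?thesis using \<phi>0 by simp
    qed
    then show "\<exists>n. \<forall>k\<ge>n. norm (\<phi> k - 0) < \<epsilon>" by blast
  qed
  have Dlim: "(\<lambda>k. D (u k)) \<longlonglongrightarrow> D v"
    unfolding D_def by (intro tendsto_intros tendsto_W12_dirichlet[OF o lim]) simp
  have key: "\<phi> k \<le> L k * (D v - D (u k))" for k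
  proof -
    have "\<phi> k \<le> L k * (D (u j) - D (u k)) + \<phi> j" for j
      using le(2)[OF adm i, of k j] by (simp add: D_def \<phi>_def algebra_simps)
    moreover have "(\<lambda>j. L k * (D (u j) - D (u k)) + \<phi> j) \<longlonglongrightarrow> L k * (D v - D (u k)) + 0"
      by (intro tendsto_intros Dlim \<open>\<phi> \<longlonglongrightarrow> 0\<close>)
    ultimately have "\<phi> k \<le> L k * (D v - D (u k)) + 0"
      by (intro LIMSEQ_le_const) auto
    then show ?thesis by simp
  qed
  have bounds: "0 \<le> \<phi> k / L k" "\<phi> k / L k \<le> D v - D (u k)" for k
    using key[of k] \<phi>0[of k] L(1)[of k] by (auto simp: pos_divide_le_eq mult.commute)
  have z: "(\<lambda>k. D v - D (u k)) \<longlonglongrightarrow> 0"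
    using tendsto_diff[OF tendsto_const[of "D v"] Dlim] by simp
  have "(\<lambda>k. \<phi> k / L k) \<longlonglongrightarrow> 0"
    by (rule tendsto_sandwich[OF _ _ tendsto_const z]) (use bounds in auto)
  then show "(\<lambda>k. (LINT x|lebesgue_on \<Omega>. f_B_tilde a b c (u k x)) / L k) \<longlonglongrightarrow> 0"
    by (simp add: \<phi>_def)
qed

section \<open>Interior estimates by the maximum principle\<close>

definition laplacian :: "('a::euclidean_space \<Rightarrow> 'b::real_normed_vector) \<Rightarrow> 'a \<Rightarrow> 'b" where
  "laplacian f x = (\<Sum>i\<in>Basis. pd i (pd i f) x)"

lemma pd_bounded_linear:
  assumes "bounded_linear h" "smooth_on U f" "x \<in> U"
  shows "pd v (\<lambda>y. h (f y)) x = h (pd v f x)"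
proof -
  have "((\<lambda>y. h (f y)) has_derivative (\<lambda>v. h (pd v f x))) (at x)"
    by (rule bounded_linear.has_derivative[OF assms(1) smooth_on_has_derivative[OF assms(2,3)]])
  from frechet_derivative_at[OF this] show ?thesis by metis
qed

lemma pd_cong:
  assumes "smooth_on U f" "x \<in> U" "\<And>y. y \<in> U \<Longrightarrow> f y = g y"
  shows "pd v f x = pd v g x"
  using frechet_derivative_transform_within_open[OF
      differentiableI[OF smooth_on_has_derivative[OF assms(1,2)]] smooth_on_open[OF assms(1)] assms(2,3)]
  by (rule fun_cong)

lemma pd_pd_bounded_linear:
  assumes "bounded_linear h" "smooth_on U f" "x \<in> U" "v \<in> Basis"
  shows "pd w (pd v (\<lambda>y. h (f y))) x = h (pd w (pd v f) x)"
proof -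
  have "pd w (pd v (\<lambda>y. h (f y))) x = pd w (\<lambda>y. h (pd v f y)) x"
    by (rule pd_cong[OF smooth_on_pd[OF smooth_on_bounded_linear[OF assms(1,2)] assms(4)] assms(3)])
      (rule pd_bounded_linear[OF assms(1,2)])
  also have "\<dots> = h (pd w (pd v f) x)"
    by (rule pd_bounded_linear[OF assms(1) smooth_on_pd[OF assms(2,4)] assms(3)])
  finally show ?thesis .
qed

lemma laplacian_bounded_linear:
  fixes f :: "'a::euclidean_space \<Rightarrow> 'b::real_normed_vector"
  assumes "bounded_linear h" "smooth_on U f" "x \<in> U"
  shows "laplacian (\<lambda>y. h (f y)) x = h (laplacian f x)"
  using pd_pd_bounded_linear[OF assms] bounded_linear.linear[OF assms(1)]
  by (simp add: laplacian_def linear_sum)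

lemma smooth_on_line_derivative:
  fixes f :: "'a::euclidean_space \<Rightarrow> real"
  assumes "smooth_on U f" "y + t *\<^sub>R i \<in> U"
  shows "((\<lambda>t. f (y + t *\<^sub>R i)) has_real_derivative pd i f (y + t *\<^sub>R i)) (at t)"
proof -
  have "((\<lambda>t. y + t *\<^sub>R i) has_derivative (\<lambda>s. s *\<^sub>R i)) (at t)"
    by (auto intro!: derivative_eq_intros)
  from has_derivative_compose[OF this smooth_on_has_derivative[OF assms]]
  show ?thesis
    using linear_scale[OF has_derivative_linear[OF smooth_on_has_derivative[OF assms]]]
    by (simp add: has_field_derivative_def mult_commute_abs)
qed

lemma second_derivative_nonpos_at_max:
  fixes g g' :: "real \<Rightarrow> real"
  assumes r: "r > 0" and g: "\<And>t. \<bar>t\<bar> < r \<Longrightarrow> (g has_real_derivative g' t) (at t)"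
    and g2: "(g' has_real_derivative g2) (at 0)"
    and max: "\<And>t. \<bar>t\<bar> < r \<Longrightarrow> g t \<le> g 0"
  shows "g' 0 = 0" "g2 \<le> 0"
proof -
  show z: "g' 0 = 0"
    by (rule DERIV_local_max[OF g r]) (use r max in auto)
  show "g2 \<le> 0"
  proof (rule ccontr)
    assume "\<not> g2 \<le> 0"
    then obtain d where d: "d > 0" "\<And>h. 0 < h \<Longrightarrow> h < d \<Longrightarrow> g' 0 < g' (0 + h)"
      using DERIV_pos_inc_right[OF g2] by auto
    define e where "e = min d r / 2"
    have e: "0 < e" "e < d" "e < r" using d(1) r by (auto simp: e_def)
    have "g 0 < g e"
    proof (rule DERIV_pos_imp_increasing_open[OF e(1)])
      show "\<exists>y. (g has_real_derivative y) (at x) \<and> 0 < y" if "0 < x" "x < e" for x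
        using g[of x] d(2)[of x] that e z by (intro exI[of _ "g' x"]) auto
      show "continuous_on {0..e} g"
        by (rule continuous_at_imp_continuous_on) (use e in \<open>auto intro!: DERIV_isCont[OF g]\<close>)
    qed
    then show False using max[of e] e by simp
  qed
qed

text \<open>If \<open>w\<close> exceeds its bound at the centre, then \<open>(R\<^sup>2 - |x - x\<^sub>0|\<^sup>2)\<^sup>2 w(x)\<close>, which vanishes on
  the sphere, is large at its maximum; there the quadratic growth of \<open>\<Delta>w\<close> in \<open>w\<close> contradicts the
  second derivative test. The bound depends on \<open>\<alpha>\<close>, \<open>\<beta>\<close> and \<open>R\<close> alone.\<close>

lemma keller_osserman_bound:
  fixes w :: "'a::euclidean_space \<Rightarrow> real"
  assumes w: "smooth_on \<Omega> w" and R: "R > 0" "cball x0 R \<subseteq> \<Omega>" and nn: "\<And>x. x \<in> \<Omega> \<Longrightarrow> w x \<ge> 0"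
    and \<alpha>: "\<alpha> > 0" and \<beta>: "\<beta> \<ge> 0"
    and lap: "\<And>x. x \<in> ball x0 R \<Longrightarrow> laplacian w x \<ge> \<alpha> * (w x)\<^sup>2 - \<beta>"
  shows "w x0 \<le> (24 + 4 * DIM('a)) / (\<alpha> * R\<^sup>2) + sqrt (\<beta> / \<alpha>)"
proof -
  define g where "g x = R\<^sup>2 - (x - x0) \<bullet> (x - x0)" for x
  define v where "v x = (g x)\<^sup>2 * w x" for x
  have contv: "continuous_on (cball x0 R) v"
    unfolding v_def g_def
    by (intro continuous_intros continuous_on_subset[OF smooth_on_continuous_on[OF w] R(2)])
  obtain y where y: "y \<in> cball x0 R" "\<And>x. x \<in> cball x0 R \<Longrightarrow> v x \<le> v y"
    using continuous_attains_sup[OF _ _ contv] R(1) by (auto simp: cball_eq_empty)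
  have gnn: "g x \<ge> 0" "g x \<le> R\<^sup>2" if "x \<in> cball x0 R" for x
  proof -
    have "(norm (x - x0))\<^sup>2 \<le> R\<^sup>2"
      using that by (intro power_mono) (auto simp: dist_norm norm_minus_commute)
    then show "g x \<ge> 0" "g x \<le> R\<^sup>2" by (auto simp: g_def power2_norm_eq_inner)
  qed
  have v0: "v x0 = R ^ 4 * w x0" by (simp add: v_def g_def flip: power_mult)
  define p where "p = (24 + 4 * DIM('a)) * R\<^sup>2 / \<alpha>"
  define q where "q = sqrt (\<beta> / \<alpha>) * R ^ 4"
  have pq: "p \<ge> 0" "q \<ge> 0" using \<alpha> \<beta> by (auto simp: p_def q_def)
  have vy: "v y \<le> p + q"
  proof (cases "v y \<le> 0")
    case False
    then have gy: "g y \<noteq> 0" and wy: "w y > 0"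
      using nn[of y] y(1) R(2) by (auto simp: v_def mult_le_0_iff less_le)
    then have gpos: "g y > 0" using gnn(1)[OF y(1)] by simp
    have "(norm (y - x0))\<^sup>2 < R\<^sup>2" using gpos by (simp add: g_def power2_norm_eq_inner)
    then have yb: "y \<in> ball x0 R"
      using R(1) power2_less_imp_less[of "norm (y - x0)" R] by (simp add: dist_norm norm_minus_commute)
    obtain r where r: "r > 0" "ball y r \<subseteq> ball x0 R" using openE[OF open_ball yb] by blast
    have line: "y + t *\<^sub>R i \<in> ball x0 R" if "\<bar>t\<bar> < r" "i \<in> Basis" for t i
      using r(2) that by (auto simp: subset_iff dist_norm)
    have ball\<Omega>: "ball x0 R \<subseteq> \<Omega>" using R(2) ball_subset_cball by blast
    \<comment> \<open>second derivative test along the line in direction \<open>i\<close>; the vanishing first derivative expresses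
        \<open>\<partial>\<^sub>i w\<close> through \<open>w\<close>\<close>
    have second: "(g y)\<^sup>2 * pd i (pd i w) y \<le> w y * (24 * ((y - x0) \<bullet> i)\<^sup>2 + 4 * g y)" if i: "i \<in> Basis" for i
    proof -
      let ?z = "(y - x0) \<bullet> i"
      define G where "G t = (g (y + t *\<^sub>R i))\<^sup>2" for t
      have ge: "g (y + t *\<^sub>R i) = g y - 2 * t * ?z - t\<^sup>2" for t
        using i by (simp add: g_def inner_diff_left inner_diff_right inner_add_left inner_add_right
            inner_commute power2_eq_square algebra_simps)
      have G': "(G has_real_derivative 2 * (g y - 2 * t * ?z - t\<^sup>2) * (- 2 * ?z - 2 * t)) (at t)" for t
        unfolding G_def ge by (auto intro!: derivative_eq_intros)
      have G'': "((\<lambda>t. 2 * (g y - 2 * t * ?z - t\<^sup>2) * (- 2 * ?z - 2 * t)) has_real_derivative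
          8 * ?z\<^sup>2 - 4 * g y) (at 0)"
        by (auto intro!: derivative_eq_intros simp: power2_eq_square algebra_simps)
      have w': "((\<lambda>t. w (y + t *\<^sub>R i)) has_real_derivative pd i w (y + t *\<^sub>R i)) (at t)" if "\<bar>t\<bar> < r" for t
        by (rule smooth_on_line_derivative[OF w]) (use line[OF that i] ball\<Omega> in blast)
      have w'': "((\<lambda>t. pd i w (y + t *\<^sub>R i)) has_real_derivative pd i (pd i w) (y + 0 *\<^sub>R i)) (at 0)"
        by (rule smooth_on_line_derivative[OF smooth_on_pd[OF w i]]) (use line[of 0, OF _ i] r ball\<Omega> in auto)
      have max: "G t * w (y + t *\<^sub>R i) \<le> G 0 * w (y + 0 *\<^sub>R i)" if "\<bar>t\<bar> < r" for t
        using y(2)[of "y + t *\<^sub>R i"] line[OF that i] ball_subset_cball[of x0 R] by (auto simp: v_def G_def)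
      note d1 = DERIV_mult[OF G' w'] and d2 = DERIV_add[OF DERIV_mult[OF G'' w'[of 0]] DERIV_mult[OF w'' G'[of 0]]]
      note test = second_derivative_nonpos_at_max[OF r(1) d1 _ max]
      have d2': "((\<lambda>t. 2 * (g y - 2 * t * ?z - t\<^sup>2) * (- 2 * ?z - 2 * t) * w (y + t *\<^sub>R i) +
          pd i w (y + t *\<^sub>R i) * G t) has_real_derivative
          (8 * ?z\<^sup>2 - 4 * g y) * w y + 2 * (pd i w y * (2 * g y * (- 2 * ?z))) + pd i (pd i w) y * (g y)\<^sup>2) (at 0)"
        by (rule DERIV_cong[OF d2]) (use r(1) in \<open>auto simp: G_def algebra_simps\<close>)
      have first: "2 * g y * (- 2 * ?z) * w y + pd i w y * (g y)\<^sup>2 = 0"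
        using test(1)[OF _ d2'] by (simp add: G_def)
      have "g y * (pd i w y * g y) = g y * (4 * ?z * w y)"
        using first by (simp add: power2_eq_square algebra_simps)
      then have wi: "pd i w y * g y = 4 * ?z * w y" using mult_left_cancel[OF gy] by blast
      have "(8 * ?z\<^sup>2 - 4 * g y) * w y + 2 * (pd i w y * (2 * g y * (- 2 * ?z))) + pd i (pd i w) y * (g y)\<^sup>2 \<le> 0"
        using test(2)[OF _ d2'] .
      moreover have "2 * (pd i w y * (2 * g y * (- 2 * ?z))) = - 32 * ?z\<^sup>2 * w y"
      proof -
        have "2 * (pd i w y * (2 * g y * (- 2 * ?z))) = - 8 * ?z * (pd i w y * g y)" by simp
        then show ?thesis unfolding wi by (simp add: power2_eq_square)
      qed
      ultimately show ?thesis by (simp add: algebra_simps)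
    qed
    have yR: "(\<Sum>i\<in>Basis. ((y - x0) \<bullet> i)\<^sup>2) \<le> R\<^sup>2"
      using gpos unfolding g_def euclidean_inner[of "y - x0" "y - x0"] by (simp add: power2_eq_square)
    have "(g y)\<^sup>2 * laplacian w y \<le> (\<Sum>i\<in>Basis. w y * (24 * ((y - x0) \<bullet> i)\<^sup>2 + 4 * g y))"
      unfolding laplacian_def sum_distrib_left by (rule sum_mono[OF second])
    also have "\<dots> = w y * (24 * (\<Sum>i\<in>Basis. ((y - x0) \<bullet> i)\<^sup>2) + DIM('a) * (4 * g y))"
      by (simp add: sum.distrib flip: sum_distrib_left)
    also have "\<dots> \<le> w y * (24 * R\<^sup>2 + DIM('a) * (4 * R\<^sup>2))"
      using wy yR gnn(2)[OF y(1)] by (intro mult_left_mono add_mono) auto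
    finally have "(g y)\<^sup>2 * (\<alpha> * (w y)\<^sup>2 - \<beta>) \<le> w y * (24 * R\<^sup>2 + DIM('a) * (4 * R\<^sup>2))"
      using mult_left_mono[OF lap[OF yb], of "(g y)\<^sup>2"] by simp
    from mult_left_mono[OF this, of "(g y)\<^sup>2"]
    have "\<alpha> * (v y)\<^sup>2 - \<beta> * ((g y)\<^sup>2)\<^sup>2 \<le> (24 + 4 * DIM('a)) * R\<^sup>2 * v y"
      by (simp add: v_def power2_eq_square algebra_simps)
    moreover have "\<beta> * ((g y)\<^sup>2)\<^sup>2 \<le> \<beta> * ((R\<^sup>2)\<^sup>2)\<^sup>2"
      using \<beta> gnn[OF y(1)] by (intro mult_left_mono power_mono) auto
    ultimately have "\<alpha> * (v y)\<^sup>2 \<le> (24 + 4 * DIM('a)) * R\<^sup>2 * v y + \<beta> * ((R\<^sup>2)\<^sup>2)\<^sup>2" by linarith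
    then have quad: "(v y)\<^sup>2 \<le> p * v y + q\<^sup>2"
      using \<alpha> \<beta> by (simp add: p_def q_def field_simps power_mult_distrib flip: power_mult)
    show ?thesis
    proof (rule ccontr)
      assume "\<not> v y \<le> p + q"
      then have gt: "v y > p + q" by simp
      have "p * v y + q\<^sup>2 < v y * v y"
      proof -
        have "q * q \<le> q * v y" using gt pq by (intro mult_left_mono) auto
        moreover have "(p + q) * v y < v y * v y" using gt False by (intro mult_strict_right_mono) auto
        ultimately show ?thesis by (simp add: power2_eq_square distrib_right)
      qed
      with quad show False by (simp add: power2_eq_square)
    qed
  qed (use pq in linarith)
  have "R ^ 4 * w x0 \<le> p + q" using y(2)[of x0] R(1) vy v0 by simp
  also have "p + q = R ^ 4 * ((24 + 4 * DIM('a)) / (\<alpha> * R\<^sup>2) + sqrt (\<beta> / \<alpha>))"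
  proof -
    have "p = R ^ 4 * ((24 + 4 * DIM('a)) / (\<alpha> * R\<^sup>2))"
      using R(1) \<alpha> by (simp add: p_def field_simps power2_eq_square power4_eq_xxxx)
    then show ?thesis by (simp add: q_def distrib_left mult.commute)
  qed
  finally show ?thesis using R(1) by simp
qed

text \<open>The function \<open>(u(x) - u(x')) / 2\<close>, with \<open>x'\<close> the mirror image of \<open>x\<close> in the hyperplane through
  \<open>x\<^sub>0\<close> orthogonal to \<open>i\<close>, vanishes on that hyperplane. On the half cube it stays below a quadratic
  barrier with the same property, and the slopes at \<open>x\<^sub>0\<close> are compared.\<close>

lemma partial_derivative_le_on_cube:
  fixes u :: "'a::euclidean_space \<Rightarrow> real" and M N :: real
  assumes u: "smooth_on \<Omega> u" and i: "i \<in> Basis" and d: "d > 0"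
    and cube: "\<And>x. (\<And>j. j \<in> Basis \<Longrightarrow> \<bar>(x - x0) \<bullet> j\<bar> \<le> d) \<Longrightarrow> x \<in> \<Omega> \<and> \<bar>u x\<bar> \<le> M \<and> \<bar>laplacian u x\<bar> < N"
  shows "pd i u x0 \<le> DIM('a) * M / d + N * d / 2"
proof -
  define Rf where "Rf x = x - (2 * ((x - x0) \<bullet> i)) *\<^sub>R i" for x :: 'a
  define n where "n = real DIM('a)"
  \<comment> \<open>The first part of the barrier is harmonic, vanishes at \<open>x\<^sub>0\<close> and dominates \<open>M\<close> on the other faces of
      the half cube; the second part has Laplacian \<open>- N\<close>.\<close>
  define \<psi> where "\<psi> x = M / d\<^sup>2 * ((\<Sum>j\<in>Basis - {i}. ((x - x0) \<bullet> j)\<^sup>2) +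
      (x - x0) \<bullet> i * (n * d - (n - 1) * ((x - x0) \<bullet> i))) + N / 2 * ((x - x0) \<bullet> i * (d - (x - x0) \<bullet> i))" for x :: 'a
  define \<phi> where "\<phi> x = (u x - u (Rf x)) / 2" for x
  define Q where "Q = {x. \<forall>j\<in>Basis. \<bar>(x - x0) \<bullet> j\<bar> \<le> d}"
  define H where "H = Q \<inter> {x. 0 \<le> (x - x0) \<bullet> i}"
  have Q\<Omega>: "x \<in> \<Omega>" "\<bar>u x\<bar> \<le> M" "\<bar>laplacian u x\<bar> < N" if "x \<in> Q" for x
    using cube[of x] that by (auto simp: Q_def)
  have Rfj: "(Rf x - x0) \<bullet> j = (if j = i then - ((x - x0) \<bullet> i) else (x - x0) \<bullet> j)" if "j \<in> Basis" for x j
    using that i by (auto simp: Rf_def inner_diff_left inner_Basis)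
  have RfQ: "Rf x \<in> Q" if "x \<in> Q" for x
    using that i by (auto simp: Q_def Rfj)
  have x0Q: "x0 \<in> Q" using d by (simp add: Q_def)
  have M0: "M \<ge> 0" using Q\<Omega>(2)[OF x0Q] by linarith
  have N0: "N > 0" using Q\<Omega>(3)[OF x0Q] by linarith
  have n1: "n \<ge> 1" by (simp add: n_def DIM_ge_Suc0 Suc_leI)
  have Qbox: "Q = cbox (x0 - d *\<^sub>R One) (x0 + d *\<^sub>R One)"
    by (auto simp: Q_def mem_box abs_le_iff inner_diff_left inner_add_left algebra_simps)
  have "closed {x. 0 \<le> (x - x0) \<bullet> i}" by (intro closed_Collect_le continuous_intros)
  then have Hc: "compact H" unfolding H_def Qbox by (intro compact_Int_closed compact_cbox)
  have contu: "continuous_on Q u"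
    using continuous_on_subset[OF smooth_on_continuous_on[OF u]] Q\<Omega>(1) by blast
  have contR: "continuous_on S Rf" for S unfolding Rf_def by (intro continuous_intros)
  have cont: "continuous_on H (\<lambda>x. \<phi> x - \<psi> x)"
    unfolding \<phi>_def \<psi>_def
    by (intro continuous_intros continuous_on_subset[OF contu] continuous_on_compose2[OF contu contR])
      (use RfQ in \<open>auto simp: H_def\<close>)
  have x0H: "x0 \<in> H" using x0Q by (simp add: H_def)
  obtain y where y: "y \<in> H" "\<And>x. x \<in> H \<Longrightarrow> \<phi> x - \<psi> x \<le> \<phi> y - \<psi> y"
    using continuous_attains_sup[OF Hc _ cont] x0H by blast
  have yQ: "y \<in> Q" "0 \<le> (y - x0) \<bullet> i" using y(1) by (auto simp: H_def)
  have yd: "(y - x0) \<bullet> i \<le> d" using yQ i by (auto simp: Q_def abs_le_iff)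
  have sum0: "(\<Sum>j\<in>Basis - {i}. ((y - x0) \<bullet> j)\<^sup>2) \<ge> 0" by (intro sum_nonneg) simp
  have \<phi>M: "\<phi> y \<le> M" using Q\<Omega>(2)[OF yQ(1)] Q\<Omega>(2)[OF RfQ[OF yQ(1)]] by (simp add: \<phi>_def abs_le_iff)
  have prod1: "(y - x0) \<bullet> i * (n * d - (n - 1) * ((y - x0) \<bullet> i)) \<ge> 0"
  proof -
    have "(n - 1) * ((y - x0) \<bullet> i) \<le> (n - 1) * d" using yd n1 by (intro mult_left_mono) auto
    then show ?thesis using yQ(2) d by (intro mult_nonneg_nonneg) (auto simp: algebra_simps)
  qed
  have prod2: "N / 2 * ((y - x0) \<bullet> i * (d - (y - x0) \<bullet> i)) \<ge> 0" using yQ(2) yd N0 by auto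
  have big: "\<psi> y \<ge> M" if "(\<Sum>j\<in>Basis - {i}. ((y - x0) \<bullet> j)\<^sup>2) + (y - x0) \<bullet> i * (n * d - (n - 1) * ((y - x0) \<bullet> i)) \<ge> d\<^sup>2"
    using mult_left_mono[OF that, of "M / d\<^sup>2"] M0 d prod2 by (simp add: \<psi>_def)
  have le0: "\<phi> y - \<psi> y \<le> 0"
  proof (cases "\<exists>j\<in>Basis - {i}. \<bar>(y - x0) \<bullet> j\<bar> = d")
    case True
    then obtain j where j: "j \<in> Basis - {i}" "\<bar>(y - x0) \<bullet> j\<bar> = d" by blast
    have "((y - x0) \<bullet> j)\<^sup>2 \<le> (\<Sum>j\<in>Basis - {i}. ((y - x0) \<bullet> j)\<^sup>2)"
      by (rule member_le_sum) (use j in auto)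
    moreover have "((y - x0) \<bullet> j)\<^sup>2 = d\<^sup>2" using j(2) by (metis power2_abs)
    ultimately show ?thesis using big prod1 \<phi>M by linarith
  next
    case nj: False
    show ?thesis
    proof (cases "(y - x0) \<bullet> i = d")
      case True
      then have "(y - x0) \<bullet> i * (n * d - (n - 1) * ((y - x0) \<bullet> i)) = d\<^sup>2"
        by (simp add: power2_eq_square algebra_simps)
      then show ?thesis using big sum0 \<phi>M by linarith
    next
      case ni: False
      show ?thesis
      proof (cases "(y - x0) \<bullet> i = 0")
        case True
        then have "Rf y = y" by (simp add: Rf_def)
        then have "\<phi> y = 0" by (simp add: \<phi>_def)
        moreover have "\<psi> y \<ge> 0" using True M0 sum0 by (simp add: \<psi>_def)
        ultimately show ?thesis by simp
      next
        case False
        \<comment> \<open>an interior maximum, excluded since \<open>\<Delta>(\<phi> - \<psi>) > 0\<close>\<close>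
        then have yi: "0 < (y - x0) \<bullet> i" "(y - x0) \<bullet> i < d" using ni yd yQ(2) by auto
        have yj: "\<bar>(y - x0) \<bullet> j\<bar> < d" if "j \<in> Basis" for j
          using nj yi yQ(1) that by (cases "j = i") (auto simp: Q_def less_le)
        have second: "(pd j (pd j u) y - pd j (pd j u) (Rf y)) / 2 \<le>
            (if j = i then - (2 * (n - 1) * M / d\<^sup>2) - N else 2 * M / d\<^sup>2)" if j: "j \<in> Basis" for j
        proof -
          \<comment> \<open>moving \<open>y\<close> by \<open>t\<close> along \<open>j\<close> moves its mirror image by \<open>\<sigma> * t\<close>\<close>
          define \<sigma> where "\<sigma> = (if j = i then - 1 else (1::real))"
          define r where "r = (if j = i then min ((y - x0) \<bullet> i) (d - (y - x0) \<bullet> i) else d - \<bar>(y - x0) \<bullet> j\<bar>)"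
          have r: "r > 0" using yi yj[OF j] by (simp add: r_def)
          have inH: "y + t *\<^sub>R j \<in> H" if "\<bar>t\<bar> < r" for t
          proof -
            have "\<bar>(y + t *\<^sub>R j - x0) \<bullet> k\<bar> \<le> d" if k: "k \<in> Basis" for k
              using yj[OF k] \<open>\<bar>t\<bar> < r\<close> j k yi
              by (auto simp: inner_diff_left inner_add_left inner_Basis r_def split: if_splits)
            moreover have "0 \<le> (y + t *\<^sub>R j - x0) \<bullet> i"
              using \<open>\<bar>t\<bar> < r\<close> j i yi
              by (auto simp: inner_diff_left inner_add_left inner_Basis r_def split: if_splits)
            ultimately show ?thesis by (simp add: H_def Q_def)
          qed
          have Rt: "Rf (y + t *\<^sub>R j) = Rf y + (\<sigma> * t) *\<^sub>R j" for t
          proof -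
            have two: "t *\<^sub>R i + t *\<^sub>R i = (t * 2) *\<^sub>R i" by (metis mult.commute scaleR_2 scaleR_scaleR)
            show ?thesis
              using i j two by (auto simp: Rf_def \<sigma>_def inner_diff_left inner_add_left inner_Basis algebra_simps)
          qed
          have inQ: "y + t *\<^sub>R j \<in> \<Omega>" "Rf y + (\<sigma> * t) *\<^sub>R j \<in> \<Omega>" if "\<bar>t\<bar> < r" for t
            using Q\<Omega>(1) inH[OF that] RfQ[of "y + t *\<^sub>R j"] by (auto simp: H_def Rt)
          have \<psi>t: "\<psi> (y + t *\<^sub>R j) = \<psi> y + (if j = i
              then M / d\<^sup>2 * (t * (n * d) - (n - 1) * (2 * t * ((y - x0) \<bullet> i) + t\<^sup>2)) + N / 2 * (t * d - 2 * t * ((y - x0) \<bullet> i) - t\<^sup>2)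
              else M / d\<^sup>2 * (2 * t * ((y - x0) \<bullet> j) + t\<^sup>2))" for t
          proof (cases "j = i")
            case True
            have s1: "(\<Sum>k\<in>Basis - {i}. ((y + t *\<^sub>R j - x0) \<bullet> k)\<^sup>2) = (\<Sum>k\<in>Basis - {i}. ((y - x0) \<bullet> k)\<^sup>2)"
              by (rule sum.cong) (use i True in \<open>auto simp: inner_diff_left inner_add_left inner_Basis\<close>)
            have s2: "(y + t *\<^sub>R j - x0) \<bullet> i = (y - x0) \<bullet> i + t"
              using i True by (simp add: inner_diff_left inner_add_left)
            have "m * (S + (z + t) * (n * d - (n - 1) * (z + t))) + k * ((z + t) * (d - (z + t)))
                = m * (S + z * (n * d - (n - 1) * z)) + k * (z * (d - z)) +
                  (m * (t * (n * d) - (n - 1) * (2 * t * z + t\<^sup>2)) + k * (t * d - 2 * t * z - t\<^sup>2))"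
              for m S z k :: real by algebra
            then show ?thesis unfolding \<psi>_def s1 s2 if_P[OF True] by blast
          next
            case False
            have "(\<Sum>k\<in>Basis - {i}. ((y + t *\<^sub>R j - x0) \<bullet> k)\<^sup>2)
                = (\<Sum>k\<in>Basis - {i}. ((y - x0) \<bullet> k)\<^sup>2 + (if k = j then 2 * t * ((y - x0) \<bullet> j) + t\<^sup>2 else 0))"
              by (rule sum.cong) (use j in \<open>auto simp: inner_diff_left inner_add_left inner_Basis power2_eq_square algebra_simps\<close>)
            also have "\<dots> = (\<Sum>k\<in>Basis - {i}. ((y - x0) \<bullet> k)\<^sup>2) + (2 * t * ((y - x0) \<bullet> j) + t\<^sup>2)"
              using False j by (simp add: sum.distrib)
            finally have s: "(\<Sum>k\<in>Basis - {i}. ((y + t *\<^sub>R j - x0) \<bullet> k)\<^sup>2) =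
              (\<Sum>k\<in>Basis - {i}. ((y - x0) \<bullet> k)\<^sup>2) + (2 * t * ((y - x0) \<bullet> j) + t\<^sup>2)" .
            have "(y + t *\<^sub>R j - x0) \<bullet> i = (y - x0) \<bullet> i"
              using i j False by (simp add: inner_diff_left inner_add_left inner_Basis)
            then show ?thesis using False unfolding \<psi>_def s by (simp add: distrib_left)
          qed
          define c1 where "c1 = (if j = i then M / d\<^sup>2 * (n * d - (n - 1) * (2 * ((y - x0) \<bullet> i))) + N / 2 * (d - 2 * ((y - x0) \<bullet> i))
              else M / d\<^sup>2 * (2 * ((y - x0) \<bullet> j)))"
          define c2 where "c2 = (if j = i then - (2 * (n - 1) * M / d\<^sup>2) - N else 2 * M / d\<^sup>2)"
          have \<psi>t': "\<psi> (y + t *\<^sub>R j) = \<psi> y + c1 * t + c2 / 2 * t\<^sup>2" for t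
            unfolding \<psi>t by (simp add: c1_def c2_def algebra_simps diff_divide_distrib add_divide_distrib)
          have u1: "((\<lambda>t. u (y + t *\<^sub>R j)) has_real_derivative pd j u (y + t *\<^sub>R j)) (at t)" if "\<bar>t\<bar> < r" for t
            by (rule smooth_on_line_derivative[OF u inQ(1)[OF that]])
          have u2: "((\<lambda>t. pd j u (y + t *\<^sub>R j)) has_real_derivative pd j (pd j u) (y + 0 *\<^sub>R j)) (at 0)"
            by (rule smooth_on_line_derivative[OF smooth_on_pd[OF u j] inQ(1)]) (use r in simp)
          have \<sigma>t: "((\<lambda>t. \<sigma> * t) has_real_derivative \<sigma>) (at t)" for t
            by (auto intro!: derivative_eq_intros)
          have v1: "((\<lambda>t. u (Rf y + (\<sigma> * t) *\<^sub>R j)) has_real_derivative pd j u (Rf y + (\<sigma> * t) *\<^sub>R j) * \<sigma>) (at t)"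
            if "\<bar>t\<bar> < r" for t
            by (rule DERIV_chain2[OF smooth_on_line_derivative[OF u inQ(2)[OF that]] \<sigma>t])
          have v2: "((\<lambda>t. pd j u (Rf y + (\<sigma> * t) *\<^sub>R j)) has_real_derivative
              pd j (pd j u) (Rf y + (\<sigma> * 0) *\<^sub>R j) * \<sigma>) (at 0)"
            by (rule DERIV_chain2[OF smooth_on_line_derivative[OF smooth_on_pd[OF u j] inQ(2)] \<sigma>t]) (use r in simp)
          have q1: "((\<lambda>t. \<psi> y + c1 * t + c2 / 2 * t\<^sup>2) has_real_derivative c1 + c2 * t) (at t)" for t
            by (auto intro!: derivative_eq_intros)
          have q2: "((\<lambda>t. c1 + c2 * t) has_real_derivative c2) (at 0)"
            by (auto intro!: derivative_eq_intros)
          have d1: "((\<lambda>t. (u (y + t *\<^sub>R j) - u (Rf y + (\<sigma> * t) *\<^sub>R j)) / 2 - (\<psi> y + c1 * t + c2 / 2 * t\<^sup>2))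
              has_real_derivative (pd j u (y + t *\<^sub>R j) - pd j u (Rf y + (\<sigma> * t) *\<^sub>R j) * \<sigma>) / 2 - (c1 + c2 * t)) (at t)"
            if "\<bar>t\<bar> < r" for t
            by (intro DERIV_diff DERIV_cdivide u1 v1 q1 that)
          have d2: "((\<lambda>t. (pd j u (y + t *\<^sub>R j) - pd j u (Rf y + (\<sigma> * t) *\<^sub>R j) * \<sigma>) / 2 - (c1 + c2 * t))
              has_real_derivative (pd j (pd j u) (y + 0 *\<^sub>R j) - pd j (pd j u) (Rf y + (\<sigma> * 0) *\<^sub>R j) * \<sigma> * \<sigma>) / 2 - c2) (at 0)"
            by (intro DERIV_diff DERIV_cdivide DERIV_cmult_right u2 v2 q2)
          have "(pd j (pd j u) (y + 0 *\<^sub>R j) - pd j (pd j u) (Rf y + (\<sigma> * 0) *\<^sub>R j) * \<sigma> * \<sigma>) / 2 - c2 \<le> 0"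
          proof (rule second_derivative_nonpos_at_max(2)[OF r d1 d2])
            fix t assume "\<bar>t\<bar> < r"
            from y(2)[OF inH[OF this]]
            show "(u (y + t *\<^sub>R j) - u (Rf y + (\<sigma> * t) *\<^sub>R j)) / 2 - (\<psi> y + c1 * t + c2 / 2 * t\<^sup>2)
              \<le> (u (y + 0 *\<^sub>R j) - u (Rf y + (\<sigma> * 0) *\<^sub>R j)) / 2 - (\<psi> y + c1 * 0 + c2 / 2 * 0\<^sup>2)"
              unfolding \<phi>_def Rt \<psi>t' by simp
          qed
          moreover have "\<sigma> * \<sigma> = 1" by (simp add: \<sigma>_def)
          ultimately show ?thesis by (simp add: c2_def mult.assoc)
        qed
        have "(laplacian u y - laplacian u (Rf y)) / 2
            = (\<Sum>j\<in>Basis. (pd j (pd j u) y - pd j (pd j u) (Rf y)) / 2)"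
          by (simp add: laplacian_def sum_subtractf flip: sum_divide_distrib)
        also have "\<dots> \<le> (\<Sum>j\<in>Basis. if j = i then - (2 * (n - 1) * M / d\<^sup>2) - N else 2 * M / d\<^sup>2)"
          by (rule sum_mono[OF second])
        also have "\<dots> = - (2 * (n - 1) * M / d\<^sup>2) - N + (\<Sum>j\<in>Basis - {i}. 2 * M / d\<^sup>2)"
          using i by (simp add: sum.remove[of Basis i])
        also have "\<dots> = - N"
          using i n1 by (simp add: n_def card_Diff_singleton of_nat_diff DIM_positive Suc_leI)
        finally have "laplacian u y - laplacian u (Rf y) \<le> - 2 * N" by simp
        then show ?thesis using Q\<Omega>(3)[OF yQ(1)] Q\<Omega>(3)[OF RfQ[OF yQ(1)]] by linarith
      qed
    qed
  qed
  have ineq: "(u (x0 + t *\<^sub>R i) - u (x0 - t *\<^sub>R i)) / 2 \<le> t * (n * M / d + N * d / 2)" if t: "0 < t" "t < d" for t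
  proof -
    have tH: "x0 + t *\<^sub>R i \<in> H" using t i by (auto simp: H_def Q_def inner_Basis)
    have "\<phi> (x0 + t *\<^sub>R i) = (u (x0 + t *\<^sub>R i) - u (x0 - t *\<^sub>R i)) / 2"
    proof -
      have "(2 * t) *\<^sub>R i = t *\<^sub>R i + t *\<^sub>R i" by (simp flip: scaleR_left_distrib)
      then have "Rf (x0 + t *\<^sub>R i) = x0 - t *\<^sub>R i" using i by (simp add: Rf_def)
      then show ?thesis by (simp add: \<phi>_def)
    qed
    moreover have "\<psi> (x0 + t *\<^sub>R i) \<le> t * (n * M / d + N * d / 2)"
    proof -
      have "(\<Sum>j\<in>Basis - {i}. ((x0 + t *\<^sub>R i - x0) \<bullet> j)\<^sup>2) = 0"
        using i by (intro sum.neutral) (auto simp: inner_Basis)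
      then have "\<psi> (x0 + t *\<^sub>R i) = M / d\<^sup>2 * (t * (n * d - (n - 1) * t)) + N / 2 * (t * (d - t))"
        using i by (simp add: \<psi>_def)
      also have "\<dots> \<le> M / d\<^sup>2 * (t * (n * d)) + N / 2 * (t * d)"
        using t M0 N0 n1 d by (intro add_mono mult_left_mono) auto
      also have "\<dots> = t * (n * M / d + N * d / 2)" using d by (simp add: power2_eq_square field_simps)
      finally show ?thesis .
    qed
    ultimately show ?thesis using y(2)[OF tH] le0 by linarith
  qed
  have x0\<Omega>: "x0 \<in> \<Omega>" using Q\<Omega>(1)[OF x0Q] .
  have "((\<lambda>t. u (x0 + t *\<^sub>R i)) has_real_derivative pd i u (x0 + 0 *\<^sub>R i)) (at 0)"
    by (rule smooth_on_line_derivative[OF u]) (simp add: x0\<Omega>)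
  moreover have "((\<lambda>t. u (x0 + (- t) *\<^sub>R i)) has_real_derivative pd i u (x0 + (- 0) *\<^sub>R i) * (- 1)) (at 0)"
    by (rule DERIV_chain2[OF smooth_on_line_derivative[OF u]])
      (auto simp: x0\<Omega> intro!: derivative_eq_intros)
  ultimately have "((\<lambda>t. (u (x0 + t *\<^sub>R i) - u (x0 + (- t) *\<^sub>R i)) / 2) has_real_derivative pd i u x0) (at 0)"
    by (auto intro!: derivative_eq_intros)
  then have "((\<lambda>t. (u (x0 + t *\<^sub>R i) - u (x0 + (- t) *\<^sub>R i)) / 2 / t) \<longlongrightarrow> pd i u x0) (at 0)"
    by (simp add: DERIV_def)
  then have "((\<lambda>t. (u (x0 + t *\<^sub>R i) - u (x0 + (- t) *\<^sub>R i)) / 2 / t) \<longlongrightarrow> pd i u x0) (at_right 0)"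
    by (rule filterlim_mono[OF _ order_refl at_le]) simp
  then have "pd i u x0 \<le> n * M / d + N * d / 2"
  proof (rule tendsto_upperbound)
    show "\<forall>\<^sub>F t in at_right 0. (u (x0 + t *\<^sub>R i) - u (x0 + (- t) *\<^sub>R i)) / 2 / t \<le> n * M / d + N * d / 2"
      unfolding eventually_at_right_field
    proof (intro exI[of _ d] conjI allI impI)
      fix t assume "0 < t" "t < d"
      with ineq[OF this] show "(u (x0 + t *\<^sub>R i) - u (x0 + (- t) *\<^sub>R i)) / 2 / t \<le> n * M / d + N * d / 2"
        by (simp add: pos_divide_le_eq mult_ac)
    qed (rule d)
  qed simp
  then show ?thesis by (simp add: n_def)
qed

text \<open>Testing against the fixed vector \<open>\<partial>\<^sub>i u (x\<^sub>0)\<close> reduces the vectorial estimate to the scalar one.\<close>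

lemma norm_pd_le_on_cube:
  fixes u :: "'a::euclidean_space \<Rightarrow> 'b::euclidean_space" and M N :: real
  assumes u: "smooth_on \<Omega> u" and i: "i \<in> Basis" and d: "d > 0"
    and cube: "\<And>x. (\<And>j. j \<in> Basis \<Longrightarrow> \<bar>(x - x0) \<bullet> j\<bar> \<le> d) \<Longrightarrow> x \<in> \<Omega> \<and> norm (u x) \<le> M \<and> norm (laplacian u x) < N"
  shows "norm (pd i u x0) \<le> DIM('a) * M / d + N * d / 2"
proof (cases "pd i u x0 = 0")
  case True
  have "norm (u x0) \<le> M \<and> norm (laplacian u x0) < N" using cube[of x0] d by simp
  then have "0 \<le> M" "0 \<le> N"
    using norm_ge_zero[of "u x0"] norm_ge_zero[of "laplacian u x0"] by linarith+
  then show ?thesis using True d by simp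
next
  case False
  define B where "B = pd i u x0"
  have B: "norm B > 0" using False by (simp add: B_def)
  note lin = bounded_linear_inner_left[of B]
  have x0: "x0 \<in> \<Omega>" using cube[of x0] d by simp
  have "pd i (\<lambda>x. u x \<bullet> B) x0 \<le> DIM('a) * (M * norm B) / d + (N * norm B) * d / 2"
  proof (rule partial_derivative_le_on_cube[OF smooth_on_bounded_linear[OF lin u] i d])
    fix x assume "\<And>j. j \<in> Basis \<Longrightarrow> \<bar>(x - x0) \<bullet> j\<bar> \<le> d"
    then have x: "x \<in> \<Omega>" "norm (u x) \<le> M" "norm (laplacian u x) < N" using cube by auto
    have "\<bar>u x \<bullet> B\<bar> \<le> M * norm B"
      using Cauchy_Schwarz_ineq2[of "u x" B] mult_right_mono[OF x(2), of "norm B"] by simp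
    moreover have "\<bar>laplacian (\<lambda>x. u x \<bullet> B) x\<bar> < N * norm B"
      unfolding laplacian_bounded_linear[OF lin u x(1)]
      using Cauchy_Schwarz_ineq2[of "laplacian u x" B] mult_strict_right_mono[OF x(3) B] by linarith
    ultimately show "x \<in> \<Omega> \<and> \<bar>u x \<bullet> B\<bar> \<le> M * norm B \<and> \<bar>laplacian (\<lambda>x. u x \<bullet> B) x\<bar> < N * norm B"
      using x(1) by blast
  qed
  then have "norm B * norm B \<le> norm B * (DIM('a) * M / d + N * d / 2)"
    unfolding pd_bounded_linear[OF lin u x0] B_def[symmetric] power2_norm_eq_inner[symmetric]
    by (simp add: power2_eq_square algebra_simps)
  then have "norm B \<le> DIM('a) * M / d + N * d / 2" using B mult_le_cancel_left_pos by blast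
  then show ?thesis by (simp add: B_def)
qed

section \<open>The monotonicity formula\<close>

lemma max_0_power2_has_derivative:
  "((\<lambda>t. (max 0 t)\<^sup>2) has_real_derivative 2 * max 0 t) (at (t::real))"
proof -
  consider "t > 0" | "t = 0" | "t < 0" by linarith
  then show ?thesis
  proof cases
    case 1
    have "((\<lambda>t. t\<^sup>2) has_real_derivative 2 * max 0 t) (at t)"
      using 1 by (auto intro!: derivative_eq_intros)
    then show ?thesis
      by (rule has_field_derivative_transform_within_open[where S="{0<..}"]) (use 1 in auto)
  next
    case 2
    have "((\<lambda>h. (max 0 h)\<^sup>2 / h) \<longlongrightarrow> 0) (at (0::real))"
    proof (rule Lim_null_comparison)
      show "\<forall>\<^sub>F h in at 0. norm ((max 0 h)\<^sup>2 / h) \<le> \<bar>h::real\<bar>"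
        by (rule always_eventually) (auto simp: max_def power2_eq_square)
      show "((\<lambda>h. \<bar>h\<bar>) \<longlongrightarrow> 0) (at (0::real))" by (intro tendsto_eq_intros) auto
    qed
    then show ?thesis using 2 by (simp add: DERIV_def)
  next
    case 3
    have "((\<lambda>t. 0) has_real_derivative 2 * max 0 t) (at t)" using 3 by simp
    then show ?thesis
      by (rule has_field_derivative_transform_within_open[where S="{..<0}"]) (use 3 in auto)
  qed
qed

text \<open>As a function of \<open>s = |x|\<^sup>2\<close> this is \<open>1 / |x|\<close>, regularized at the scale \<open>\<sigma>\<close> and cut off at the radius \<open>R\<close>.
  The square makes it continuously differentiable across \<open>s = R\<^sup>2\<close>, as the divergence theorem requires.\<close>

definition radial_weight :: "real \<Rightarrow> real \<Rightarrow> real \<Rightarrow> real" where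
  "radial_weight R \<sigma> s = (max 0 (1 - s / R\<^sup>2))\<^sup>2 / sqrt (s + \<sigma>\<^sup>2)"

definition radial_weight_deriv :: "real \<Rightarrow> real \<Rightarrow> real \<Rightarrow> real" where
  "radial_weight_deriv R \<sigma> s = - (2 / R\<^sup>2) * max 0 (1 - s / R\<^sup>2) / sqrt (s + \<sigma>\<^sup>2)
     - (max 0 (1 - s / R\<^sup>2))\<^sup>2 / (2 * (s + \<sigma>\<^sup>2) * sqrt (s + \<sigma>\<^sup>2))"

lemma radial_weight_has_derivative:
  assumes "\<sigma> > 0" "s \<ge> 0"
  shows "(radial_weight R \<sigma> has_real_derivative radial_weight_deriv R \<sigma> s) (at s)"
proof -
  have p: "s + \<sigma>\<^sup>2 > 0" using assms by (simp add: add_nonneg_pos)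
  have "((\<lambda>s. 1 - s / R\<^sup>2) has_real_derivative 0 - 1 / R\<^sup>2) (at s)"
    by (intro DERIV_diff DERIV_const DERIV_cdivide DERIV_ident)
  then have "((\<lambda>s. 1 - s / R\<^sup>2) has_real_derivative - (1 / R\<^sup>2)) (at s)" by simp
  from DERIV_chain2[OF max_0_power2_has_derivative this]
  have a: "((\<lambda>s. (max 0 (1 - s / R\<^sup>2))\<^sup>2) has_real_derivative 2 * max 0 (1 - s / R\<^sup>2) * (- (1 / R\<^sup>2))) (at s)" .
  have b: "((\<lambda>s. sqrt (s + \<sigma>\<^sup>2)) has_real_derivative 1 / (2 * sqrt (s + \<sigma>\<^sup>2))) (at s)"
    using p by (auto intro!: derivative_eq_intros simp: field_simps)
  have "((\<lambda>s. (max 0 (1 - s / R\<^sup>2))\<^sup>2 / sqrt (s + \<sigma>\<^sup>2)) has_real_derivative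
      (2 * max 0 (1 - s / R\<^sup>2) * (- (1 / R\<^sup>2)) * sqrt (s + \<sigma>\<^sup>2) - (max 0 (1 - s / R\<^sup>2))\<^sup>2 * (1 / (2 * sqrt (s + \<sigma>\<^sup>2))))
        / (sqrt (s + \<sigma>\<^sup>2) * sqrt (s + \<sigma>\<^sup>2))) (at s)"
    by (rule DERIV_divide[OF a b]) (use p in simp)
  then show ?thesis
    unfolding radial_weight_def[abs_def]
  proof (rule DERIV_cong)
    define q where "q = sqrt (s + \<sigma>\<^sup>2)"
    have q: "q > 0" "s + \<sigma>\<^sup>2 = q * q" using p by (simp_all add: q_def)
    show "(2 * max 0 (1 - s / R\<^sup>2) * (- (1 / R\<^sup>2)) * sqrt (s + \<sigma>\<^sup>2) - (max 0 (1 - s / R\<^sup>2))\<^sup>2 * (1 / (2 * sqrt (s + \<sigma>\<^sup>2))))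
        / (sqrt (s + \<sigma>\<^sup>2) * sqrt (s + \<sigma>\<^sup>2)) = radial_weight_deriv R \<sigma> s"
      unfolding radial_weight_deriv_def q_def[symmetric] q(2)
      using q(1) by (simp add: diff_divide_distrib)
  qed
qed

lemma radial_weight_nonneg: "s \<ge> 0 \<Longrightarrow> radial_weight R \<sigma> s \<ge> 0"
  by (simp add: radial_weight_def)

lemma radial_weight_deriv_nonpos: "s \<ge> 0 \<Longrightarrow> radial_weight_deriv R \<sigma> s \<le> 0"
proof -
  assume s: "s \<ge> 0"
  have "0 \<le> 2 / R\<^sup>2 * max 0 (1 - s / R\<^sup>2) / sqrt (s + \<sigma>\<^sup>2)"
    using s by simp
  moreover have "0 \<le> (max 0 (1 - s / R\<^sup>2))\<^sup>2 / (2 * (s + \<sigma>\<^sup>2) * sqrt (s + \<sigma>\<^sup>2))"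
    using s by simp
  ultimately show ?thesis unfolding radial_weight_deriv_def mult_minus_left minus_divide_left[symmetric] by linarith
qed

lemma radial_weight_outside:
  assumes "R > 0" "s \<ge> R\<^sup>2"
  shows "radial_weight R \<sigma> s = 0" "radial_weight_deriv R \<sigma> s = 0"
proof -
  have "max 0 (1 - s / R\<^sup>2) = 0" using assms by (simp add: max_def field_simps)
  then show "radial_weight R \<sigma> s = 0" "radial_weight_deriv R \<sigma> s = 0"
    by (simp_all add: radial_weight_def radial_weight_deriv_def)
qed

text \<open>For the weight \<open>1 / sqrt (s + \<sigma>\<^sup>2)\<close> without cutoff the left-hand side equals \<open>\<sigma>\<^sup>2 / (s + \<sigma>\<^sup>2) powr (3/2)\<close>,
  which is positive; the error term comes from the cutoff.\<close>

lemma radial_weight_combination: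
  assumes R: "R > 0" and \<sigma>: "\<sigma> > 0" and s: "s \<ge> 0"
  shows "radial_weight R \<sigma> s + 2 * s * radial_weight_deriv R \<sigma> s \<ge> - (4 / R) * (if s \<le> R\<^sup>2 then 1 else 0)"
proof (cases "s \<le> R\<^sup>2")
  case False
  then show ?thesis using radial_weight_outside[OF R, of s \<sigma>] by simp
next
  case True
  define q where "q = sqrt (s + \<sigma>\<^sup>2)"
  define \<kappa> where "\<kappa> = max 0 (1 - s / R\<^sup>2)"
  have p: "s + \<sigma>\<^sup>2 > 0" using \<sigma> s by (simp add: add_nonneg_pos)
  have q: "q > 0" "s + \<sigma>\<^sup>2 = q * q" using p by (simp_all add: q_def)
  have \<kappa>: "0 \<le> \<kappa>" "\<kappa> \<le> 1" using s R by (auto simp: \<kappa>_def)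
  have "\<kappa>\<^sup>2 / q - s * \<kappa>\<^sup>2 / (q * q * q) = (\<kappa>\<^sup>2 / (q * q * q)) * (q * q - s)"
    using q(1) by (simp add: field_simps)
  also have "\<dots> = (\<kappa>\<^sup>2 / (q * q * q)) * \<sigma>\<^sup>2" using q(2) by (metis add_diff_cancel_left')
  also have "\<dots> \<ge> 0" using q(1) by simp
  finally have A: "\<kappa>\<^sup>2 / q - s * \<kappa>\<^sup>2 / (q * q * q) \<ge> 0" .
  have "s \<le> R * q"
  proof -
    have r: "sqrt s \<le> R" using True R by (simp add: real_le_lsqrt)
    have "sqrt s \<le> q" by (simp add: q_def)
    then have "sqrt s * sqrt s \<le> R * q" using r R s by (intro mult_mono) auto
    then show ?thesis using s by simp
  qed
  then have "s / q \<le> R" using q(1) by (simp add: pos_divide_le_eq)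
  then have "\<kappa> * (s / q) \<le> 1 * R" using \<kappa> s q(1) R by (intro mult_mono) auto
  then have B: "4 / R\<^sup>2 * (\<kappa> * (s / q)) \<le> 4 / R"
    using R mult_left_mono[of "\<kappa> * (s / q)" R "4 / R\<^sup>2"] by (simp add: power2_eq_square)
  have "radial_weight R \<sigma> s + 2 * s * radial_weight_deriv R \<sigma> s =
      (\<kappa>\<^sup>2 / q - s * \<kappa>\<^sup>2 / (q * q * q)) - 4 / R\<^sup>2 * (\<kappa> * (s / q))"
    unfolding radial_weight_def radial_weight_deriv_def q_def[symmetric] \<kappa>_def[symmetric] q(2)
    using q(1) R by (simp add: field_simps)
  then show ?thesis using A B True by simp
qed

lemma radial_weight_lower_bound:
  assumes \<sigma>: "\<sigma> > 0" "2 * \<sigma> \<le> R" and s: "0 \<le> s" "s \<le> \<sigma>\<^sup>2"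
  shows "radial_weight R \<sigma> s \<ge> 3 / (8 * \<sigma>)"
proof -
  have R: "R > 0" using \<sigma> by simp
  have "\<sigma>\<^sup>2 \<le> (R / 2)\<^sup>2" by (rule power_mono) (use \<sigma> in auto)
  then have "s \<le> (R / 2)\<^sup>2" using s(2) by (rule order_trans[rotated])
  then have "s / R\<^sup>2 \<le> 1 / 4" using R by (simp add: power_divide pos_divide_le_eq)
  then have "3 / 4 \<le> max 0 (1 - s / R\<^sup>2)" by linarith
  then have \<kappa>: "(3 / 4)\<^sup>2 \<le> (max 0 (1 - s / R\<^sup>2))\<^sup>2" by (rule power_mono) simp
  have "(3 / 2 * \<sigma>)\<^sup>2 = 9 / 4 * \<sigma>\<^sup>2" by (simp add: power2_eq_square)
  moreover have "0 \<le> \<sigma>\<^sup>2" by simp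
  ultimately have "s + \<sigma>\<^sup>2 \<le> (3 / 2 * \<sigma>)\<^sup>2" using s(2) by linarith
  then have "sqrt (s + \<sigma>\<^sup>2) \<le> 3 / 2 * \<sigma>" using \<sigma> by (intro real_le_lsqrt) auto
  moreover have "sqrt (s + \<sigma>\<^sup>2) > 0" using \<sigma> s by (simp add: add_nonneg_pos)
  ultimately have "(3 / 4)\<^sup>2 / (3 / 2 * \<sigma>) \<le> radial_weight R \<sigma> s"
    unfolding radial_weight_def by (intro frac_le \<kappa>) auto
  then show ?thesis by (simp add: power2_eq_square field_simps)
qed

definition energy_density ::
  "real \<Rightarrow> ('b::euclidean_space \<Rightarrow> real) \<Rightarrow> ('a::euclidean_space \<Rightarrow> 'b) \<Rightarrow> 'a \<Rightarrow> real" where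
  "energy_density L W u x = (\<Sum>i\<in>Basis. (norm (pd i u x))\<^sup>2) / 2 + W (u x) / L"

lemma pd_as_basis_sum:
  fixes u :: "'a::euclidean_space \<Rightarrow> 'b::real_normed_vector"
  assumes "smooth_on U u" "x \<in> U"
  shows "pd v u x = (\<Sum>i\<in>Basis. (v \<bullet> i) *\<^sub>R pd i u x)"
proof -
  have lin: "linear (frechet_derivative u (at x))"
    using has_derivative_linear[OF smooth_on_has_derivative[OF assms]] .
  have "pd v u x = frechet_derivative u (at x) (\<Sum>i\<in>Basis. (v \<bullet> i) *\<^sub>R i)" by (simp add: euclidean_representation)
  then show ?thesis by (simp add: linear_sum[OF lin] linear_scale[OF lin])
qed

text \<open>The Euler-Lagrange equation makes the stress tensor \<open>T\<^sub>i\<^sub>j = e \<delta>\<^sub>i\<^sub>j - \<partial>\<^sub>iu \<bullet> \<partial>\<^sub>ju\<close> divergence free.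
  Its contraction with the field \<open>h(|y|\<^sup>2) y\<close>, where \<open>y = x - x\<^sub>0\<close> and \<open>h\<close> is the radial weight, therefore has
  divergence \<open>h (3e - |\<nabla>u|\<^sup>2) + 2h' (|y|\<^sup>2 e - |\<partial>\<^sub>yu|\<^sup>2)\<close>, which integrates to zero. In dimension three
  \<open>3e - |\<nabla>u|\<^sup>2 = e + 2W/L\<close>, and \<open>h\<close> was chosen such that \<open>h + 2 |y|\<^sup>2 h'\<close> is bounded below by \<open>- 4/R\<close> while \<open>h\<close> is
  of order \<open>1/\<sigma>\<close> on the small ball.\<close>

lemma bulk_monotonicity:
  fixes u :: "'a::euclidean_space \<Rightarrow> 'b::euclidean_space"
  assumes dim: "DIM('a) = 3"
    and u: "smooth_on \<Omega> u" and L: "L > 0"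
    and W: "\<And>Q. (W has_derivative DW Q) (at Q)" and DWc: "continuous_on UNIV (\<lambda>(Q, H). DW Q H)"
    and Wnn: "\<And>x. x \<in> \<Omega> \<Longrightarrow> W (u x) \<ge> 0"
    and EL: "\<And>x i. x \<in> \<Omega> \<Longrightarrow> i \<in> Basis \<Longrightarrow> L * (laplacian u x \<bullet> pd i u x) = DW (u x) (pd i u x)"
    and \<sigma>: "\<sigma> > 0" "2 * \<sigma> \<le> R" and ball: "cball x0 R \<subseteq> \<Omega>"
  shows "(LINT x|lebesgue_on (cball x0 \<sigma>). W (u x) / L) \<le>
    6 * \<sigma> / R * (LINT x|lebesgue_on (cball x0 R). energy_density L W u x)"
proof -
  have R: "R > 0" using \<sigma> by simp
  note o = smooth_on_open[OF u]
  define e where "e x = energy_density L W u x" for x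
  define e' where "e' x v = (\<Sum>j\<in>Basis. pd j u x \<bullet> pd v (pd j u) x) + DW (u x) (pd v u x) / L" for x v
  define h where "h x = radial_weight R \<sigma> ((x - x0) \<bullet> (x - x0))" for x
  define k where "k x = radial_weight_deriv R \<sigma> ((x - x0) \<bullet> (x - x0))" for x
  define E where "E i x = e x * ((x - x0) \<bullet> i) - (\<Sum>j\<in>Basis. ((x - x0) \<bullet> j) * (pd i u x \<bullet> pd j u x))" for i x
  define E' where "E' i x v = (e x * (v \<bullet> i) + e' x v * ((x - x0) \<bullet> i)) -
      (\<Sum>j\<in>Basis. ((x - x0) \<bullet> j) * (pd i u x \<bullet> pd v (pd j u) x + pd v (pd i u) x \<bullet> pd j u x) + (v \<bullet> j) * (pd i u x \<bullet> pd j u x))" for i x v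
  have Wc: "continuous_on UNIV W" by (rule has_derivative_continuous_on, rule has_derivative_at_withinI, rule W)
  have ud: "(u has_derivative (\<lambda>v. pd v u x)) (at x)" if "x \<in> \<Omega>" for x
    using smooth_on_has_derivative[OF u that] .
  have ud2: "(pd j u has_derivative (\<lambda>v. pd v (pd j u) x)) (at x)" if "x \<in> \<Omega>" "j \<in> Basis" for x j
    using smooth_on_has_derivative[OF smooth_on_pd[OF u that(2)] that(1)] .
  have ed: "(e has_derivative e' x) (at x)" if x: "x \<in> \<Omega>" for x
  proof -
    have "((\<lambda>x. (1 / 2) * (\<Sum>j\<in>Basis. pd j u x \<bullet> pd j u x) + (1 / L) * W (u x)) has_derivative
        (\<lambda>v. (1 / 2) * (\<Sum>j\<in>Basis. pd j u x \<bullet> pd v (pd j u) x + pd v (pd j u) x \<bullet> pd j u x) + (1 / L) * DW (u x) (pd v u x))) (at x)"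
      by (intro has_derivative_add has_derivative_mult_right has_derivative_sum has_derivative_inner
          has_derivative_compose[OF ud[OF x] W] ud2[OF x])
    moreover have "(1 / 2) * (\<Sum>j\<in>Basis. pd j u x \<bullet> pd v (pd j u) x + pd v (pd j u) x \<bullet> pd j u x)
        = (\<Sum>j\<in>Basis. pd j u x \<bullet> pd v (pd j u) x)" for v
      unfolding sum_distrib_left by (intro sum.cong refl) (simp add: inner_commute)
    ultimately show ?thesis
      by (simp add: e_def[abs_def] energy_density_def e'_def[abs_def] power2_norm_eq_inner)
  qed
  have yd: "((\<lambda>x. (x - x0) \<bullet> w) has_derivative (\<lambda>v. v \<bullet> w)) (at x)" for x w :: 'a
    by (auto intro!: derivative_eq_intros)
  have Ed: "(E i has_derivative E' i x) (at x)" if x: "x \<in> \<Omega>" and i: "i \<in> Basis" for x i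
    unfolding E_def[abs_def] E'_def[abs_def]
    by (intro has_derivative_diff has_derivative_mult has_derivative_sum has_derivative_inner ed[OF x] yd ud2[OF x] i)
  have hd: "(h has_derivative (\<lambda>v. k x * (2 * ((x - x0) \<bullet> v)))) (at x)" for x
  proof -
    have s: "((\<lambda>x. (x - x0) \<bullet> (x - x0)) has_derivative (\<lambda>v. 2 * ((x - x0) \<bullet> v))) (at x)"
      by (auto intro!: derivative_eq_intros simp: inner_commute)
    show ?thesis
      unfolding h_def[abs_def] k_def
      using has_derivative_compose[OF s radial_weight_has_derivative[OF \<sigma>(1), unfolded has_field_derivative_def]]
      by simp
  qed
  \<comment> \<open>the derivative of the \<open>i\<close>-th component \<open>h * E i\<close> of the field; \<open>k\<close> is \<open>h'\<close>\<close>
  define F' where "F' i x v = h x * E' i x v + k x * (2 * ((x - x0) \<bullet> v)) * E i x" for i x v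
  have Fd: "((\<lambda>x. h x * E i x) has_derivative F' i x) (at x)" if "x \<in> \<Omega>" "i \<in> Basis" for x i
    unfolding F'_def[abs_def] by (rule has_derivative_mult[OF hd Ed[OF that]])
  have hc: "continuous_on S h" for S
    by (rule has_derivative_continuous_on, rule has_derivative_at_withinI, rule hd)
  have kc: "continuous_on S k" for S
  proof -
    have p: "(x - x0) \<bullet> (x - x0) + \<sigma>\<^sup>2 > 0" for x using \<sigma> by (simp add: add_nonneg_pos)
    have q: "sqrt ((x - x0) \<bullet> (x - x0) + \<sigma>\<^sup>2) \<noteq> 0"
      "2 * ((x - x0) \<bullet> (x - x0) + \<sigma>\<^sup>2) * sqrt ((x - x0) \<bullet> (x - x0) + \<sigma>\<^sup>2) \<noteq> 0" for x
      using p[of x] by auto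
    show ?thesis
      unfolding k_def radial_weight_deriv_def
      by (intro continuous_on_diff continuous_on_divide continuous_on_mult continuous_on_const
          continuous_on_max continuous_on_power continuous_on_inner continuous_on_id continuous_on_add
          continuous_on_real_sqrt ballI q) (use R in auto)
  qed
  have uc1: "continuous_on \<Omega> u" by (rule smooth_on_continuous_on[OF u])
  have uc2: "continuous_on \<Omega> (pd j u)" if "j \<in> Basis" for j
    by (rule smooth_on_continuous_on[OF smooth_on_pd[OF u that]])
  have uc3: "continuous_on \<Omega> (pd v (pd j u))" if "j \<in> Basis" "v \<in> Basis" for j v
    by (rule smooth_on_continuous_on[OF smooth_on_pd[OF smooth_on_pd[OF u that(1)] that(2)]])
  have ec: "continuous_on \<Omega> e"
    by (rule has_derivative_continuous_on, rule has_derivative_at_withinI, rule ed)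
  have e'c: "continuous_on \<Omega> (\<lambda>x. e' x v)" if v: "v \<in> Basis" for v
  proof -
    have "continuous_on \<Omega> (\<lambda>x. (u x, pd v u x))" by (intro continuous_intros uc1 uc2 v)
    from continuous_on_compose2[OF DWc this] have "continuous_on \<Omega> (\<lambda>x. DW (u x) (pd v u x))" by simp
    then show ?thesis unfolding e'_def using L v by (intro continuous_intros uc2 uc3) auto
  qed
  have F'c: "continuous_on \<Omega> (\<lambda>x. F' i x i)" if i: "i \<in> Basis" for i
    unfolding F'_def E_def E'_def
    by (intro continuous_intros hc kc ec e'c uc2 uc3 i)
  have zero: "h x * E i x = 0" if "x \<notin> cball x0 R" for x i
  proof -
    have "R\<^sup>2 \<le> (norm (x - x0))\<^sup>2" using that R by (intro power_mono) (auto simp: dist_norm norm_minus_commute)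
    then show ?thesis using radial_weight_outside[OF R] by (simp add: h_def power2_norm_eq_inner)
  qed
  have F'int: "integrable (lebesgue_on \<Omega>) (\<lambda>x. F' i x i)" "(LINT x|lebesgue_on \<Omega>. F' i x i) = 0" if i: "i \<in> Basis" for i
    using integral_derivative_compact_support[OF o compact_cball ball Fd[OF _ i] F'c[OF i] zero] by auto
  define dF where "dF x = (\<Sum>i\<in>Basis. F' i x i)" for x
  have dF0: "(LINT x|lebesgue_on \<Omega>. dF x) = 0" "integrable (lebesgue_on \<Omega>) dF"
    unfolding dF_def using F'int by simp_all
  have ineq: "3 / (4 * \<sigma>) * (indicator (cball x0 \<sigma>) x *\<^sub>R (W (u x) / L)) \<le> dF x + 4 / R * (indicator (cball x0 R) x *\<^sub>R e x)"
    if x: "x \<in> \<Omega>" for x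
  proof -
    define y where "y = x - x0"
    define s where "s = y \<bullet> y"
    have s0: "s \<ge> 0" by (simp add: s_def)
    define D where "D = (\<Sum>i\<in>Basis. (norm (pd i u x))\<^sup>2)"
    define Y where "Y = (\<Sum>j\<in>Basis. (y \<bullet> j) *\<^sub>R pd j u x)"
    have sumEi: "(\<Sum>i\<in>Basis. E' i x i) = 3 * e x - D"
    proof -
      have "(\<Sum>i\<in>Basis. E' i x i) = (\<Sum>i\<in>(Basis :: 'a set). e x * (i \<bullet> i)) + (\<Sum>i\<in>Basis. e' x i * (y \<bullet> i))
          - (\<Sum>i\<in>Basis. \<Sum>j\<in>Basis. (y \<bullet> j) * (pd i u x \<bullet> pd i (pd j u) x))
          - (\<Sum>i\<in>Basis. \<Sum>j\<in>Basis. (y \<bullet> j) * (pd i (pd i u) x \<bullet> pd j u x))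
          - (\<Sum>i\<in>Basis. \<Sum>j\<in>Basis. (i \<bullet> j) * (pd i u x \<bullet> pd j u x))"
        by (simp add: E'_def y_def sum.distrib sum_subtractf distrib_left)
      moreover have "(\<Sum>i\<in>(Basis :: 'a set). e x * (i \<bullet> i)) = 3 * e x"
        using dim by (simp add: inner_same_Basis)
      moreover have "(\<Sum>i\<in>Basis. \<Sum>j\<in>Basis. (i \<bullet> j) * (pd i u x \<bullet> pd j u x)) = D"
      proof -
        have "(\<Sum>j\<in>Basis. (i \<bullet> j) * (pd i u x \<bullet> pd j u x)) = (norm (pd i u x))\<^sup>2" if "i \<in> Basis" for i
          using that by (simp add: inner_Basis if_distrib[of "\<lambda>t. t * _"] sum.delta' power2_norm_eq_inner cong: if_cong)
        then show ?thesis by (simp add: D_def)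
      qed
      moreover have "(\<Sum>i\<in>Basis. e' x i * (y \<bullet> i)) =
          (\<Sum>i\<in>Basis. \<Sum>j\<in>Basis. (y \<bullet> j) * (pd i u x \<bullet> pd i (pd j u) x))
          + (\<Sum>i\<in>Basis. \<Sum>j\<in>Basis. (y \<bullet> j) * (pd i (pd i u) x \<bullet> pd j u x))"
      proof -
        have "(\<Sum>i\<in>Basis. e' x i * (y \<bullet> i)) = (\<Sum>i\<in>Basis. \<Sum>j\<in>Basis. (y \<bullet> i) * (pd j u x \<bullet> pd i (pd j u) x))
            + (\<Sum>i\<in>Basis. (y \<bullet> i) * (DW (u x) (pd i u x) / L))"
        proof -
          have "e' x i * (y \<bullet> i) = (\<Sum>j\<in>Basis. (y \<bullet> i) * (pd j u x \<bullet> pd i (pd j u) x))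
              + (y \<bullet> i) * (DW (u x) (pd i u x) / L)" for i
            by (simp only: e'_def mult.commute[of _ "y \<bullet> i"] distrib_left sum_distrib_left)
          then show ?thesis by (simp only: sum.distrib)
        qed
        also have "(\<Sum>i\<in>Basis. \<Sum>j\<in>Basis. (y \<bullet> i) * (pd j u x \<bullet> pd i (pd j u) x))
            = (\<Sum>j\<in>Basis. \<Sum>i\<in>Basis. (y \<bullet> i) * (pd j u x \<bullet> pd j (pd i u) x))"
          by (subst sum.swap) (intro sum.cong refl, simp add: pd_commute[OF u x])
        also have "(\<Sum>i\<in>Basis. (y \<bullet> i) * (DW (u x) (pd i u x) / L))
            = (\<Sum>j\<in>Basis. (y \<bullet> j) * (laplacian u x \<bullet> pd j u x))"
          by (rule sum.cong) (use EL[OF x] L in \<open>auto simp: field_simps\<close>)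
        also have "\<dots> = (\<Sum>i\<in>Basis. \<Sum>j\<in>Basis. (y \<bullet> j) * (pd i (pd i u) x \<bullet> pd j u x))"
          by (subst sum.swap) (simp add: laplacian_def inner_sum_left sum_distrib_left)
        finally show ?thesis .
      qed
      ultimately show ?thesis by simp
    qed
    have sumyE: "(\<Sum>i\<in>Basis. (y \<bullet> i) * E i x) = s * e x - (norm Y)\<^sup>2"
    proof -
      have "(\<Sum>i\<in>Basis. (y \<bullet> i) * E i x) = (\<Sum>i\<in>Basis. (y \<bullet> i) * (y \<bullet> i)) * e x
          - (\<Sum>i\<in>Basis. \<Sum>j\<in>Basis. (y \<bullet> i) * ((y \<bullet> j) * (pd i u x \<bullet> pd j u x)))"
        by (simp add: E_def y_def right_diff_distrib sum_subtractf sum_distrib_left sum_distrib_right mult_ac)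
      moreover have "(\<Sum>i\<in>Basis. (y \<bullet> i) * (y \<bullet> i)) = s" unfolding s_def by (rule euclidean_inner[symmetric])
      moreover have "(norm Y)\<^sup>2 = (\<Sum>i\<in>Basis. \<Sum>j\<in>Basis. (y \<bullet> i) * ((y \<bullet> j) * (pd i u x \<bullet> pd j u x)))"
        by (simp add: Y_def power2_norm_eq_inner inner_sum_left inner_sum_right sum_distrib_left)
          (intro sum.cong refl, simp add: inner_commute)
      ultimately show ?thesis by simp
    qed
    have "dF x = h x * (\<Sum>i\<in>Basis. E' i x i) + 2 * k x * (\<Sum>i\<in>Basis. (y \<bullet> i) * E i x)"
      by (simp add: dF_def F'_def y_def sum.distrib sum_distrib_left mult_ac)
    also have "\<dots> = (h x + 2 * s * k x) * e x + h x * (2 * (W (u x) / L)) - 2 * k x * (norm Y)\<^sup>2"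
    proof -
      have Deq: "D = 2 * e x - 2 * (W (u x) / L)" by (simp add: D_def e_def energy_density_def)
      show ?thesis unfolding sumEi sumyE Deq by (simp add: algebra_simps)
    qed
    finally have dFx: "dF x = (h x + 2 * s * k x) * e x + h x * (2 * (W (u x) / L)) - 2 * k x * (norm Y)\<^sup>2" .
    have WL: "W (u x) / L \<ge> 0" using Wnn[OF x] L by simp
    have e0: "e x \<ge> 0" using WL by (simp add: e_def energy_density_def sum_nonneg)
    have hs: "h x = radial_weight R \<sigma> s" "k x = radial_weight_deriv R \<sigma> s" by (simp_all add: h_def k_def s_def y_def)
    have k0: "- 2 * k x * (norm Y)\<^sup>2 \<ge> 0"
    proof -
      have "- 2 * k x \<ge> 0" using radial_weight_deriv_nonpos[OF s0, of R \<sigma>] by (simp add: hs)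
      then show ?thesis by (rule mult_nonneg_nonneg) simp
    qed
    have snorm: "s = (norm (x - x0))\<^sup>2" by (simp add: s_def y_def power2_norm_eq_inner)
    have in_ball: "s \<le> r\<^sup>2 \<longleftrightarrow> x \<in> cball x0 r" if "r > 0" for r
      using that by (simp add: snorm dist_norm norm_minus_commute abs_le_square_iff[symmetric])
    have comb: "(h x + 2 * s * k x) * e x \<ge> - (4 / R * (indicator (cball x0 R) x *\<^sub>R e x))"
    proof -
      have "(if s \<le> R\<^sup>2 then 1 else 0) = indicat_real (cball x0 R) x" using in_ball[OF R] by (simp add: indicator_def)
      with mult_right_mono[OF radial_weight_combination[OF R \<sigma>(1) s0] e0] show ?thesis
        unfolding hs by (simp add: mult.assoc)
    qed
    have lower: "3 / (4 * \<sigma>) * (indicator (cball x0 \<sigma>) x *\<^sub>R (W (u x) / L)) \<le> h x * (2 * (W (u x) / L))"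
    proof (cases "x \<in> cball x0 \<sigma>")
      case True
      then have "s \<le> \<sigma>\<^sup>2" using in_ball[OF \<sigma>(1)] by simp
      from radial_weight_lower_bound[OF \<sigma> s0 this] have "3 / (8 * \<sigma>) \<le> h x" by (simp add: hs)
      from mult_right_mono[OF this, of "2 * (W (u x) / L)"] WL True \<sigma>(1)
      show ?thesis by (simp add: field_simps)
    next
      case False
      have "0 \<le> h x" using radial_weight_nonneg[OF s0] by (simp add: hs)
      moreover have "0 \<le> 2 * (W (u x) / L)" using WL by linarith
      ultimately have "0 \<le> h x * (2 * (W (u x) / L))" by (rule mult_nonneg_nonneg)
      moreover have "indicat_real (cball x0 \<sigma>) x = 0" using False by simp
      ultimately show ?thesis by (simp only: scaleR_zero_left mult_zero_right)
    qed
    show ?thesis using dFx k0 comb lower by linarith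
  qed
  have sub: "cball x0 \<sigma> \<subseteq> cball x0 R" using \<sigma> R by (intro subset_cball) simp
  have Wint: "integrable (lebesgue_on (cball x0 \<sigma>)) (\<lambda>x. W (u x) / L)"
  proof -
    have "continuous_on \<Omega> (\<lambda>x. W (u x) / L)"
      using continuous_on_compose2[OF Wc smooth_on_continuous_on[OF u]] L by (auto intro!: continuous_on_divide)
    from locally_integrable_continuous[OF this] show ?thesis
      using ball sub unfolding locally_integrable_on_def by auto
  qed
  have eint: "integrable (lebesgue_on (cball x0 R)) e"
    using locally_integrable_continuous[OF ec] ball unfolding locally_integrable_on_def by auto
  have ind: "integrable (lebesgue_on \<Omega>) (\<lambda>x. indicator B x *\<^sub>R f x)"
    "(LINT x|lebesgue_on \<Omega>. indicator B x *\<^sub>R f x) = (LINT x|lebesgue_on B. f x)"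
    if "integrable (lebesgue_on B) f" "B \<subseteq> \<Omega>" "closed B" for B and f :: "'a \<Rightarrow> real"
  proof -
    have eq: "indicator \<Omega> x *\<^sub>R (indicator B x *\<^sub>R f x) = indicator B x *\<^sub>R f x" for x
      using that(2) by (auto simp: indicator_def)
    have B: "B \<inter> space lebesgue \<in> sets lebesgue" using that(3) by simp
    show "integrable (lebesgue_on \<Omega>) (\<lambda>x. indicator B x *\<^sub>R f x)"
      using that(1) unfolding integrable_restrict_space[OF space_lebesgue_inter[OF o]] integrable_restrict_space[OF B] eq .
    show "(LINT x|lebesgue_on \<Omega>. indicator B x *\<^sub>R f x) = (LINT x|lebesgue_on B. f x)"
      unfolding integral_restrict_space[OF space_lebesgue_inter[OF o]] integral_restrict_space[OF B] eq ..
  qed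
  note iW = ind[OF Wint subset_trans[OF sub ball] closed_cball] and ie = ind[OF eint ball closed_cball]
  have "3 / (4 * \<sigma>) * (LINT x|lebesgue_on (cball x0 \<sigma>). W (u x) / L)
      = (LINT x|lebesgue_on \<Omega>. 3 / (4 * \<sigma>) * (indicator (cball x0 \<sigma>) x *\<^sub>R (W (u x) / L)))"
    unfolding iW(2)[symmetric] by (rule integral_mult_right_zero[symmetric])
  also have "\<dots> \<le> (LINT x|lebesgue_on \<Omega>. dF x + 4 / R * (indicator (cball x0 R) x *\<^sub>R e x))"
    by (intro integral_mono Bochner_Integration.integrable_add integrable_mult_right iW(1) ie(1) dF0(2) ineq) simp
  also have "\<dots> = 4 / R * (LINT x|lebesgue_on (cball x0 R). e x)"
    unfolding Bochner_Integration.integral_add[OF dF0(2) integrable_mult_right[OF ie(1)]]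
    by (simp only: dF0(1) integral_mult_right_zero ie(2) add_0)
  finally have fin: "3 / (4 * \<sigma>) * (LINT x|lebesgue_on (cball x0 \<sigma>). W (u x) / L) \<le> 4 / R * (LINT x|lebesgue_on (cball x0 R). e x)" .
  have e0: "0 \<le> (LINT x|lebesgue_on (cball x0 R). e x)"
  proof (rule integral_nonneg_AE, rule AE_I2)
    fix x assume "x \<in> space (lebesgue_on (cball x0 R))"
    then have "x \<in> \<Omega>" using ball by auto
    then show "0 \<le> e x" using Wnn L by (simp add: e_def energy_density_def sum_nonneg)
  qed
  have "(LINT x|lebesgue_on (cball x0 \<sigma>). W (u x) / L) \<le> 16 / 3 * \<sigma> / R * (LINT x|lebesgue_on (cball x0 R). e x)"
    using mult_left_mono[OF fin, of "4 * \<sigma> / 3"] \<sigma> by simp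
  also have "\<dots> \<le> 6 * \<sigma> / R * (LINT x|lebesgue_on (cball x0 R). e x)"
    using \<sigma> R e0 by (intro mult_right_mono divide_right_mono) auto
  finally show ?thesis by (simp add: e_def)
qed

section \<open>The Euler-Lagrange equation\<close>

lemma integral_eq_integral_cbox:
  fixes f :: "'a::euclidean_space \<Rightarrow> real"
  assumes "open \<Omega>" "cbox lo hi \<subseteq> \<Omega>" "continuous_on \<Omega> f" "\<And>x. x \<in> \<Omega> \<Longrightarrow> x \<notin> cbox lo hi \<Longrightarrow> f x = 0"
  shows "integrable (lebesgue_on \<Omega>) f" "(LINT x|lebesgue_on \<Omega>. f x) = integral (cbox lo hi) f"
proof -
  have eq: "indicator \<Omega> x *\<^sub>R f x = indicator (cbox lo hi) x *\<^sub>R f x" for x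
    using assms(2,4) by (auto simp: indicator_def)
  have i: "integrable (lebesgue_on (cbox lo hi)) f"
    using locally_integrable_continuous[OF assms(3)] assms(2) by (simp add: locally_integrable_on_def)
  have c: "cbox lo hi \<inter> space lebesgue \<in> sets lebesgue" by simp
  show "integrable (lebesgue_on \<Omega>) f"
    using i unfolding integrable_restrict_space[OF space_lebesgue_inter[OF assms(1)]] integrable_restrict_space[OF c] eq .
  have "(LINT x|lebesgue_on \<Omega>. f x) = (LINT x|lebesgue_on (cbox lo hi). f x)"
    unfolding integral_restrict_space[OF space_lebesgue_inter[OF assms(1)]] integral_restrict_space[OF c] eq ..
  then show "(LINT x|lebesgue_on \<Omega>. f x) = integral (cbox lo hi) f"
    using lebesgue_integral_eq_integral[OF i] by simp
qed

lemma weak_grad_sq_smooth_AE: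
  fixes u :: "'a::euclidean_space \<Rightarrow> 'b::euclidean_space"
  assumes "smooth_on \<Omega> u"
  shows "AE x in lebesgue_on \<Omega>. weak_grad_sq \<Omega> u x = (\<Sum>i\<in>Basis. (norm (pd i u x))\<^sup>2)"
  by (rule weak_grad_sq_AE_eq[OF smooth_on_open[OF assms] has_weak_deriv_smooth[OF assms]])

text \<open>The energy of \<open>u + t \<psi> B\<close> differs from that of \<open>u\<close> by an integral over the box that supports the bump \<open>\<psi>\<close>.
  The integrand is smooth in \<open>t\<close> and continuous up to the boundary of the box, so it may be differentiated
  under the integral, and the derivative vanishes at the minimum \<open>t = 0\<close>.\<close>

lemma first_variation_zero:
  fixes u :: "real^3 \<Rightarrow> real^3^3"
  assumes c: "c\<^sup>2 > 0" and L: "L > 0"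
    and min: "is_arg_min (F_LG a b c \<Omega> L) (\<lambda>P. P \<in> admissible_Q \<Omega> Qb) u"
    and u: "smooth_on \<Omega> u" and uS: "\<And>x. x \<in> \<Omega> \<Longrightarrow> u x \<in> S0"
    and i: "integrable (lebesgue_on \<Omega>) (\<lambda>x. f_B_tilde a b c (u x))"
    and B: "B \<in> S0" and box: "cbox lo hi \<subseteq> \<Omega>"
  defines "\<psi> \<equiv> box_bump lo hi"
  shows "integral (cbox lo hi) (\<lambda>x. L * (\<Sum>i\<in>Basis. pd i \<psi> x * (pd i u x \<bullet> B)) + \<psi> x * bulk_deriv a b c (u x) B) = 0"
proof -
  note o = smooth_on_open[OF u]
  have s\<psi>: "smooth_on UNIV \<psi>" unfolding \<psi>_def by (rule smooth_on_box_bump)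
  have t\<psi>: "test_function \<Omega> \<psi>" unfolding \<psi>_def by (rule test_function_box_bump[OF box])
  have z: "\<psi> x = 0" if "x \<notin> cbox lo hi" for x
    unfolding \<psi>_def by (rule box_bump_eq_0_cbox[OF that])
  have off: "\<psi> x = 0" "pd v \<psi> x = 0" if "x \<notin> cbox lo hi" for x v
    by (rule z[OF that], rule pd_eq_0_outside_closed[OF closed_cbox z that])
  have cont: "continuous_on T \<psi>" "v \<in> Basis \<Longrightarrow> continuous_on T (pd v \<psi>)" for T v
    using continuous_on_subset[OF smooth_on_continuous_on[OF s\<psi>]]
      continuous_on_subset[OF smooth_on_continuous_on[OF smooth_on_pd[OF s\<psi>]]] by auto
  have uc: "continuous_on \<Omega> u" by (rule smooth_on_continuous_on[OF u])
  have u'c: "continuous_on \<Omega> (pd v u)" if "v \<in> Basis" for v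
    by (rule smooth_on_continuous_on[OF smooth_on_pd[OF u that]])
  define P where "P t x = u x + (t * \<psi> x) *\<^sub>R B" for t x
  define g where "g t x = (\<Sum>i\<in>Basis. (norm (pd i u x + (t * pd i \<psi> x) *\<^sub>R B))\<^sup>2) - (\<Sum>i\<in>Basis. (norm (pd i u x))\<^sup>2)" for t x
  define w where "w t x = bulk a b c (P t x) - bulk a b c (u x)" for t x
  have t\<phi>: "test_function \<Omega> (\<lambda>x. (t * \<psi> x) *\<^sub>R B)" for t
    using t\<psi> smooth_on_bounded_linear[OF bounded_linear_scaleR_left[of B] smooth_on_bounded_linear[OF bounded_linear_mult_right[of t] s\<psi>]]
    unfolding test_function_def by auto
  have adm: "P t \<in> admissible_Q \<Omega> Qb" for t
    unfolding P_def
  proof (rule admissible_Q_add_test_function[OF o _ t\<phi>])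
    show "u \<in> admissible_Q \<Omega> Qb" using min by (simp add: is_arg_min_def)
    show "(t * \<psi> x) *\<^sub>R B \<in> S0" for x by (rule subspace_scale[OF subspace_S0 B])
  qed
  have PS: "P t x \<in> S0" if "x \<in> \<Omega>" for t x
    unfolding P_def by (intro subspace_add[OF subspace_S0] subspace_scale[OF subspace_S0] B uS that)
  have sP: "smooth_on \<Omega> (P t)" for t
    unfolding P_def
    by (rule smooth_on_add[OF u smooth_on_subset[OF test_function_smooth[OF t\<phi>] o]]) simp
  have pdP: "pd v (P t) x = pd v u x + (t * pd v \<psi> x) *\<^sub>R B" if "x \<in> \<Omega>" for v t x
  proof -
    have "(P t has_derivative (\<lambda>v. pd v u x + (t * pd v \<psi> x) *\<^sub>R B)) (at x)"
      unfolding P_def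
      by (intro has_derivative_add has_derivative_scaleR_left has_derivative_mult_right
          smooth_on_has_derivative[OF u that] smooth_on_has_derivative[OF s\<psi> UNIV_I])
    from fun_cong[OF frechet_derivative_at[OF this], of v] show ?thesis by simp
  qed
  have gc: "continuous_on \<Omega> (g t)" for t
    unfolding g_def by (intro continuous_intros u'c cont)
  have wc: "continuous_on \<Omega> (w t)" for t
  proof -
    have "continuous_on \<Omega> (P t)" unfolding P_def by (intro continuous_intros uc cont)
    then show ?thesis unfolding w_def
      by (intro continuous_on_diff continuous_on_compose2[OF continuous_on_bulk[of UNIV]] uc) auto
  qed
  have goff: "g t x = 0" if "x \<notin> cbox lo hi" for t x using off[OF that] by (simp add: g_def)
  have woff: "w t x = 0" if "x \<notin> cbox lo hi" for t x using off[OF that] by (simp add: w_def P_def)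
  note ig = integral_eq_integral_cbox[OF o box gc goff] and iw = integral_eq_integral_cbox[OF o box wc woff]
  define d where "d t x = L / 2 * g t x + w t x" for t x
  have dint: "d t integrable_on cbox lo hi" for t
    unfolding d_def using continuous_on_subset[OF gc box] continuous_on_subset[OF wc box]
    by (intro integrable_continuous continuous_intros)
  have nonneg: "0 \<le> integral (cbox lo hi) (d t)" for t
  proof -
    have fP: "f_B_tilde a b c (P t x) = f_B_tilde a b c (u x) + w t x" if "x \<in> \<Omega>" for x
      using f_B_tilde_eq_bulk[OF PS[OF that], of a b c] f_B_tilde_eq_bulk[OF uS[OF that], of a b c]
      by (simp add: w_def)
    have iP: "integrable (lebesgue_on \<Omega>) (\<lambda>x. f_B_tilde a b c (P t x))"
      using Bochner_Integration.integrable_add[OF i iw(1)[of t]]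
      by (rule Bochner_Integration.integrable_cong[THEN iffD1, rotated 2]) (use fP in auto)
    have "(LINT x|lebesgue_on \<Omega>. f_B_tilde a b c (P t x)) = (LINT x|lebesgue_on \<Omega>. f_B_tilde a b c (u x) + w t x)"
      by (rule Bochner_Integration.integral_cong) (use fP in auto)
    then have e1: "(LINT x|lebesgue_on \<Omega>. f_B_tilde a b c (P t x))
        = (LINT x|lebesgue_on \<Omega>. f_B_tilde a b c (u x)) + integral (cbox lo hi) (w t)"
      using i iw[of t] by simp
    have W: "u \<in> W12 \<Omega> S0" "P t \<in> W12 \<Omega> S0" using min adm[of t] by (auto simp: is_arg_min_def admissible_Q_def)
    note iu = integrable_weak_grad_sq[OF o W(1)] and iPg = integrable_weak_grad_sq[OF o W(2)]
    have "AE x in lebesgue_on \<Omega>. weak_grad_sq \<Omega> (P t) x = weak_grad_sq \<Omega> u x + g t x"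
      using weak_grad_sq_smooth_AE[OF sP[of t]] weak_grad_sq_smooth_AE[OF u] AE_space
      by eventually_elim (simp add: g_def pdP)
    then have "(LINT x|lebesgue_on \<Omega>. weak_grad_sq \<Omega> (P t) x) = (LINT x|lebesgue_on \<Omega>. weak_grad_sq \<Omega> u x + g t x)"
      using iPg iu ig(1)[of t] by (intro integral_cong_AE) auto
    then have e2: "(LINT x|lebesgue_on \<Omega>. weak_grad_sq \<Omega> (P t) x)
        = (LINT x|lebesgue_on \<Omega>. weak_grad_sq \<Omega> u x) + integral (cbox lo hi) (g t)"
      using iu ig[of t] by simp
    have "0 \<le> L / 2 * integral (cbox lo hi) (g t) + integral (cbox lo hi) (w t)"
      using is_arg_min_F_LG_le(2)[OF c o L min adm iP] unfolding e1 e2 by (simp add: algebra_simps)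
    also have "\<dots> = integral (cbox lo hi) (d t)"
      unfolding d_def using continuous_on_subset[OF gc box] continuous_on_subset[OF wc box]
      by (subst integral_add) (auto intro!: integrable_continuous continuous_intros)
    finally show ?thesis .
  qed
  define d' where "d' t x = L / 2 * (\<Sum>i\<in>Basis. 2 * ((pd i u x + (t * pd i \<psi> x) *\<^sub>R B) \<bullet> (pd i \<psi> x *\<^sub>R B)))
      + bulk_deriv a b c (P t x) (\<psi> x *\<^sub>R B)" for t x
  have "((\<lambda>t. integral (cbox lo hi) (d t)) has_real_derivative integral (cbox lo hi) (d' 0)) (at 0 within UNIV)"
  proof (rule leibniz_rule_field_derivative)
    fix t x
    have 1: "((\<lambda>t. (norm (pd i u x + (t * pd i \<psi> x) *\<^sub>R B))\<^sup>2) has_real_derivative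
        2 * ((pd i u x + (t * pd i \<psi> x) *\<^sub>R B) \<bullet> (pd i \<psi> x *\<^sub>R B))) (at t)" for i
      unfolding power2_norm_eq_inner has_field_derivative_def
      by (auto intro!: derivative_eq_intros simp: inner_commute algebra_simps)
    have "((\<lambda>t. P t x) has_derivative (\<lambda>s. s *\<^sub>R (\<psi> x *\<^sub>R B))) (at t)"
      unfolding P_def by (auto intro!: derivative_eq_intros)
    note comp = has_derivative_compose[OF this bulk_has_derivative[of a b c]]
    have 2: "((\<lambda>t. bulk a b c (P t x)) has_real_derivative bulk_deriv a b c (P t x) (\<psi> x *\<^sub>R B)) (at t)"
      unfolding has_field_derivative_def
      by (rule has_derivative_eq_rhs[OF comp])
        (simp only: linear_scale[OF has_derivative_linear[OF bulk_has_derivative]], simp add: fun_eq_iff)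
    have "((\<lambda>t. L / 2 * ((\<Sum>i\<in>Basis. (norm (pd i u x + (t * pd i \<psi> x) *\<^sub>R B))\<^sup>2) - (\<Sum>i\<in>Basis. (norm (pd i u x))\<^sup>2))
        + (bulk a b c (P t x) - bulk a b c (u x))) has_real_derivative
        L / 2 * ((\<Sum>i\<in>Basis. 2 * ((pd i u x + (t * pd i \<psi> x) *\<^sub>R B) \<bullet> (pd i \<psi> x *\<^sub>R B))) - 0)
        + (bulk_deriv a b c (P t x) (\<psi> x *\<^sub>R B) - 0)) (at t)"
      by (intro DERIV_add DERIV_cmult DERIV_diff DERIV_sum DERIV_const 1 2)
    then show "((\<lambda>t. d t x) has_real_derivative d' t x) (at t within UNIV)"
      by (simp add: d_def g_def w_def d'_def)
  next
    have uc': "continuous_on (UNIV \<times> cbox lo hi) (\<lambda>z::real \<times> (real^3). u (snd z))"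
      by (rule continuous_on_compose2[OF uc continuous_on_snd[OF continuous_on_id]]) (use box in auto)
    have u'c': "continuous_on (UNIV \<times> cbox lo hi) (\<lambda>z::real \<times> (real^3). pd v u (snd z))" if "v \<in> Basis" for v
      by (rule continuous_on_compose2[OF u'c[OF that] continuous_on_snd[OF continuous_on_id]]) (use box in auto)
    have \<psi>c': "continuous_on T (\<lambda>z::real \<times> (real^3). \<psi> (snd z))" for T
      by (rule continuous_on_compose2[OF cont(1)[of UNIV] continuous_on_snd[OF continuous_on_id]]) auto
    have \<psi>'c': "continuous_on T (\<lambda>z::real \<times> (real^3). pd v \<psi> (snd z))" if "v \<in> Basis" for T v
      by (rule continuous_on_compose2[OF cont(2)[OF that, of UNIV] continuous_on_snd[OF continuous_on_id]]) auto
    show "continuous_on (UNIV \<times> cbox lo hi) (\<lambda>(t, x). d' t x)"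
      unfolding d'_def P_def case_prod_beta
      by (intro continuous_intros continuous_on_bulk_deriv uc' u'c' \<psi>c' \<psi>'c')
  qed (use dint in auto)
  then have "((\<lambda>t. integral (cbox lo hi) (d t)) has_real_derivative integral (cbox lo hi) (d' 0)) (at 0)" by simp
  then have "integral (cbox lo hi) (d' 0) = 0"
  proof (rule DERIV_local_min[OF _ zero_less_one], intro allI impI)
    fix t
    have "d 0 = (\<lambda>x. 0)" by (auto simp: d_def g_def w_def P_def)
    then show "integral (cbox lo hi) (d 0) \<le> integral (cbox lo hi) (d t)" using nonneg[of t] by simp
  qed
  moreover have "d' 0 x = L * (\<Sum>i\<in>Basis. pd i \<psi> x * (pd i u x \<bullet> B)) + \<psi> x * bulk_deriv a b c (u x) B" for x
    using linear_scale[OF has_derivative_linear[OF bulk_has_derivative[of a b c "u x"]]]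
    by (simp add: d'_def P_def sum_distrib_left)
  ultimately show ?thesis by (simp add: d'_def cong: integral_cong)
qed

text \<open>If the difference \<open>k\<close> of the two sides were nonzero at \<open>x\<close>, it would have constant sign on a box around \<open>x\<close>.
  After an integration by parts the first variation in the direction of the bump of this box is the integral
  of \<open>\<psi> k\<close>, which would then be nonzero.\<close>

lemma euler_lagrange:
  fixes u :: "real^3 \<Rightarrow> real^3^3"
  assumes c: "c\<^sup>2 > 0" and L: "L > 0"
    and min: "is_arg_min (F_LG a b c \<Omega> L) (\<lambda>P. P \<in> admissible_Q \<Omega> Qb) u"
    and u: "smooth_on \<Omega> u" and uS: "\<And>x. x \<in> \<Omega> \<Longrightarrow> u x \<in> S0"
    and i: "integrable (lebesgue_on \<Omega>) (\<lambda>x. f_B_tilde a b c (u x))"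
    and B: "B \<in> S0" and x: "x \<in> \<Omega>"
  shows "L * (laplacian u x \<bullet> B) = bulk_deriv a b c (u x) B"
proof (rule ccontr)
  note o = smooth_on_open[OF u]
  define k where "k x = bulk_deriv a b c (u x) B - L * (laplacian u x \<bullet> B)" for x
  have u''c: "continuous_on \<Omega> (pd w (pd v u))" if "v \<in> Basis" "w \<in> Basis" for v w
    by (rule smooth_on_continuous_on[OF smooth_on_pd[OF smooth_on_pd[OF u that(1)] that(2)]])
  have lc: "continuous_on \<Omega> (laplacian u)"
    unfolding laplacian_def[abs_def] by (intro continuous_intros u''c)
  have kc: "continuous_on \<Omega> k"
    unfolding k_def by (intro continuous_intros continuous_on_bulk_deriv lc smooth_on_continuous_on[OF u])
  assume "L * (laplacian u x \<bullet> B) \<noteq> bulk_deriv a b c (u x) B"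
  then have kx: "k x \<noteq> 0" by (simp add: k_def)
  have "open {y \<in> \<Omega>. 0 < sgn (k x) * k y}"
    using continuous_open_preimage[OF continuous_on_mult[OF continuous_on_const kc] o open_greaterThan, of "sgn (k x)" 0]
    by (simp add: vimage_def Int_def greaterThan_def conj_commute)
  moreover have "x \<in> {y \<in> \<Omega>. 0 < sgn (k x) * k y}" using x kx by (auto simp: sgn_if)
  ultimately obtain lo hi where box: "cbox lo hi \<subseteq> {y \<in> \<Omega>. 0 < sgn (k x) * k y}" "x \<in> box lo hi"
    by (rule open_contains_cbox)
  then have sub: "cbox lo hi \<subseteq> \<Omega>" and pos: "\<And>y. y \<in> cbox lo hi \<Longrightarrow> 0 < sgn (k x) * k y" by auto
  define \<psi> where "\<psi> = box_bump lo hi"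
  have s\<psi>: "smooth_on UNIV \<psi>" unfolding \<psi>_def by (rule smooth_on_box_bump)
  have \<psi>c: "continuous_on T \<psi>" "v \<in> Basis \<Longrightarrow> continuous_on T (pd v \<psi>)" for T v
    using continuous_on_subset[OF smooth_on_continuous_on[OF s\<psi>]]
      continuous_on_subset[OF smooth_on_continuous_on[OF smooth_on_pd[OF s\<psi>]]] by auto
  have u'c: "continuous_on \<Omega> (pd v u)" if "v \<in> Basis" for v
    by (rule smooth_on_continuous_on[OF smooth_on_pd[OF u that]])
  have off: "\<psi> y = 0" if "y \<notin> cbox lo hi" for y
    unfolding \<psi>_def by (rule box_bump_eq_0_cbox[OF that])
  have off': "pd v \<psi> y = 0" if "y \<notin> cbox lo hi" for v y
    by (rule pd_eq_0_outside_closed[OF closed_cbox off that])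
  define F' where "F' i y v = \<psi> y * (pd v (pd i u) y \<bullet> B) + pd v \<psi> y * (pd i u y \<bullet> B)" for i y v
  have F0: "integral (cbox lo hi) (\<lambda>y. F' i y i) = 0" if i: "i \<in> Basis" for i
  proof -
    have c: "continuous_on \<Omega> (\<lambda>y. F' i y i)"
      unfolding F'_def by (intro continuous_intros \<psi>c u'c u''c i)
    have "(LINT y|lebesgue_on \<Omega>. F' i y i) = 0"
    proof (rule integral_derivative_compact_support(2)[OF o compact_cbox sub, where \<psi>="\<lambda>y. \<psi> y * (pd i u y \<bullet> B)" and \<psi>'="F' i" and v=i])
      show "((\<lambda>y. \<psi> y * (pd i u y \<bullet> B)) has_derivative F' i y) (at y)" if "y \<in> \<Omega>" for y
        unfolding F'_def[abs_def]
        by (intro has_derivative_mult has_derivative_inner_left smooth_on_has_derivative[OF s\<psi> UNIV_I]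
            smooth_on_has_derivative[OF smooth_on_pd[OF u i] that])
    qed (simp_all add: off c)
    then show ?thesis
      using integral_eq_integral_cbox(2)[OF o sub c] off off' by (simp add: F'_def)
  qed
  have int: "f integrable_on cbox lo hi" if "continuous_on \<Omega> f" for f :: "real^3 \<Rightarrow> real"
    using continuous_on_subset[OF that sub] by (rule integrable_continuous)
  have F'c: "continuous_on \<Omega> (\<lambda>y. F' i y i)" if "i \<in> Basis" for i
    unfolding F'_def by (intro continuous_intros \<psi>c u'c u''c that)
  let ?V = "\<lambda>y. L * (\<Sum>i\<in>Basis. pd i \<psi> y * (pd i u y \<bullet> B)) + \<psi> y * bulk_deriv a b c (u y) B"
  have Vc: "continuous_on \<Omega> ?V"
    by (intro continuous_intros continuous_on_bulk_deriv \<psi>c u'c smooth_on_continuous_on[OF u])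
  have "integral (cbox lo hi) (\<lambda>y. ?V y - L * (\<Sum>i\<in>Basis. F' i y i)) = 0"
  proof -
    have "integral (cbox lo hi) (\<lambda>y. \<Sum>i\<in>Basis. F' i y i) = 0"
      by (subst integral_sum) (auto intro: int F'c simp: F0)
    moreover have "integral (cbox lo hi) ?V = 0"
      using first_variation_zero[OF c L min u uS i B sub] by (simp add: \<psi>_def)
    ultimately show ?thesis
      by (subst integral_diff) (auto intro!: int Vc continuous_intros F'c)
  qed
  moreover have "?V y - L * (\<Sum>i\<in>Basis. F' i y i) = \<psi> y * k y" for y
    by (simp add: F'_def k_def laplacian_def sum.distrib inner_sum_left sum_distrib_left algebra_simps)
  ultimately have z: "integral (cbox lo hi) (\<lambda>y. \<psi> y * k y) = 0" by simp
  have ckc: "continuous_on (cbox lo hi) (\<lambda>y. sgn (k x) * (\<psi> y * k y))"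
    by (intro continuous_intros \<psi>c continuous_on_subset[OF kc sub])
  have "((\<lambda>y. sgn (k x) * (\<psi> y * k y)) has_integral 0) (cbox lo hi)"
    using integrable_integral[OF integrable_continuous[OF ckc]] z by simp
  then have "sgn (k x) * (\<psi> x * k x) = 0"
  proof (rule has_integral_0_cbox_imp_0[OF ckc, rotated])
    show "0 \<le> sgn (k x) * (\<psi> y * k y)" if "y \<in> box lo hi" for y
    proof -
      have "0 \<le> \<psi> y * (sgn (k x) * k y)"
      proof (rule mult_nonneg_nonneg)
        show "0 \<le> \<psi> y" by (simp add: \<psi>_def box_bump_nonneg)
        show "0 \<le> sgn (k x) * k y"
          using pos[OF subsetD[OF box_subset_cbox that]] by (rule less_imp_le)
      qed
      then show ?thesis by (simp add: mult_ac)
    qed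
  qed (use box(2) box_subset_cbox[of lo hi] in auto)
  then show False using kx box_bump_pos[OF box(2)] by (simp add: \<psi>_def sgn_if split: if_splits)
qed

section \<open>Uniform smallness of the bulk density\<close>

lemma smooth_on_norm_sq_laplacian:
  fixes u :: "'a::euclidean_space \<Rightarrow> 'b::euclidean_space"
  assumes u: "smooth_on \<Omega> u" and x: "x \<in> \<Omega>"
  shows "laplacian (\<lambda>x. u x \<bullet> u x) x \<ge> 2 * (laplacian u x \<bullet> u x)"
proof -
  have d: "pd v (\<lambda>x. u x \<bullet> u x) y = 2 * (u y \<bullet> pd v u y)" if "y \<in> \<Omega>" for v y
  proof -
    have "((\<lambda>x. u x \<bullet> u x) has_derivative (\<lambda>v. u y \<bullet> pd v u y + pd v u y \<bullet> u y)) (at y)"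
      by (intro has_derivative_inner smooth_on_has_derivative[OF u that])
    from fun_cong[OF frechet_derivative_at[OF this], of v] show ?thesis by (simp add: inner_commute)
  qed
  have s: "smooth_on \<Omega> (\<lambda>x. u x \<bullet> u x)" by (rule smooth_on_bilinear[OF bounded_bilinear_inner u u])
  have "pd v (pd v (\<lambda>x. u x \<bullet> u x)) x \<ge> 2 * (pd v (pd v u) x \<bullet> u x)" if v: "v \<in> Basis" for v
  proof -
    have "pd v (pd v (\<lambda>x. u x \<bullet> u x)) x = pd v (\<lambda>y. 2 * (u y \<bullet> pd v u y)) x"
      by (rule pd_cong[OF smooth_on_pd[OF s v] x d])
    also have "\<dots> = 2 * (u x \<bullet> pd v (pd v u) x + pd v u x \<bullet> pd v u x)"
    proof -
      have "((\<lambda>y. 2 * (u y \<bullet> pd v u y)) has_derivative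
          (\<lambda>w. 2 * (u x \<bullet> pd w (pd v u) x + pd w u x \<bullet> pd v u x))) (at x)"
        by (intro has_derivative_mult_right has_derivative_inner smooth_on_has_derivative[OF u x]
            smooth_on_has_derivative[OF smooth_on_pd[OF u v] x])
      from fun_cong[OF frechet_derivative_at[OF this], of v] show ?thesis by simp
    qed
    finally show ?thesis by (simp add: inner_commute)
  qed
  then show ?thesis unfolding laplacian_def inner_sum_left sum_distrib_left by (intro sum_mono)
qed

lemma closed_subspace_pd_mem:
  fixes u :: "'a::euclidean_space \<Rightarrow> 'b::euclidean_space"
  assumes u: "smooth_on \<Omega> u" and x: "x \<in> \<Omega>" and S: "subspace S" and uS: "\<And>x. x \<in> \<Omega> \<Longrightarrow> u x \<in> S"
  shows "pd v u x \<in> S"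
proof -
  have "((\<lambda>t. (u (x + t *\<^sub>R v) - u x) /\<^sub>R t) \<longlongrightarrow> pd v u x) (at 0)"
    by (rule difference_quotient_tendsto[OF smooth_on_has_derivative[OF u x]])
  moreover have "\<forall>\<^sub>F t in at 0. (u (x + t *\<^sub>R v) - u x) /\<^sub>R t \<in> S"
  proof -
    have "((\<lambda>t. x + t *\<^sub>R v) \<longlongrightarrow> x + 0 *\<^sub>R v) (at 0)" by (intro tendsto_intros)
    then have "\<forall>\<^sub>F t in at 0. x + t *\<^sub>R v \<in> \<Omega>"
      using topological_tendstoD[OF _ smooth_on_open[OF u]] x by fastforce
    then show ?thesis
      by eventually_elim (auto intro!: subspace_scale[OF S] subspace_diff[OF S] uS x)
  qed
  ultimately show ?thesis
    using Lim_in_closed_set[OF closed_subspace[OF S]] by (metis trivial_limit_at)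
qed

text \<open>The constraint holds almost everywhere, hence everywhere: the set where it fails is open.\<close>

lemma smooth_W12_mem_S0:
  assumes u: "smooth_on \<Omega> u" and W: "u \<in> W12 \<Omega> S0" and x: "x \<in> \<Omega>"
  shows "u x \<in> S0"
proof -
  note o = smooth_on_open[OF u]
  define V where "V = {y \<in> \<Omega>. u y \<notin> S0}"
  have "open (\<Omega> \<inter> u -` (- S0))"
    by (rule continuous_open_preimage[OF smooth_on_continuous_on[OF u] o]) (use closed_S0 in auto)
  then have "open V" by (simp add: V_def vimage_def Int_def Compl_eq)
  moreover have "AE y \<in> V in lebesgue. y \<in> {}"
  proof -
    have "AE y in lebesgue_on \<Omega>. u y \<in> S0" using W by (simp add: W12_def)
    then have "AE y \<in> \<Omega> in lebesgue. u y \<in> S0"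
      using o by (subst (asm) AE_restrict_space_iff) auto
    then show ?thesis by eventually_elim (simp add: V_def)
  qed
  ultimately have "x \<notin> V" using mem_closed_if_AE_lebesgue_open[of V "{}" x] by auto
  then show ?thesis using x by (simp add: V_def)
qed

text \<open>The bounds are uniform in \<open>L\<close> and in the solution. Testing the Euler-Lagrange equation with \<open>u\<close> itself and
  using the quartic growth of the bulk density, \<open>|u|\<^sup>2\<close> satisfies the differential inequality of the
  Keller-Osserman bound. Testing it with \<open>\<Delta>u\<close>, whose values lie in \<^const>\<open>S0\<close>, bounds \<open>L |\<Delta>u|\<close> by some \<open>\<Lambda>\<close>, and the
  gradient estimate on cubes of size \<open>sqrt L\<close> applies. These cubes lie within distance \<open>3 sqrt L\<close>.\<close>

lemma interior_bounds:
  assumes c: "c\<^sup>2 > 0" and r: "r > 0"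
  obtains M G where "M \<ge> 0" "G > 0"
    "\<And>(u :: real^3 \<Rightarrow> real^3^3) \<Omega> L x. smooth_on \<Omega> u \<Longrightarrow> (\<And>x. x \<in> \<Omega> \<Longrightarrow> u x \<in> S0) \<Longrightarrow>
      (\<And>x B. x \<in> \<Omega> \<Longrightarrow> B \<in> S0 \<Longrightarrow> L * (laplacian u x \<bullet> B) = bulk_deriv a b c (u x) B) \<Longrightarrow>
      0 < L \<Longrightarrow> L \<le> 1 \<Longrightarrow> 3 * sqrt L \<le> r \<Longrightarrow> cball x (2 * r) \<subseteq> \<Omega> \<Longrightarrow>
      norm (u x) \<le> M \<and> (\<forall>i\<in>Basis. norm (pd i u x) \<le> G / sqrt L)"
proof -
  obtain C0 where C0: "\<And>Q. bulk_deriv a b c Q Q \<ge> (c\<^sup>2 / 2) * norm Q ^ 4 - C0"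
    using bulk_lower_bound[OF c] by metis
  define C where "C = max C0 0"
  have C: "C \<ge> 0" "\<And>Q. bulk_deriv a b c Q Q \<ge> (c\<^sup>2 / 2) * norm Q ^ 4 - C"
    using C0 by (auto simp: C_def) (smt (verit) max.cobounded1)
  obtain K where K: "K \<ge> 0" "\<And>Q H. \<bar>bulk_deriv a b c Q H\<bar> \<le> K * (1 + norm Q ^ 3) * norm H"
    using bulk_deriv_bound by blast
  define M2 where "M2 = 36 / (c\<^sup>2 * r\<^sup>2) + sqrt (2 * C / c\<^sup>2)"
  define M where "M = sqrt M2"
  have M20: "M2 \<ge> 0" using C(1) by (simp add: M2_def)
  then have M0: "M \<ge> 0" by (simp add: M_def)
  define \<Lambda> where "\<Lambda> = K * (1 + M ^ 3)"
  have \<Lambda>0: "\<Lambda> \<ge> 0" using K M0 by (simp add: \<Lambda>_def)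
  define G where "G = 3 * M + (\<Lambda> + 1) / 2"
  have G0: "G > 0" unfolding G_def using M0 \<Lambda>0 by (intro add_nonneg_pos) auto
  have main: "norm (u x) \<le> M \<and> (\<forall>i\<in>Basis. norm (pd i u x) \<le> G / sqrt L)"
    if u: "smooth_on \<Omega> u" and uS: "\<And>x. x \<in> \<Omega> \<Longrightarrow> u x \<in> S0"
      and EL: "\<And>x B. x \<in> \<Omega> \<Longrightarrow> B \<in> S0 \<Longrightarrow> L * (laplacian u x \<bullet> B) = bulk_deriv a b c (u x) B"
      and L: "0 < L" "L \<le> 1" "3 * sqrt L \<le> r" and ball: "cball x (2 * r) \<subseteq> \<Omega>"
    for u :: "real^3 \<Rightarrow> real^3^3" and \<Omega> L x
  proof -
    have bd: "norm (u z) \<le> M" if z: "cball z r \<subseteq> \<Omega>" for z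
    proof -
      have "u z \<bullet> u z \<le> (24 + 4 * DIM(real^3)) / ((c\<^sup>2 / L) * r\<^sup>2) + sqrt ((2 * C / L) / (c\<^sup>2 / L))"
      proof (rule keller_osserman_bound[OF smooth_on_bilinear[OF bounded_bilinear_inner u u] r z])
        fix y assume "y \<in> ball z r"
        then have y: "y \<in> \<Omega>" using z ball_subset_cball by blast
        have "L * (laplacian u y \<bullet> u y) \<ge> (c\<^sup>2 / 2) * norm (u y) ^ 4 - C"
          using EL[OF y uS[OF y]] C(2)[of "u y"] by simp
        then have "laplacian u y \<bullet> u y \<ge> ((c\<^sup>2 / 2) * norm (u y) ^ 4 - C) / L"
          using L(1) by (simp add: pos_divide_le_eq mult.commute)
        moreover have "norm (u y) ^ 4 = (u y \<bullet> u y)\<^sup>2" by (simp add: norm_power4)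
        ultimately have "2 * (laplacian u y \<bullet> u y) \<ge> c\<^sup>2 / L * (u y \<bullet> u y)\<^sup>2 - 2 * C / L"
          by (simp add: diff_divide_distrib)
        then show "c\<^sup>2 / L * (u y \<bullet> u y)\<^sup>2 - 2 * C / L \<le> laplacian (\<lambda>x. u x \<bullet> u x) y"
          using smooth_on_norm_sq_laplacian[OF u y] by linarith
      qed (use c C(1) L in auto)
      also have "\<dots> = 36 * L / (c\<^sup>2 * r\<^sup>2) + sqrt (2 * C / c\<^sup>2)"
        using L(1) by simp
      also have "\<dots> \<le> M2"
      proof -
        have "36 * L / (c\<^sup>2 * r\<^sup>2) \<le> 36 / (c\<^sup>2 * r\<^sup>2)" using L(2) c r by (intro divide_right_mono) auto
        then show ?thesis by (simp add: M2_def)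
      qed
      finally show ?thesis unfolding M_def norm_eq_sqrt_inner by (rule real_sqrt_le_mono)
    qed
    have lap: "norm (laplacian u z) \<le> \<Lambda> / L" if z: "cball z r \<subseteq> \<Omega>" for z
    proof (cases "laplacian u z = 0")
      case False
      have z\<Omega>: "z \<in> \<Omega>" using z r by (meson centre_in_cball less_imp_le subsetD)
      have "pd i (pd i u) z \<in> S0" if "i \<in> Basis" for i
        by (rule closed_subspace_pd_mem[OF smooth_on_pd[OF u that] z\<Omega> subspace_S0])
          (rule closed_subspace_pd_mem[OF u _ subspace_S0 uS])
      then have lS: "laplacian u z \<in> S0" unfolding laplacian_def by (intro subspace_sum[OF subspace_S0])
      have "L * (norm (laplacian u z))\<^sup>2 = bulk_deriv a b c (u z) (laplacian u z)"
        using EL[OF z\<Omega> lS] by (simp add: power2_norm_eq_inner)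
      also have "\<dots> \<le> K * (1 + norm (u z) ^ 3) * norm (laplacian u z)"
        using K(2)[of "u z" "laplacian u z"] by linarith
      also have "\<dots> \<le> \<Lambda> * norm (laplacian u z)"
        unfolding \<Lambda>_def using K(1) bd[OF z] by (intro mult_right_mono mult_left_mono add_left_mono power_mono) auto
      finally have "(L * norm (laplacian u z)) * norm (laplacian u z) \<le> \<Lambda> * norm (laplacian u z)"
        by (simp add: power2_eq_square mult.assoc)
      then have "L * norm (laplacian u z) \<le> \<Lambda>" using False by simp
      then show ?thesis using L(1) by (simp add: pos_le_divide_eq mult.commute)
    qed (use \<Lambda>0 L in simp)
    have sL: "sqrt L > 0" "sqrt L * sqrt L = L" using L(1) by auto
    have grad: "norm (pd i u x) \<le> G / sqrt L" if i: "i \<in> Basis" for i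
    proof -
      have "norm (pd i u x) \<le> DIM(real^3) * M / sqrt L + ((\<Lambda> + 1) / L) * sqrt L / 2"
      proof (rule norm_pd_le_on_cube[OF u i sL(1)])
        fix z assume z: "\<And>j. j \<in> Basis \<Longrightarrow> \<bar>(z - x) \<bullet> j\<bar> \<le> sqrt L"
        have "norm (z - x) \<le> (\<Sum>j\<in>Basis. \<bar>(z - x) \<bullet> j\<bar>)" by (rule norm_le_l1)
        also have "\<dots> \<le> (\<Sum>j\<in>(Basis :: (real^3) set). sqrt L)" by (rule sum_mono[OF z])
        also have "\<dots> \<le> r" using L(3) by simp
        finally have "dist x z \<le> r" by (simp add: dist_norm norm_minus_commute)
        then have zb: "cball z r \<subseteq> \<Omega>"
          using ball by (intro subset_trans[OF _ ball]) (auto simp: subset_iff intro: order_trans[OF dist_triangle[of x _ z]])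
        have "\<Lambda> / L < (\<Lambda> + 1) / L" using L(1) by (intro divide_strict_right_mono) auto
        then show "z \<in> \<Omega> \<and> norm (u z) \<le> M \<and> norm (laplacian u z) < (\<Lambda> + 1) / L"
          using bd[OF zb] lap[OF zb] zb r by (auto intro: order_le_less_trans)
      qed
      also have "\<dots> = G / sqrt L"
      proof -
        have "((\<Lambda> + 1) / L) * sqrt L = (\<Lambda> + 1) / sqrt L"
        proof -
          have "((\<Lambda> + 1) / L) * sqrt L = ((\<Lambda> + 1) / (sqrt L * sqrt L)) * sqrt L"
            by (simp only: sL(2))
          also have "\<dots> = (\<Lambda> + 1) / sqrt L" using sL(1) by (simp del: real_sqrt_mult_self)
          finally show ?thesis .
        qed
        then show ?thesis by (simp add: G_def add_divide_distrib)
      qed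
      finally show ?thesis .
    qed
    have "cball x r \<subseteq> \<Omega>" using r by (intro subset_trans[OF subset_cball ball]) simp
    then show ?thesis by (intro conjI ballI bd grad)
  qed
  show ?thesis by (rule that[OF M0 G0 main])
qed

lemma norm_diff_le_if_pd_bounded:
  fixes u :: "'a::euclidean_space \<Rightarrow> 'b::euclidean_space" and g :: real
  assumes u: "smooth_on \<Omega> u" and S: "S \<subseteq> \<Omega>" "convex S" "x \<in> S" "y \<in> S"
    and bd: "\<And>z i. z \<in> S \<Longrightarrow> i \<in> Basis \<Longrightarrow> norm (pd i u z) \<le> g"
  shows "norm (u x - u y) \<le> DIM('a) * g * norm (x - y)"
proof (rule differentiable_bound[OF S(2) _ _ S(3,4)])
  show "(u has_derivative frechet_derivative u (at z)) (at z within S)" if "z \<in> S" for z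
    using smooth_on_has_derivative[OF u] S(1) that has_derivative_at_withinI by blast
  show "onorm (frechet_derivative u (at z)) \<le> DIM('a) * g" if z: "z \<in> S" for z
  proof (rule onorm_le)
    fix v
    have "pd v u z = (\<Sum>i\<in>Basis. (v \<bullet> i) *\<^sub>R pd i u z)"
      by (rule pd_as_basis_sum[OF u]) (use S(1) z in blast)
    then have "norm (pd v u z) \<le> (\<Sum>i\<in>Basis. \<bar>v \<bullet> i\<bar> * norm (pd i u z))"
      using norm_sum[of "\<lambda>i. (v \<bullet> i) *\<^sub>R pd i u z" Basis] by simp
    also have "\<dots> \<le> (\<Sum>i\<in>(Basis :: 'a set). norm v * g)"
      by (intro sum_mono mult_mono bd[OF z] Basis_le_norm) auto
    finally show "norm (pd v u z) \<le> DIM('a) * g * norm v" by (simp add: mult_ac)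
  qed
qed

lemma integral_subset_le:
  fixes f :: "'a::euclidean_space \<Rightarrow> real"
  assumes "open \<Omega>" "integrable (lebesgue_on \<Omega>) f" "closed B" "B \<subseteq> \<Omega>" "AE x in lebesgue_on \<Omega>. 0 \<le> f x"
  shows "integrable (lebesgue_on B) f" "(LINT x|lebesgue_on B. f x) \<le> (LINT x|lebesgue_on \<Omega>. f x)"
proof -
  show i: "integrable (lebesgue_on B) f"
    by (rule integrable_lebesgue_on_subset[OF assms(2)]) (use assms in auto)
  have B: "B \<inter> space lebesgue \<in> sets lebesgue" using assms(3) by simp
  show "(LINT x|lebesgue_on B. f x) \<le> (LINT x|lebesgue_on \<Omega>. f x)"
    unfolding integral_restrict_space[OF B] integral_restrict_space[OF space_lebesgue_inter[OF assms(1)]]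
  proof (rule integral_mono_AE)
    have "AE x in lebesgue. x \<in> \<Omega> \<longrightarrow> 0 \<le> f x"
      using assms(1,5) by (subst (asm) AE_restrict_space_iff) auto
    then show "AE x in lebesgue. indicat_real B x *\<^sub>R f x \<le> indicat_real \<Omega> x *\<^sub>R f x"
      by eventually_elim (use assms(4) in \<open>auto simp: indicator_def\<close>)
  qed (use i assms(2) in \<open>simp_all only: integrable_restrict_space[OF B] integrable_restrict_space[OF space_lebesgue_inter[OF assms(1)]]\<close>)
qed

lemma integral_const_cball:
  fixes x :: "'a::euclidean_space" and C :: real
  shows "integrable (lebesgue_on (cball x R)) (\<lambda>y. C)"
    and "(LINT y|lebesgue_on (cball x R). C) = C * measure lebesgue (cball x R)"
proof -
  show "integrable (lebesgue_on (cball x R)) (\<lambda>y. C)"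
    using locally_integrable_continuous[OF continuous_on_const, of "cball x R" C]
    by (simp add: locally_integrable_on_def)
  show "(LINT y|lebesgue_on (cball x R). C) = C * measure lebesgue (cball x R)"
    by (simp add: measure_restrict_space)
qed

lemma weak_grad_sq_locally_bounded:
  fixes v :: "real^3 \<Rightarrow> 'b::euclidean_space"
  assumes o: "open \<Omega>" and v: "v \<in> W12 \<Omega> T" and p: "p \<in> \<Omega>" "p \<notin> singularities \<Omega> v"
  obtains r C where "r > 0" "C \<ge> 0" "cball p r \<subseteq> \<Omega>"
    "AE x in lebesgue. x \<in> cball p r \<longrightarrow> weak_grad_sq \<Omega> v x \<le> C"
proof -
  obtain U g where U: "p \<in> U" "U \<subseteq> \<Omega>" "smooth_on U g" "AE x in lebesgue_on U. v x = g x"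
    using p unfolding singularities_def by blast
  note oU = smooth_on_open[OF U(3)]
  obtain r where r: "r > 0" "cball p r \<subseteq> U" using open_contains_cball U(1) oU by blast
  define h where "h x = (\<Sum>i\<in>Basis. (norm (pd i g x))\<^sup>2)" for x
  have "continuous_on U h"
    unfolding h_def by (intro continuous_intros smooth_on_continuous_on[OF smooth_on_pd[OF U(3)]])
  then have "bounded (h ` cball p r)"
    using compact_continuous_image[OF continuous_on_subset] r(2) compact_cball compact_imp_bounded by blast
  then obtain C where "\<forall>x\<in>cball p r. \<bar>h x\<bar> \<le> C" by (auto simp: bounded_iff)
  then have C: "\<bar>h x\<bar> \<le> C" if "x \<in> cball p r" for x using that by blast
  have "0 \<le> C" using C[of p] r(1) by auto
  have "AE x in lebesgue_on U. weak_deriv \<Omega> v i x = pd i g x" if i: "i \<in> Basis" for i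
    by (rule weak_deriv_eq_pd_if_AE_eq_smooth[OF U(3,4) i
          has_weak_deriv_subset[OF o oU U(2) W12_has_weak_deriv[OF v i]]])
  then have "AE x in lebesgue_on U. \<forall>i\<in>Basis. weak_deriv \<Omega> v i x = pd i g x"
    by (simp add: AE_finite_all)
  then have "AE x in lebesgue. x \<in> U \<longrightarrow> (\<forall>i\<in>Basis. weak_deriv \<Omega> v i x = pd i g x)"
    using oU by (subst (asm) AE_restrict_space_iff) auto
  then have "AE x in lebesgue. x \<in> cball p r \<longrightarrow> weak_grad_sq \<Omega> v x \<le> C"
  proof eventually_elim
    case (elim x)
    show ?case
    proof
      assume x: "x \<in> cball p r"
      then have "weak_grad_sq \<Omega> v x = h x" using elim r(2) by (auto simp: weak_grad_sq_def h_def)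
      then show "weak_grad_sq \<Omega> v x \<le> C" using C[OF x] by simp
    qed
  qed
  moreover have "cball p r \<subseteq> \<Omega>" using r(2) U(2) by blast
  ultimately show ?thesis using that r(1) \<open>0 \<le> C\<close> by blast
qed

text \<open>The gradient of \<open>u\<close> is compared with that of \<open>Q0\<close>, which is bounded on the ball; the two global integrals tend
  to zero along the sequence.\<close>

lemma energy_on_ball_le:
  fixes u Q0 :: "real^3 \<Rightarrow> real^3^3"
  assumes c: "c\<^sup>2 > 0" and L: "L > 0" and u: "smooth_on \<Omega> u" and uS: "\<And>x. x \<in> \<Omega> \<Longrightarrow> u x \<in> S0"
    and W: "u \<in> W12 \<Omega> S0" "Q0 \<in> W12 \<Omega> S0"
    and i: "integrable (lebesgue_on \<Omega>) (\<lambda>x. f_B_tilde a b c (u x))"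
    and ball: "cball x R \<subseteq> \<Omega>" and R: "R > 0"
    and C: "AE y in lebesgue. y \<in> cball x R \<longrightarrow> weak_grad_sq \<Omega> Q0 y \<le> C"
    and wc: "continuous_on UNIV w" and w: "\<And>Q. Q \<in> S0 \<Longrightarrow> w Q = f_B_tilde a b c Q"
  shows "(LINT y|lebesgue_on (cball x R). energy_density L w u y) \<le>
    C * measure lebesgue (cball x R) + (LINT y|lebesgue_on \<Omega>. weak_grad_sq \<Omega> (\<lambda>y. u y - Q0 y) y)
      + (LINT y|lebesgue_on \<Omega>. f_B_tilde a b c (u y)) / L"
proof -
  note o = smooth_on_open[OF u]
  let ?d = "weak_grad_sq \<Omega> (\<lambda>y. u y - Q0 y)" and ?f = "\<lambda>y. f_B_tilde a b c (u y)"
  have d: "integrable (lebesgue_on (cball x R)) ?d"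
    "(LINT y|lebesgue_on (cball x R). ?d y) \<le> (LINT y|lebesgue_on \<Omega>. ?d y)"
    using integral_subset_le[OF o integrable_weak_grad_sq[OF o W12_diff[OF o W]] closed_cball ball]
    by (auto simp: weak_grad_sq_nonneg)
  have f0: "AE y in lebesgue_on \<Omega>. 0 \<le> ?f y"
    using f_B_tilde_nonneg[OF c uS] by (intro AE_I2) simp
  note f = integral_subset_le[OF o i closed_cball ball f0]
  note const = integral_const_cball[of x R C]
  have ec: "continuous_on \<Omega> (energy_density L w u)"
    unfolding energy_density_def[abs_def]
    using smooth_on_continuous_on[OF u] smooth_on_continuous_on[OF smooth_on_pd[OF u]] L
    by (intro continuous_intros continuous_on_compose2[OF wc]) auto
  have ei: "integrable (lebesgue_on (cball x R)) (energy_density L w u)"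
    using locally_integrable_continuous[OF ec] ball unfolding locally_integrable_on_def by auto
  have "AE y in lebesgue_on \<Omega>. y \<in> cball x R \<longrightarrow> energy_density L w u y \<le> C + ?d y + ?f y / L"
  proof -
    have "AE y in lebesgue_on \<Omega>. y \<in> cball x R \<longrightarrow> weak_grad_sq \<Omega> Q0 y \<le> C"
      using C o by (subst AE_restrict_space_iff) auto
    with weak_grad_sq_smooth_AE[OF u] weak_grad_sq_triangle_AE[OF o W] AE_space show ?thesis
    proof eventually_elim
      case (elim y)
      then show ?case using w[OF uS, of y] by (auto simp: energy_density_def)
    qed
  qed
  then have "AE y in lebesgue. y \<in> \<Omega> \<longrightarrow> y \<in> cball x R \<longrightarrow> energy_density L w u y \<le> C + ?d y + ?f y / L"
    using o by (subst (asm) AE_restrict_space_iff) auto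
  then have "AE y in lebesgue. y \<in> cball x R \<longrightarrow> energy_density L w u y \<le> C + ?d y + ?f y / L"
    by eventually_elim (use ball in auto)
  then have "AE y in lebesgue_on (cball x R). energy_density L w u y \<le> C + ?d y + ?f y / L"
    by (subst AE_restrict_space_iff) auto
  then have "(LINT y|lebesgue_on (cball x R). energy_density L w u y) \<le>
      (LINT y|lebesgue_on (cball x R). C + ?d y + ?f y / L)"
    by (intro integral_mono_AE ei Bochner_Integration.integrable_add const(1) d(1) integrable_divide f(1))
  also have "\<dots> = C * measure lebesgue (cball x R) + (LINT y|lebesgue_on (cball x R). ?d y)
      + (LINT y|lebesgue_on (cball x R). ?f y) / L"
    using const d(1) f(1) by simp
  also have "\<dots> \<le> C * measure lebesgue (cball x R) + (LINT y|lebesgue_on \<Omega>. ?d y)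
      + (LINT y|lebesgue_on \<Omega>. ?f y) / L"
    using d(2) f(2) L by (intro add_mono divide_right_mono) auto
  finally show ?thesis .
qed

text \<open>At a point where the bulk density is at least \<open>\<delta>\<close> it is at least \<open>\<delta>/2\<close> on a ball of radius
  \<open>\<sigma> = \<kappa> sqrt L\<close>, by the gradient bound. The monotonicity formula transports this to a fixed radius
  \<open>R\<close>, where the energy is at most \<open>O(R\<^sup>3) + o(1)\<close>, a contradiction for small \<open>R\<close> and large index.\<close>

lemma bulk_uniformly_small_near_regular_point:
  fixes u :: "nat \<Rightarrow> real^3 \<Rightarrow> real^3^3"
  assumes c: "c\<^sup>2 > 0" and o: "open \<Omega>" and L: "\<And>k. L k > 0" "L \<longlonglongrightarrow> 0"
    and u: "\<And>k. smooth_on \<Omega> (u k)" and uS: "\<And>k x. x \<in> \<Omega> \<Longrightarrow> u k x \<in> S0"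
    and EL: "\<And>k x B. x \<in> \<Omega> \<Longrightarrow> B \<in> S0 \<Longrightarrow> L k * (laplacian (u k) x \<bullet> B) = bulk_deriv a b c (u k x) B"
    and lim: "tendsto_W12 \<Omega> S0 u Q0"
    and fi: "\<And>k. integrable (lebesgue_on \<Omega>) (\<lambda>x. f_B_tilde a b c (u k x))"
    and bulk0: "(\<lambda>k. (LINT x|lebesgue_on \<Omega>. f_B_tilde a b c (u k x)) / L k) \<longlonglongrightarrow> 0"
    and p: "p \<in> \<Omega>" "p \<notin> singularities \<Omega> Q0"
  obtains \<rho> where "\<rho> > 0" "uniform_limit (ball p \<rho>) (\<lambda>k x. f_B_tilde a b c (u k x)) (\<lambda>x. 0) sequentially"
proof -
  have W: "u k \<in> W12 \<Omega> S0" "Q0 \<in> W12 \<Omega> S0" for k using lim by (auto simp: tendsto_W12_def)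
  obtain r4 C where r4: "r4 > 0" "C \<ge> 0" "cball p r4 \<subseteq> \<Omega>"
    "AE x in lebesgue. x \<in> cball p r4 \<longrightarrow> weak_grad_sq \<Omega> Q0 x \<le> C"
    by (rule weak_grad_sq_locally_bounded[OF o W(2) p])
  define r where "r = r4 / 4"
  have r: "r > 0" "r4 = 4 * r" using r4(1) by (simp_all add: r_def)
  obtain M G where MG: "M \<ge> 0" "G > 0"
    and bounds: "\<And>(u :: real^3 \<Rightarrow> real^3^3) \<Omega> L x. smooth_on \<Omega> u \<Longrightarrow> (\<And>x. x \<in> \<Omega> \<Longrightarrow> u x \<in> S0) \<Longrightarrow>
      (\<And>x B. x \<in> \<Omega> \<Longrightarrow> B \<in> S0 \<Longrightarrow> L * (laplacian u x \<bullet> B) = bulk_deriv a b c (u x) B) \<Longrightarrow>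
      0 < L \<Longrightarrow> L \<le> 1 \<Longrightarrow> 3 * sqrt L \<le> r \<Longrightarrow> cball x (2 * r) \<subseteq> \<Omega> \<Longrightarrow>
      norm (u x) \<le> M \<and> (\<forall>i\<in>Basis. norm (pd i u x) \<le> G / sqrt L)"
    by (rule interior_bounds[OF c r(1), of a b]) blast
  define m where "m = (INF P\<in>S0. f_B a b c P)"
  define w where "w Q = bulk a b c Q - m" for Q
  have w: "w Q = f_B_tilde a b c Q" if "Q \<in> S0" for Q
    using f_B_tilde_eq_bulk[OF that, of a b c] by (simp add: w_def m_def)
  have wder: "(w has_derivative bulk_deriv a b c Q) (at Q)" for Q
    unfolding w_def[abs_def] using has_derivative_diff[OF bulk_has_derivative has_derivative_const] by simp
  have wc: "continuous_on UNIV w" unfolding w_def[abs_def] by (intro continuous_intros continuous_on_bulk)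
  have dc: "continuous_on UNIV (\<lambda>(Q, H). bulk_deriv a b c Q H)"
    unfolding case_prod_beta by (intro continuous_on_bulk_deriv continuous_intros)
  have inside: "cball y (2 * r) \<subseteq> \<Omega>" if "y \<in> cball p (2 * r)" for y
    by (rule subset_trans[OF _ r4(3)])
      (use that in \<open>auto simp: r(2) subset_iff intro: order_trans[OF dist_triangle[of p _ y]]\<close>)
  define V where "V = unit_ball_vol 3"
  have V: "V > 0" by (simp add: V_def unit_ball_vol_pos)
  have vol: "measure lebesgue (cball (y :: real^3) s) = V * s ^ 3" if "s > 0" for y s
    using content_cball[of s y] that by (simp add: V_def)
  have "uniform_limit (ball p r) (\<lambda>k x. f_B_tilde a b c (u k x)) (\<lambda>x. 0) sequentially"
    unfolding uniform_limit_iff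
  proof (intro allI impI)
    fix \<delta> :: real assume \<delta>: "\<delta> > 0"
    have "uniformly_continuous_on (cball 0 M) (f_B_tilde a b c)"
      by (rule compact_uniformly_continuous[OF continuous_on_f_B_tilde compact_cball])
    then obtain \<eta> where \<eta>: "\<eta> > 0" "\<And>Q Q'. Q \<in> cball 0 M \<Longrightarrow> Q' \<in> cball 0 M \<Longrightarrow> dist Q' Q < \<eta> \<Longrightarrow>
        dist (f_B_tilde a b c Q') (f_B_tilde a b c Q) < \<delta> / 2"
      using \<delta> unfolding uniformly_continuous_on_def by (metis half_gt_zero)
    \<comment> \<open>on a ball of radius \<open>\<kappa> sqrt L\<close> the map oscillates by less than \<open>\<eta>\<close>\<close>
    define \<kappa> where "\<kappa> = \<eta> / (6 * G)"
    have \<kappa>: "\<kappa> > 0" "3 * G * \<kappa> < \<eta>" using \<eta>(1) MG(2) by (simp_all add: \<kappa>_def)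
    \<comment> \<open>\<open>R\<close> makes the contribution \<open>6 C R\<^sup>2\<close> of the limit map at most a quarter of \<open>\<delta> \<kappa>\<^sup>2 / 2\<close>\<close>
    define R where "R = min r (sqrt (\<delta> * \<kappa>\<^sup>2 / (48 * (C + 1))))"
    have R: "R > 0" "R \<le> r" using r(1) \<delta> \<kappa>(1) r4(2) by (auto simp: R_def)
    have RC: "6 * C * R\<^sup>2 \<le> \<delta> * \<kappa>\<^sup>2 / 8"
    proof -
      have "R\<^sup>2 \<le> (sqrt (\<delta> * \<kappa>\<^sup>2 / (48 * (C + 1))))\<^sup>2" using R by (intro power_mono) (auto simp: R_def)
      also have "\<dots> = \<delta> * \<kappa>\<^sup>2 / (48 * (C + 1))" using \<delta> r4(2) by simp
      finally have "6 * (C + 1) * R\<^sup>2 \<le> \<delta> * \<kappa>\<^sup>2 / 8" using r4(2) by (simp add: field_simps)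
      moreover have "6 * C * R\<^sup>2 \<le> 6 * (C + 1) * R\<^sup>2" by (intro mult_right_mono) auto
      ultimately show ?thesis by linarith
    qed
    define \<epsilon> where "\<epsilon> k = (LINT y|lebesgue_on \<Omega>. weak_grad_sq \<Omega> (\<lambda>y. u k y - Q0 y) y)
      + (LINT y|lebesgue_on \<Omega>. f_B_tilde a b c (u k y)) / L k" for k
    have sq: "(\<lambda>k. sqrt (L k)) \<longlonglongrightarrow> sqrt 0" by (intro tendsto_intros L)
    have "(\<lambda>k. 6 / R * \<epsilon> k) \<longlonglongrightarrow> 6 / R * (0 + 0)"
      unfolding \<epsilon>_def by (intro tendsto_intros tendsto_W12_grad[OF o lim] bulk0)
    then have "\<forall>\<^sub>F k in sequentially. 6 / R * \<epsilon> k < \<delta> * \<kappa>\<^sup>2 * V / 8"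
      using \<delta> \<kappa>(1) V by (intro order_tendstoD(2)) auto
    moreover have "\<forall>\<^sub>F k in sequentially. 3 * sqrt (L k) < r"
      using order_tendstoD(2)[OF tendsto_mult[OF tendsto_const sq], of 3 r] r(1) by simp
    moreover have "\<forall>\<^sub>F k in sequentially. 2 * (\<kappa> * sqrt (L k)) < R"
      using order_tendstoD(2)[OF tendsto_mult[OF tendsto_const tendsto_mult[OF tendsto_const sq]], of 2 \<kappa> R] R(1) by simp
    moreover have "\<forall>\<^sub>F k in sequentially. L k < 1" using L(2) by (rule order_tendstoD(2)) simp
    ultimately show "\<forall>\<^sub>F k in sequentially. \<forall>x\<in>ball p r. dist (f_B_tilde a b c (u k x)) 0 < \<delta>"
    proof eventually_elim
      case (elim k)
      show ?case
      proof (rule ballI, rule ccontr)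
        fix x assume x: "x \<in> ball p r" and "\<not> dist (f_B_tilde a b c (u k x)) 0 < \<delta>"
        define \<sigma> where "\<sigma> = \<kappa> * sqrt (L k)"
        have sL: "sqrt (L k) > 0" using L(1) by simp
        have \<sigma>: "\<sigma> > 0" "2 * \<sigma> \<le> R" using \<kappa>(1) sL elim(3) by (auto simp: \<sigma>_def)
        have near: "cball x s \<subseteq> cball p (2 * r)" if "s \<le> r" for s
          using x that by (auto simp: subset_iff intro: order_trans[OF dist_triangle[of p _ x]])
        have bd: "norm (u k y) \<le> M" "i \<in> Basis \<Longrightarrow> norm (pd i (u k) y) \<le> G / sqrt (L k)"
          if "y \<in> cball p (2 * r)" for y i
          using bounds[OF u[of k] uS EL L(1) _ _ inside[OF that]] elim by auto
        have sub: "cball p (2 * r) \<subseteq> \<Omega>" using r4(3) r by (intro subset_trans[OF subset_cball r4(3)]) simp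
        have xin: "x \<in> cball p (2 * r)" using x r(1) by simp
        then have x\<Omega>: "x \<in> \<Omega>" using sub by blast
        have fx: "f_B_tilde a b c (u k x) \<ge> \<delta>"
          using \<open>\<not> _ < \<delta>\<close> f_B_tilde_nonneg[OF c uS[OF x\<Omega>], of a b k] by simp
        have half: "\<delta> / 2 \<le> w (u k y)" if y: "y \<in> cball x \<sigma>" for y
        proof -
          have yin: "y \<in> cball p (2 * r)" using near[of \<sigma>] y \<sigma> R by auto
          have "norm (u k y - u k x) \<le> DIM(real^3) * (G / sqrt (L k)) * norm (y - x)"
            by (rule norm_diff_le_if_pd_bounded[OF u sub convex_cball yin xin bd(2)])
          also have "\<dots> \<le> DIM(real^3) * (G / sqrt (L k)) * \<sigma>"
            using y MG(2) sL by (intro mult_left_mono) (auto simp: dist_norm norm_minus_commute)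
          also have "\<dots> = 3 * G * \<kappa>" using sL by (simp add: \<sigma>_def)
          finally have "dist (u k y) (u k x) < \<eta>" using \<kappa>(2) by (simp add: dist_norm)
          from \<eta>(2)[OF _ _ this] bd(1)[OF yin] bd(1)[OF xin]
          have "dist (f_B_tilde a b c (u k y)) (f_B_tilde a b c (u k x)) < \<delta> / 2" by simp
          moreover have "w (u k y) = f_B_tilde a b c (u k y)" by (rule w[OF uS]) (use yin sub in blast)
          ultimately show ?thesis using fx by (simp add: dist_real_def abs_if split: if_splits)
        qed
        have ballR: "cball x R \<subseteq> \<Omega>" using near[OF R(2)] sub by blast
        have "cball x \<sigma> \<subseteq> cball x R" using \<sigma> by (intro subset_cball) simp
        then have ball\<sigma>: "cball x \<sigma> \<subseteq> \<Omega>" using ballR by blast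
        have wi: "integrable (lebesgue_on (cball x \<sigma>)) (\<lambda>y. w (u k y) / L k)"
        proof -
          have "continuous_on \<Omega> (\<lambda>y. w (u k y) / L k)"
            using continuous_on_compose2[OF wc smooth_on_continuous_on[OF u[of k]]] L(1)[of k]
            by (intro continuous_intros) auto
          from locally_integrable_continuous[OF this] show ?thesis
            using ball\<sigma> unfolding locally_integrable_on_def by auto
        qed
        have "\<delta> / 2 / L k * (V * \<sigma> ^ 3) = (LINT y|lebesgue_on (cball x \<sigma>). \<delta> / 2 / L k)"
          by (simp only: integral_const_cball(2) vol[OF \<sigma>(1)])
        also have "\<dots> \<le> (LINT y|lebesgue_on (cball x \<sigma>). w (u k y) / L k)"
        proof (rule integral_mono[OF integral_const_cball(1) wi])
          show "\<delta> / 2 / L k \<le> w (u k y) / L k" if "y \<in> space (lebesgue_on (cball x \<sigma>))" for y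
            using half[of y] that L(1)[of k] by (intro divide_right_mono) auto
        qed
        also have "\<dots> \<le> 6 * \<sigma> / R * (LINT y|lebesgue_on (cball x R). energy_density (L k) w (u k) y)"
        proof (rule bulk_monotonicity[OF _ u L(1) wder dc _ _ \<sigma> ballR])
          show "0 \<le> w (u k y)" if "y \<in> \<Omega>" for y
            using w[OF uS[OF that]] f_B_tilde_nonneg[OF c uS[OF that]] by simp
          show "L k * (laplacian (u k) y \<bullet> pd i (u k) y) = bulk_deriv a b c (u k y) (pd i (u k) y)"
            if "y \<in> \<Omega>" for y i
            by (rule EL[OF that closed_subspace_pd_mem[OF u that subspace_S0 uS]])
        qed simp
        also have "\<dots> \<le> 6 * \<sigma> / R * (C * (V * R ^ 3) + \<epsilon> k)"
        proof (rule mult_left_mono)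
          have "AE y in lebesgue. y \<in> cball x R \<longrightarrow> weak_grad_sq \<Omega> Q0 y \<le> C"
            using r4(4) by eventually_elim (use near[OF R(2)] r in \<open>auto simp: subset_iff\<close>)
          from energy_on_ball_le[OF c L(1)[of k] u[of k] uS W fi ballR R(1) this wc w]
          show "(LINT y|lebesgue_on (cball x R). energy_density (L k) w (u k) y) \<le> C * (V * R ^ 3) + \<epsilon> k"
            by (simp add: vol[OF R(1)] \<epsilon>_def add.assoc)
        qed (use \<sigma> R in simp)
        also have "\<dots> = \<sigma> * ((6 * C * R\<^sup>2) * V + 6 / R * \<epsilon> k)"
          using R(1) by (simp add: field_simps power2_eq_square power3_eq_cube)
        finally have "\<sigma> * (\<delta> / 2 * (V * (\<sigma>\<^sup>2 / L k))) \<le> \<sigma> * ((6 * C * R\<^sup>2) * V + 6 / R * \<epsilon> k)"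
          by (simp add: power2_eq_square power3_eq_cube mult_ac)
        then have "\<delta> / 2 * (V * (\<sigma>\<^sup>2 / L k)) \<le> (6 * C * R\<^sup>2) * V + 6 / R * \<epsilon> k"
          using \<sigma>(1) mult_le_cancel_left_pos by blast
        moreover have "\<sigma>\<^sup>2 / L k = \<kappa>\<^sup>2" using L(1)[of k] by (simp add: \<sigma>_def power_mult_distrib)
        then have "\<delta> / 2 * (V * (\<sigma>\<^sup>2 / L k)) = \<delta> * \<kappa>\<^sup>2 * V / 2" by simp
        moreover have "(6 * C * R\<^sup>2) * V \<le> \<delta> * \<kappa>\<^sup>2 / 8 * V" using RC V by (intro mult_right_mono) auto
        then have "(6 * C * R\<^sup>2) * V \<le> \<delta> * \<kappa>\<^sup>2 * V / 8" by simp
        moreover have "0 < \<delta> * \<kappa>\<^sup>2 * V" using \<delta> \<kappa>(1) V by simp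
        ultimately show False using elim(1) by linarith
      qed
    qed
  qed
  with that r(1) show ?thesis by blast
qed

theorem proposition4:
  fixes a b c :: real
    and \<Omega> K :: "(real^3) set"
    and nb :: "real^3 \<Rightarrow> real^3"
    and Q :: "real \<Rightarrow> real^3 \<Rightarrow> real^3^3"
    and Q0 :: "real^3 \<Rightarrow> real^3^3"
    and Lk :: "nat \<Rightarrow> real"
  assumes "a\<^sup>2 > 0" "b\<^sup>2 > 0" "c\<^sup>2 > 0"
    and "open \<Omega>" "bounded \<Omega>" "simply_connected \<Omega>" "smooth_boundary \<Omega>"
    and "smooth_map_on (frontier \<Omega>) nb" "nb ` frontier \<Omega> \<subseteq> sphere 0 1"
    and minimizer: "\<And>L. L > 0 \<Longrightarrow>
          is_arg_min (F_LG a b c \<Omega> L)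
            (\<lambda>P. P \<in> admissible_Q \<Omega> (uniaxial (s_plus a b c) nb)) (Q L)"
    and smooth_representative: "\<And>L. L > 0 \<Longrightarrow> smooth_on \<Omega> (Q L)"
    and "\<And>k. Lk k > 0" "Lk \<longlonglongrightarrow> 0"
    and "tendsto_W12 \<Omega> S0 (\<lambda>k. Q (Lk k)) Q0"
    and "limiting_harmonic_map (s_plus a b c) \<Omega> nb Q0"
    and "compact K" "K \<subseteq> \<Omega>" "K \<inter> singularities \<Omega> Q0 = {}"
  shows "uniform_limit K (\<lambda>k x. f_B_tilde a b c (Q (Lk k) x)) (\<lambda>x. 0) sequentially"
proof -
  let ?Qb = "uniaxial (s_plus a b c) nb"
  define u where "u k = Q (Lk k)" for k
  have o: "open \<Omega>" and c: "c\<^sup>2 > 0" and L: "\<And>k. Lk k > 0" "Lk \<longlonglongrightarrow> 0" by fact+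
  have min: "is_arg_min (F_LG a b c \<Omega> (Lk k)) (\<lambda>P. P \<in> admissible_Q \<Omega> ?Qb) (u k)" for k
    unfolding u_def by (rule minimizer[OF L(1)])
  have su: "smooth_on \<Omega> (u k)" for k unfolding u_def by (rule smooth_representative[OF L(1)])
  have lim: "tendsto_W12 \<Omega> S0 u Q0" unfolding u_def by fact
  have uS: "u k x \<in> S0" if "x \<in> \<Omega>" for k x
    by (rule smooth_W12_mem_S0[OF su _ that]) (use lim in \<open>simp add: tendsto_W12_def\<close>)
  have Qb: "?Qb x \<in> S0" if "x \<in> frontier \<Omega>" for x
    by (rule uniaxial_in_S0) (use that \<open>nb ` frontier \<Omega> \<subseteq> sphere 0 1\<close> in auto)
  have bulk: "integrable (lebesgue_on \<Omega>) (\<lambda>x. f_B_tilde a b c (u k x))" for k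
    by (rule bulk_energy_over_L_tendsto_0(1)[OF c o \<open>bounded \<Omega>\<close> L Qb min su uS lim])
  have bulk0: "(\<lambda>k. (LINT x|lebesgue_on \<Omega>. f_B_tilde a b c (u k x)) / Lk k) \<longlonglongrightarrow> 0"
    by (rule bulk_energy_over_L_tendsto_0(2)[OF c o \<open>bounded \<Omega>\<close> L Qb min su uS lim])
  have EL: "Lk k * (laplacian (u k) x \<bullet> B) = bulk_deriv a b c (u k x) B" if "x \<in> \<Omega>" "B \<in> S0" for k x B
    by (rule euler_lagrange[OF c L(1) min su uS bulk that(2,1)])
  have "\<exists>\<rho>>0. uniform_limit (ball p \<rho>) (\<lambda>k x. f_B_tilde a b c (u k x)) (\<lambda>x. 0) sequentially" if "p \<in> K" for p
  proof -
    have p: "p \<in> \<Omega>" "p \<notin> singularities \<Omega> Q0"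
      using that \<open>K \<subseteq> \<Omega>\<close> \<open>K \<inter> singularities \<Omega> Q0 = {}\<close> by auto
    show ?thesis
    proof (rule bulk_uniformly_small_near_regular_point[OF c o L su uS EL lim bulk bulk0 p])
      fix \<rho> :: real
      assume "\<rho> > 0" "uniform_limit (ball p \<rho>) (\<lambda>k x. f_B_tilde a b c (u k x)) (\<lambda>x. 0) sequentially"
      then show ?thesis by (intro exI conjI)
    qed
  qed
  then obtain \<rho> where \<rho>: "\<And>p. p \<in> K \<Longrightarrow> \<rho> p > 0"
    "\<And>p. p \<in> K \<Longrightarrow> uniform_limit (ball p (\<rho> p)) (\<lambda>k x. f_B_tilde a b c (u k x)) (\<lambda>x. 0) sequentially"
    by metis
  have cover: "K \<subseteq> (\<Union>p\<in>K. ball p (\<rho> p))" using \<rho>(1) by force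
  obtain C where C: "C \<subseteq> K" "finite C" "K \<subseteq> (\<Union>p\<in>C. ball p (\<rho> p))"
    using compactE_image[OF \<open>compact K\<close> _ cover] by (metis open_ball)
  have "uniform_limit (\<Union>p\<in>C. ball p (\<rho> p)) (\<lambda>k x. f_B_tilde a b c (u k x)) (\<lambda>x. 0) sequentially"
    by (rule uniform_limit_on_UNION[OF C(2)]) (use C(1) \<rho>(2) in blast)
  from uniform_limit_on_subset[OF this C(3)]
  show ?thesis unfolding u_def .
qed

end
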